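(* Let $\Phi$ be a shuffle. Let $f$ be an excursion and let $(f_n)$ be a sequence of excursions such that $f_n\to f$ for the Skorokhod topology on $[-1,1]$. If $B_f\cap \mathrm{B}(\Phi)=\emptyset$, then the convergence $\widetilde{\mathscr{V}}_{f_n}\to\widetilde{\mathscr{V}}_f$ holds for the pointed Gromov–Hausdorff–Prokhorov topology.
   Context: A càdlàg function is right-continuous with left limits; càglàd means left-continuous with right limits. The space of càdlàg functions $[-1,1]\to\mathbb{R}$ has the Skorokhod topology induced by $\rho(f_1,f_2)=\inf_{\lambda}\max(\|\lambda-\mathsf{id}\|_\infty,\|f_1-f_2\circ\lambda\|_\infty)$, infimum over increasing bijections $\lambda$ of $[-1,1]$. For a càdlàg $f$ write $f(t-)=\lim_{s\to t-}f(s)$, $\Delta_t(f)=f(t)-f(t-)$, $x_s^t(f)=\mathbf{1}_{\{s\le t\}}\max\big(\inf_{[s,t]}f-f(s-),0\big)$; we drop $f$ when clear. An excursion is a nonnegative càdlàg function $f:[-1,1]\to[0,\infty)$ such that $f(s)=f(1)=0$ for all $s\in[-1,0)$ and $\Delta_t(f)\ge 0$ for all $t\in[0,1]$. $(\mathcal{C},\delta)$ is the metric circle of perimeter $1$, i.e. $[0,1]$ with the pseudo-distance $\delta(a,b)=\min(|a-b|,1-|a-b|)$ (so $0$ and $1$ are identified). $\overleftarrow{\mathbb{D}}([0,1],\mathcal{C})$ is the set of càglàd functions $[0,1]\to\mathcal{C}$ with the Skorokhod distance $\inf_{\lambda}\max\big(\|\lambda-\mathsf{id}\|_\infty,\sup_{x\in[0,1]}\delta(\phi_1(x),\phi_2\circ\lambda(x))\big)$,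 infimum over increasing bijections $\lambda$ of $[0,1]$. A shuffle is a Borel map $\Phi:\Delta\in(0,\infty)\mapsto\phi_\Delta\in\overleftarrow{\mathbb{D}}([0,1],\mathcal{C})$ such that for all $\Delta>0$, $\phi_\Delta$ is surjective, $\sup_{u\in(0,\Delta]}\sup_{x\in(0,1]}\left|\frac{2}{x}\delta(\phi_u(0),\phi_u(x))-1\right|<\infty$, and $\sup_{x\in(0,1]}\left|\frac{2}{x}\delta(\phi_\Delta(0),\phi_\Delta(x))-1\right|\to0$ as $\Delta\to0^+$. Given a shuffle $\Phi$ and an excursion $f$, for $s\in[0,1]$ let $\tilde\delta_s(x,y)=\Delta_s\,\delta\big(\phi_{\Delta_s}(x/\Delta_s),\phi_{\Delta_s}(y/\Delta_s)\big)$ for $x,y\in[0,\Delta_s]$ if $\Delta_s>0$, and $\tilde\delta_s=0$ if $\Delta_s=0$. Define pseudo-distances on $[-1,1]$ by $\widetilde d^{\mathsf{L}}_f(s,t)=\sum_{r\in[0,1]}\tilde\delta_r(x_r^s,x_r^t)$; $d^{\mathsf{T}}_f(s,t)=d^{\mathsf{T}}_f(t,s)=f(s)+f(t)-2\inf_{[s,t]}f-\sum_{r\in[0,1]}|x_r^s-x_r^t|$ for $s\le t$; $\widetilde d^{\mathsf{V}}_f=d^{\mathsf{T}}_f+2\widetilde d^{\mathsf{L}}_f$. The shuffled vernation tree $\widetilde{\mathscr{V}}_f$ is the quotient metric space of $[0,1]$ induced by $\widetilde d^{\mathsf{V}}_f$ (identify points at pseudo-distance $0$; it is compact), pointed at the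 projection of $1$ and equipped with the pushforward of Lebesgue measure on $[0,1]$ by the projection. $\mathrm{B}(\Phi)=\mathrm{B}^1(\Phi)\cup\mathrm{B}^2(\Phi)$, where $\mathrm{B}^1(\Phi)=\{\Delta>0:\Phi\text{ is discontinuous at }\Delta\text{ for the Skorokhod topology}\}$ and $\mathrm{B}^2(\Phi)=\{(\Delta,x)\in(0,\infty)\times[0,1]:\phi_\Delta\text{ is discontinuous at }x\}$. $B_f=B_f^1\cup B_f^2$, where $B_f^1=\{\Delta_t:t\in[0,1],\Delta_t>0\}$ and $B_f^2=\{(\Delta_r,x_r^t/\Delta_r):r,s,t\in[0,1],\ s\ne t,\ \Delta_r>0,\ x_r^t=x_r^s>0\}$. The pointed Gromov–Hausdorff–Prokhorov distance between pointed weighted (= with Borel probability measure) compact metric spaces $(X_i,d_i,a_i,\mu_i)$, $i=1,2$, is $\inf_{\mathcal{R},\nu}\max\big(\tfrac12\mathrm{dis}(\mathcal{R}),1-\nu(\mathcal{R})\big)$, over couplings $\nu$ of $\mu_1,\mu_2$ and compact correspondences $\mathcal{R}\subset X_1\times X_2$ (both coordinate projections of $\mathcal R$ are onto) with $(a_1,a_2)\in\mathcal{R}$, where $\mathrm{dis}(\mathcal{R})=\sup\{|d_1(x_1,y_1)-d_2(x_2,y_2)|:(x_1,x_2),(y_1,y_2)\in\mathcal{R}\}$. *)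

theory Defs
  imports "HOL-Probability.Probability"
begin

section \<open>Skorokhod distance and excursions\<close>

definition increasing_bijections :: "real \<Rightarrow> real \<Rightarrow> (real \<Rightarrow> real) set" where
  "increasing_bijections a b =
     {l. strict_mono_on {a..b} l \<and> bij_betw l {a..b} {a..b}}"

text \<open>Functions on \<open>[a, b]\<close> are total functions; only their values on \<open>[a, b]\<close> matter here and
  in all notions below. \<open>D\<close> is the (pseudo-)distance of the target space. The suprema are
  taken in the reals: they are suprema of bounded sets for cadlag real functions and for functions
  with values in the circle.\<close>

definition skorokhod_dist ::
  "real \<Rightarrow> real \<Rightarrow> ('b \<Rightarrow> 'b \<Rightarrow> real) \<Rightarrow> (real \<Rightarrow> 'b) \<Rightarrow> (real \<Rightarrow> 'b) \<Rightarrow> real" where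
  "skorokhod_dist a b D f g =
     (INF l\<in>increasing_bijections a b.
        max (SUP x\<in>{a..b}. \<bar>l x - x\<bar>) (SUP x\<in>{a..b}. D (f x) (g (l x))))"

definition cadlag :: "(real \<Rightarrow> real) \<Rightarrow> bool" where
  "cadlag f \<longleftrightarrow>
     (\<forall>t\<in>{-1..<1}. continuous (at_right t) f) \<and>
     (\<forall>t\<in>{-1<..1}. \<exists>l. (f \<longlongrightarrow> l) (at_left t))"

definition left_lim :: "(real \<Rightarrow> real) \<Rightarrow> real \<Rightarrow> real" where
  "left_lim f t = Lim (at_left t) f"

definition jump :: "(real \<Rightarrow> real) \<Rightarrow> real \<Rightarrow> real" where
  "jump f t = f t - left_lim f t"

text \<open>\<open>xval f s t\<close> is the quantity usually written \<open>x\<close> with lower index \<open>s\<close> and upper index \<open>t\<close>.\<close>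

definition xval :: "(real \<Rightarrow> real) \<Rightarrow> real \<Rightarrow> real \<Rightarrow> real" where
  "xval f s t = (if s \<le> t then max ((INF u\<in>{s..t}. f u) - left_lim f s) 0 else 0)"

definition excursion :: "(real \<Rightarrow> real) \<Rightarrow> bool" where
  "excursion f \<longleftrightarrow>
     cadlag f \<and> (\<forall>t\<in>{-1..1}. 0 \<le> f t) \<and>
     (\<forall>s\<in>{-1..<0}. f s = 0) \<and> f 1 = 0 \<and> (\<forall>t\<in>{0..1}. 0 \<le> jump f t)"

section \<open>The circle and shuffles\<close>

text \<open>The circle of perimeter 1 is kept as the interval \<open>[0, 1]\<close> with a pseudo-distance that
  identifies 0 and 1. Convergence, surjectivity and so on are understood modulo this
  identification.\<close>

definition circ :: "real \<Rightarrow> real \<Rightarrow> real" where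
  "circ a b = min \<bar>a - b\<bar> (1 - \<bar>a - b\<bar>)"

definition caglad_circ :: "(real \<Rightarrow> real) set" where
  "caglad_circ =
     {\<phi>. (\<forall>x\<in>{0..1}. \<phi> x \<in> {0..1}) \<and>
         (\<forall>x\<in>{0<..1}. ((\<lambda>y. circ (\<phi> y) (\<phi> x)) \<longlongrightarrow> 0) (at_left x)) \<and>
         (\<forall>x\<in>{0..<1}. \<exists>c\<in>{0..1}. ((\<lambda>y. circ (\<phi> y) c) \<longlongrightarrow> 0) (at_right x))}"

abbreviation skorokhod_circ :: "(real \<Rightarrow> real) \<Rightarrow> (real \<Rightarrow> real) \<Rightarrow> real" where
  "skorokhod_circ \<equiv> skorokhod_dist 0 1 circ"

definition skorokhod_circ_open :: "(real \<Rightarrow> real) set \<Rightarrow> bool" where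
  "skorokhod_circ_open U \<longleftrightarrow>
     U \<subseteq> caglad_circ \<and>
     (\<forall>\<phi>\<in>U. \<exists>e>0. \<forall>\<psi>\<in>caglad_circ. skorokhod_circ \<phi> \<psi> < e \<longrightarrow> \<psi> \<in> U)"

definition skorokhod_circ_borel :: "(real \<Rightarrow> real) measure" where
  "skorokhod_circ_borel = sigma caglad_circ {U. skorokhod_circ_open U}"

definition surj_circ :: "(real \<Rightarrow> real) \<Rightarrow> bool" where
  "surj_circ \<phi> \<longleftrightarrow> (\<forall>c\<in>{0..1}. \<exists>x\<in>{0..1}. circ (\<phi> x) c = 0)"

definition deviation :: "(real \<Rightarrow> real) \<Rightarrow> real \<Rightarrow> real" where
  "deviation \<phi> x = \<bar>2 / x * circ (\<phi> 0) (\<phi> x) - 1\<bar>"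

definition shuffle :: "(real \<Rightarrow> real \<Rightarrow> real) \<Rightarrow> bool" where
  "shuffle \<Phi> \<longleftrightarrow>
     \<Phi> \<in> restrict_space borel {0<..} \<rightarrow>\<^sub>M skorokhod_circ_borel \<and>
     (\<forall>\<Delta>>0. surj_circ (\<Phi> \<Delta>)) \<and>
     (\<forall>\<Delta>>0. bdd_above ((\<lambda>(u, x). deviation (\<Phi> u) x) ` ({0<..\<Delta>} \<times> {0<..1}))) \<and>
     ((\<lambda>\<Delta>. SUP x\<in>{0<..1}. deviation (\<Phi> \<Delta>) x) \<longlongrightarrow> 0) (at_right 0)"

definition disc1 :: "(real \<Rightarrow> real \<Rightarrow> real) \<Rightarrow> real set" where
  "disc1 \<Phi> = {\<Delta>. 0 < \<Delta> \<and> \<not> ((\<lambda>u. skorokhod_circ (\<Phi> u) (\<Phi> \<Delta>)) \<longlongrightarrow> 0) (at \<Delta>)}"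

definition disc2 :: "(real \<Rightarrow> real \<Rightarrow> real) \<Rightarrow> (real \<times> real) set" where
  "disc2 \<Phi> = {(\<Delta>, x). 0 < \<Delta> \<and> x \<in> {0..1} \<and>
     \<not> ((\<lambda>y. circ (\<Phi> \<Delta> y) (\<Phi> \<Delta> x)) \<longlongrightarrow> 0) (at x within {0..1})}"

text \<open>Both B-sets are unions of a subset of the line and a subset of the plane, hence
  disjoint unions.\<close>

definition disc :: "(real \<Rightarrow> real \<Rightarrow> real) \<Rightarrow> (real + real \<times> real) set" where
  "disc \<Phi> = disc1 \<Phi> <+> disc2 \<Phi>"

definition bset1 :: "(real \<Rightarrow> real) \<Rightarrow> real set" where
  "bset1 f = {jump f t | t. t \<in> {0..1} \<and> 0 < jump f t}"

definition bset2 :: "(real \<Rightarrow> real) \<Rightarrow> (real \<times> real) set" where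
  "bset2 f = {(jump f r, xval f r t / jump f r) | r s t.
     r \<in> {0..1} \<and> s \<in> {0..1} \<and> t \<in> {0..1} \<and> s \<noteq> t \<and>
     0 < jump f r \<and> xval f r t = xval f r s \<and> 0 < xval f r s}"

definition bset :: "(real \<Rightarrow> real) \<Rightarrow> (real + real \<times> real) set" where
  "bset f = bset1 f <+> bset2 f"

section \<open>The pseudo-distances\<close>

definition loop_dist ::
  "(real \<Rightarrow> real \<Rightarrow> real) \<Rightarrow> (real \<Rightarrow> real) \<Rightarrow> real \<Rightarrow> real \<Rightarrow> real \<Rightarrow> real" where
  "loop_dist \<Phi> f s x y =
     (if 0 < jump f s
      then jump f s * circ (\<Phi> (jump f s) (x / jump f s)) (\<Phi> (jump f s) (y / jump f s))
      else 0)"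

text \<open>The families summed below are summable when \<open>f\<close> is an excursion and \<open>\<Phi>\<close> is a shuffle.\<close>

definition dL ::
  "(real \<Rightarrow> real \<Rightarrow> real) \<Rightarrow> (real \<Rightarrow> real) \<Rightarrow> real \<Rightarrow> real \<Rightarrow> real" where
  "dL \<Phi> f s t = (\<Sum>\<^sub>\<infinity>r\<in>{0..1}. loop_dist \<Phi> f r (xval f r s) (xval f r t))"

definition dT :: "(real \<Rightarrow> real) \<Rightarrow> real \<Rightarrow> real \<Rightarrow> real" where
  "dT f s t = f s + f t - 2 * (INF u\<in>{min s t..max s t}. f u)
     - (\<Sum>\<^sub>\<infinity>r\<in>{0..1}. \<bar>xval f r s - xval f r t\<bar>)"

definition dV ::
  "(real \<Rightarrow> real \<Rightarrow> real) \<Rightarrow> (real \<Rightarrow> real) \<Rightarrow> real \<Rightarrow> real \<Rightarrow> real" where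
  "dV \<Phi> f s t = dT f s t + 2 * dL \<Phi> f s t"

section \<open>Pointed weighted metric spaces and the shuffled vernation tree\<close>

record 'a pointed_weighted_space =
  pts :: "'a set"
  mdist :: "'a \<Rightarrow> 'a \<Rightarrow> real"
  base :: 'a
  mass :: "'a measure"

abbreviation pw_topology :: "'a pointed_weighted_space \<Rightarrow> 'a topology" where
  "pw_topology X \<equiv> Metric_space.mtopology (pts X) (mdist X)"

definition zero_rel :: "'a set \<Rightarrow> ('a \<Rightarrow> 'a \<Rightarrow> real) \<Rightarrow> 'a rel" where
  "zero_rel S d = {(x, y). x \<in> S \<and> y \<in> S \<and> d x y = 0}"

text \<open>The value does not depend on the representatives if \<open>d\<close> is a pseudo-distance on \<open>S\<close>.
  Outside the quotient the value is 0, so that it is nonnegative and symmetric on the whole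
  type, as the locale \<open>Metric_space\<close> demands.\<close>

definition quotient_dist ::
  "'a set \<Rightarrow> ('a \<Rightarrow> 'a \<Rightarrow> real) \<Rightarrow> 'a set \<Rightarrow> 'a set \<Rightarrow> real" where
  "quotient_dist S d A B =
     (if A \<in> S // zero_rel S d \<and> B \<in> S // zero_rel S d
      then d (SOME x. x \<in> A) (SOME y. y \<in> B) else 0)"

definition borel_of_topology :: "'a topology \<Rightarrow> 'a measure" where
  "borel_of_topology T = sigma (topspace T) {U. openin T U}"

definition shuffled_vernation_tree ::
  "(real \<Rightarrow> real \<Rightarrow> real) \<Rightarrow> (real \<Rightarrow> real) \<Rightarrow> real set pointed_weighted_space" where
  "shuffled_vernation_tree \<Phi> f =
     (let S = {0..1};
          R = zero_rel S (dV \<Phi> f);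
          Q = S // R;
          D = quotient_dist S (dV \<Phi> f);
          proj = (\<lambda>t. R `` {t})
      in \<lparr> pts = Q, mdist = D, base = proj 1,
           mass = distr (restrict_space lborel S)
                    (borel_of_topology (Metric_space.mtopology Q D)) proj \<rparr>)"

section \<open>The pointed Gromov-Hausdorff-Prokhorov distance\<close>

definition couplings :: "'a measure \<Rightarrow> 'b measure \<Rightarrow> ('a \<times> 'b) measure set" where
  "couplings M N = {\<nu>. prob_space \<nu> \<and> sets \<nu> = sets (M \<Otimes>\<^sub>M N) \<and>
     distr \<nu> M fst = M \<and> distr \<nu> N snd = N}"

definition compact_correspondences ::
  "'a pointed_weighted_space \<Rightarrow> 'b pointed_weighted_space \<Rightarrow> ('a \<times> 'b) set set" where
  "compact_correspondences X Y =
     {R. compactin (prod_topology (pw_topology X) (pw_topology Y)) R \<and>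
         fst ` R = pts X \<and> snd ` R = pts Y \<and> (base X, base Y) \<in> R}"

text \<open>Valued in \<open>ennreal\<close>, so that unbounded distortions and empty infima give infinity rather than
  an unspecified real number.\<close>

definition distortion ::
  "'a pointed_weighted_space \<Rightarrow> 'b pointed_weighted_space \<Rightarrow> ('a \<times> 'b) set \<Rightarrow> ennreal" where
  "distortion X Y R =
     (SUP ((x1, x2), (y1, y2))\<in>R \<times> R. ennreal \<bar>mdist X x1 y1 - mdist Y x2 y2\<bar>)"

definition GHP_dist ::
  "'a pointed_weighted_space \<Rightarrow> 'b pointed_weighted_space \<Rightarrow> ennreal" where
  "GHP_dist X Y =
     (INF (R, \<nu>)\<in>compact_correspondences X Y \<times> couplings (mass X) (mass Y).
        max (distortion X Y R / 2) (ennreal (1 - measure \<nu> R)))"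

end

theory Submission imports Defs begin

text \<open>Composing \<open>f\<^sub>n\<close> with the inverse of a nearly optimal time change gives paths \<open>g\<close> that are uniformly
  close to \<open>f\<close> and code the same tree, so everything reduces to the dependence of the tree distance
  on a path with nonnegative jumps.

  Write \<open>l\<close> for the level at which the loop of a jump time starts and \<open>x\<close> for the coordinate of a given
  time on this loop. The level intervals \<open>(l, l + x)\<close> of the loops met on the way down are disjoint. This makes the sums
  finite and turns the skeleton part of the distance into a length of branches, whence the triangle
  inequality. All but one of the loops contribute almost nothing when their perimeter is small, because
  there \<open>x\<close> is the same at both times, or vanishes at one of them and the deviation controls the term. Hence, uniformly in the path,
  finitely many loops determine the distance up to \<open>\<epsilon>\<close>. On such a loop the position of a nearby path
  follows that of \<open>f\<close> except near a discontinuity of the shuffle. By the assumption on the B-sets a given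
  discontinuity is met at a single time \<open>s\<close>, only one loop is concerned, and \<open>f\<close> is continuous at \<open>s\<close>, so near \<open>s\<close> a
  point of the tree of \<open>g\<close> is close to a time slightly before or slightly after \<open>s\<close>. This gives a
  finite net that serves all nearby paths, with almost the same mutual distances. The
  correspondence is the union of the products of closed balls around matching points of the net; being
  a finite union of rectangles it is compact and measurable, and the image of Lebesgue
  measure under both projections charges it by dominated convergence.

  The trees are compact because a left limit of the projection along a loop is a point of that loop, and the shuffle is
  surjective.\<close>

section \<open>Paths with nonnegative jumps\<close>

text \<open>Neither \<open>dT\<close> nor \<open>dL\<close> depends continuously on the path: a
  staircase with many small steps is uniformly close to a continuous slope, and its small loops turn
  into skeleton. Only the combination is stable, because a small loop seen from its root has
  \<open>2 * loop_dist\<close> close to the coordinate that \<open>dT\<close> subtracts. The two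
  terms of a loop are therefore kept together.

  The second obstacle is that a nearby path cannot be compared with \<open>f\<close> at every time.
  Skorokhod convergence of the shuffles shifts their argument a little, so a position close to a
  discontinuity may land on either side of it, depending on \<open>g\<close>. The two trees are
  compared only at net points, where this does no harm; any other time is tied to a net point inside
  the tree of its own path.

  Left-continuity of the shuffles fits the direction of time: a coordinate on an open loop never
  increases, so the times just after \<open>s\<close> approach the position of \<open>s\<close> from
  below. Hence the projection is right-continuous.

  The final constant is \<open>17 = 8 + 8 + 1\<close>: in each tree two points may be displaced by
  the radius \<open>4 * \<epsilon>\<close>, and distances between net points differ by
  \<open>\<epsilon>\<close>.\<close>

text \<open>Time changes of \<open>[-1, 1]\<close> preserve this class. They do not preserve
  excursions, whose vanishing on \<open>[-1, 0)\<close> may be lost.\<close>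

definition spectrally_positive :: "(real \<Rightarrow> real) \<Rightarrow> bool" where
  "spectrally_positive g \<longleftrightarrow>
     cadlag g \<and> (\<forall>t\<in>{-1..1}. 0 \<le> g t) \<and> (\<forall>t\<in>{-1<..1}. 0 \<le> jump g t)"

definition valley :: "(real \<Rightarrow> real) \<Rightarrow> real \<Rightarrow> real \<Rightarrow> real" where
  "valley g s t = (INF u\<in>{min s t..max s t}. g u)"

definition climb :: "(real \<Rightarrow> real) \<Rightarrow> real \<Rightarrow> real \<Rightarrow> real" where
  "climb g s t = g s + g t - 2 * valley g s t"

text \<open>Compactness of an interval against a radius that varies with the centre. It yields the
  boundedness of cadlag paths, the finiteness of the large jumps and the passage from local nets to
  a finite one.\<close>

lemma finite_ball_cover:
  fixes a b :: real
  assumes "\<And>s. s \<in> {a..b} \<Longrightarrow> 0 < \<delta> s"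
  obtains E where "finite E" "E \<subseteq> {a..b}" "\<And>t. t \<in> {a..b} \<Longrightarrow> \<exists>s\<in>E. \<bar>t - s\<bar> < \<delta> s"
proof -
  have cov: "{a..b} \<subseteq> (\<Union>s\<in>{a..b}. ball s (\<delta> s))"
    using assms by force
  obtain E where E: "E \<subseteq> {a..b}" "finite E" "{a..b} \<subseteq> (\<Union>s\<in>E. ball s (\<delta> s))"
    by (rule compactE_image[OF compact_Icc _ cov]) auto
  show ?thesis
  proof
    show "\<exists>s\<in>E. \<bar>t - s\<bar> < \<delta> s" if "t \<in> {a..b}" for t
    proof -
      have "t \<in> (\<Union>s\<in>E. ball s (\<delta> s))" using E(3) \<open>t \<in> {a..b}\<close> by (rule subsetD)
      then obtain s where "s \<in> E" "t \<in> ball s (\<delta> s)" by blast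
      then show ?thesis by (auto simp: dist_real_def abs_minus_commute intro!: bexI[of _ s])
    qed
  qed (use E in auto)
qed

section \<open>Cadlag paths: one-sided control and boundedness\<close>

lemma cadlag_left_lim:
  assumes "cadlag g" "t \<in> {-1<..1}"
  shows "(g \<longlongrightarrow> left_lim g t) (at_left t)"
proof -
  obtain l where l: "(g \<longlongrightarrow> l) (at_left t)"
    using assms unfolding cadlag_def by blast
  then have "left_lim g t = l"
    unfolding left_lim_def by (intro tendsto_Lim) auto
  with l show ?thesis by simp
qed

lemma left_lim_eqI:
  assumes "(g \<longlongrightarrow> l) (at_left t)"
  shows "left_lim g t = l"
  unfolding left_lim_def using assms by (intro tendsto_Lim) auto

lemma cadlag_left_close:
  assumes "cadlag g" "t \<in> {-1<..1}" "0 < e"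
  obtains d where "0 < d" "d \<le> t + 1" "\<And>u. u \<in> {t - d<..<t} \<Longrightarrow> \<bar>g u - left_lim g t\<bar> < e"
proof -
  have "eventually (\<lambda>u. dist (g u) (left_lim g t) < e) (at_left t)"
    using cadlag_left_lim[OF assms(1,2)] assms(3) by (rule tendstoD)
  then obtain b where b: "b < t" "\<And>u. b < u \<Longrightarrow> u < t \<Longrightarrow> dist (g u) (left_lim g t) < e"
    by (auto simp: eventually_at_left_field)
  show ?thesis
  proof
    show "0 < min (t - b) (t + 1)" "min (t - b) (t + 1) \<le> t + 1" using b assms by auto
    show "\<bar>g u - left_lim g t\<bar> < e" if "u \<in> {t - min (t - b) (t + 1)<..<t}" for u
      using b(2)[of u] that by (auto simp: dist_real_def)
  qed
qed

lemma cadlag_right_close: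
  assumes "cadlag g" "t \<in> {-1..<1}" "0 < e"
  obtains d where "0 < d" "d \<le> 1 - t" "\<And>u. u \<in> {t..<t + d} \<Longrightarrow> \<bar>g u - g t\<bar> < e"
proof -
  have "(g \<longlongrightarrow> g t) (at_right t)"
    using assms by (auto simp: cadlag_def continuous_within)
  then have "eventually (\<lambda>u. dist (g u) (g t) < e) (at_right t)"
    using assms(3) by (rule tendstoD)
  then obtain b where b: "b > t" "\<And>u. t < u \<Longrightarrow> u < b \<Longrightarrow> dist (g u) (g t) < e"
    by (auto simp: eventually_at_right_field)
  show ?thesis
  proof
    show "0 < min (b - t) (1 - t)" "min (b - t) (1 - t) \<le> 1 - t" using b assms by auto
    show "\<bar>g u - g t\<bar> < e" if "u \<in> {t..<t + min (b - t) (1 - t)}" for u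
      using b(2)[of u] that assms by (cases "u = t") (auto simp: dist_real_def)
  qed
qed

text \<open>Intersecting with \<open>{-1..1}\<close> absorbs the endpoints: at \<open>1\<close> the
  right part is the point itself, and at \<open>-1\<close> the left part is empty, so the arbitrary
  value \<open>left_lim g (-1)\<close> does no harm.\<close>

lemma cadlag_two_sided:
  assumes "cadlag g" "t \<in> {-1..1}" "0 < e"
  obtains d where "0 < d"
    "\<And>u. u \<in> {t..<t + d} \<inter> {-1..1} \<Longrightarrow> \<bar>g u - g t\<bar> < e"
    "\<And>u. u \<in> {t - d<..<t} \<inter> {-1..1} \<Longrightarrow> \<bar>g u - left_lim g t\<bar> < e"
proof -
  obtain d1 where d1: "0 < d1" "\<And>u. u \<in> {t..<t + d1} \<inter> {-1..1} \<Longrightarrow> \<bar>g u - g t\<bar> < e"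
  proof (cases "t = 1")
    case True
    then have "u = t" if "u \<in> {t..<t + 1} \<inter> {-1..1}" for u using that by auto
    then show ?thesis using that[of 1] assms(3) by fastforce
  next
    case False
    then show ?thesis using cadlag_right_close[OF assms(1) _ assms(3), of t] that assms
      by (metis IntD1 atLeastAtMost_iff atLeastLessThan_iff order_le_less)
  qed
  obtain d2 where d2: "0 < d2" "\<And>u. u \<in> {t - d2<..<t} \<inter> {-1..1} \<Longrightarrow> \<bar>g u - left_lim g t\<bar> < e"
  proof (cases "t = -1")
    case True
    then show ?thesis using that[of 1] assms by auto
  next
    case False
    then show ?thesis using cadlag_left_close[OF assms(1) _ assms(3), of t] that assms
      by (metis IntD1 atLeastAtMost_iff greaterThanAtMost_iff order_le_less)
  qed
  show ?thesis
  proof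
    show "0 < min d1 d2" using d1 d2 by simp
    show "\<bar>g u - g t\<bar> < e" if "u \<in> {t..<t + min d1 d2} \<inter> {-1..1}" for u
      using that by (intro d1(2)) auto
    show "\<bar>g u - left_lim g t\<bar> < e" if "u \<in> {t - min d1 d2<..<t} \<inter> {-1..1}" for u
      using that by (intro d2(2)) auto
  qed
qed

lemma cadlag_bounded:
  assumes "cadlag g"
  obtains M where "0 < M" "\<And>t. t \<in> {-1..1} \<Longrightarrow> \<bar>g t\<bar> \<le> M"
proof -
  have "\<exists>d>0. (\<forall>u. u \<in> {t..<t + d} \<inter> {-1..1} \<longrightarrow> \<bar>g u - g t\<bar> < 1) \<and>
    (\<forall>u. u \<in> {t - d<..<t} \<inter> {-1..1} \<longrightarrow> \<bar>g u - left_lim g t\<bar> < 1)" if "t \<in> {-1..1}" for t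
    using cadlag_two_sided[OF assms that zero_less_one] by metis
  then obtain d where d: "\<And>t. t \<in> {-1..1} \<Longrightarrow> 0 < d t"
    "\<And>t u. t \<in> {-1..1} \<Longrightarrow> u \<in> {t..<t + d t} \<inter> {-1..1} \<Longrightarrow> \<bar>g u - g t\<bar> < 1"
    "\<And>t u. t \<in> {-1..1} \<Longrightarrow> u \<in> {t - d t<..<t} \<inter> {-1..1} \<Longrightarrow> \<bar>g u - left_lim g t\<bar> < 1"
    by metis
  obtain E where E: "finite E" "E \<subseteq> {-1..1}" "\<And>t. t \<in> {-1..1} \<Longrightarrow> \<exists>s\<in>E. \<bar>t - s\<bar> < d s"
    using finite_ball_cover[of "-1" 1 d] d(1) by metis
  define M where "M = 1 + (\<Sum>s\<in>E. \<bar>g s\<bar> + \<bar>left_lim g s\<bar>)"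
  show ?thesis
  proof
    show "0 < M" unfolding M_def by (smt (verit) sum_nonneg)
    show "\<bar>g t\<bar> \<le> M" if t: "t \<in> {-1..1}" for t
    proof -
      obtain s where s: "s \<in> E" "\<bar>t - s\<bar> < d s" using E t by blast
      then have "\<bar>g s\<bar> + \<bar>left_lim g s\<bar> \<le> (\<Sum>s\<in>E. \<bar>g s\<bar> + \<bar>left_lim g s\<bar>)"
        using E by (intro member_le_sum[of s E "\<lambda>s. \<bar>g s\<bar> + \<bar>left_lim g s\<bar>"]) auto
      moreover have "\<bar>g t - g s\<bar> < 1 \<or> \<bar>g t - left_lim g s\<bar> < 1"
        using d(2)[of s t] d(3)[of s t] s E t by (cases "s \<le> t") auto
      ultimately show ?thesis unfolding M_def by linarith
    qed
  qed
qed

lemma sp_nonneg: "spectrally_positive g \<Longrightarrow> t \<in> {-1..1} \<Longrightarrow> 0 \<le> g t"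
  by (auto simp: spectrally_positive_def)

lemma sp_cadlag: "spectrally_positive g \<Longrightarrow> cadlag g"
  by (auto simp: spectrally_positive_def)

lemma sp_left_lim_le: "spectrally_positive g \<Longrightarrow> t \<in> {-1<..1} \<Longrightarrow> left_lim g t \<le> g t"
  by (auto simp: spectrally_positive_def jump_def)

lemma left_lim_ge:
  assumes "cadlag g" "t \<in> {-1<..1}" "a < t" "\<And>u. u \<in> {a..<t} \<Longrightarrow> c \<le> g u"
  shows "c \<le> left_lim g t"
proof (rule tendsto_lowerbound[OF cadlag_left_lim[OF assms(1,2)]])
  show "eventually (\<lambda>u. c \<le> g u) (at_left t)"
    using assms by (auto simp: eventually_at_left_field intro!: exI[of _ a])
qed auto

lemma sp_left_lim_nonneg:
  assumes "spectrally_positive g" "t \<in> {-1<..1}"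
  shows "0 \<le> left_lim g t"
  using assms sp_nonneg[OF assms(1)]
  by (intro left_lim_ge[of g t "-1"]) (auto simp: sp_cadlag)

section \<open>Minima over intervals\<close>

lemma valley_commute: "valley g s t = valley g t s"
  by (simp add: valley_def min.commute max.commute)

lemma climb_commute: "climb g s t = climb g t s"
  by (simp add: climb_def valley_commute[of g s t])

lemma valley_le:
  assumes "spectrally_positive g" "s \<in> {-1..1}" "t \<in> {-1..1}" "u \<in> {min s t..max s t}"
  shows "valley g s t \<le> g u"
  unfolding valley_def
proof (intro cINF_lower bdd_belowI2[of _ 0])
  show "0 \<le> g v" if "v \<in> {min s t..max s t}" for v
    using sp_nonneg[OF assms(1), of v] that assms by (auto simp: min_le_iff_disj le_max_iff_disj)
qed (use assms in auto)

lemma valley_ge: "(\<And>u. u \<in> {min s t..max s t} \<Longrightarrow> c \<le> g u) \<Longrightarrow> c \<le> valley g s t"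
  unfolding valley_def by (intro cINF_greatest) auto

lemma valley_refl [simp]: "valley g s s = g s"
  by (simp add: valley_def)

lemma valley_nonneg:
  assumes "spectrally_positive g" "s \<in> {-1..1}" "t \<in> {-1..1}"
  shows "0 \<le> valley g s t"
  by (intro valley_ge sp_nonneg[OF assms(1)]) (use assms in auto)

lemma valley_split:
  assumes "spectrally_positive g" "-1 \<le> r" "r \<le> s" "s \<le> t" "t \<le> 1"
  shows "valley g r t = min (valley g r s) (valley g s t)"
proof (rule antisym)
  show "valley g r t \<le> min (valley g r s) (valley g s t)"
    using assms by (auto intro!: valley_ge valley_le)
  show "min (valley g r s) (valley g s t) \<le> valley g r t"
  proof (rule valley_ge)
    fix u assume "u \<in> {min r t..max r t}"
    then have u: "u \<in> {r..t}" using assms by auto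
    show "min (valley g r s) (valley g s t) \<le> g u"
    proof (cases "u \<le> s")
      case True
      then have "valley g r s \<le> g u" using u assms by (intro valley_le) auto
      then show ?thesis by simp
    next
      case False
      then have "valley g s t \<le> g u" using u assms by (intro valley_le) auto
      then show ?thesis by simp
    qed
  qed
qed

text \<open>Whatever the order of the three times, the interval between \<open>s\<close> and
  \<open>u\<close> is covered by the two intervals that end at \<open>t\<close>. This is the
  ultrametric inequality behind the triangle inequality of the skeleton.\<close>

lemma valley_triple:
  assumes "spectrally_positive g" "s \<in> {-1..1}" "t \<in> {-1..1}" "u \<in> {-1..1}"
  shows "min (valley g s t) (valley g t u) \<le> valley g s u"
proof (rule valley_ge)
  fix v assume v: "v \<in> {min s u..max s u}"
  then have "v \<in> {min s t..max s t} \<or> v \<in> {min t u..max t u}" by auto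
  then show "min (valley g s t) (valley g t u) \<le> g v"
    using valley_le[OF assms(1-3), of v] valley_le[OF assms(1,3,4), of v] by auto
qed

lemma climb_nonneg:
  assumes "spectrally_positive g" "s \<in> {-1..1}" "t \<in> {-1..1}"
  shows "0 \<le> climb g s t"
  using valley_le[OF assms, of s] valley_le[OF assms, of t] by (auto simp: climb_def)

text \<open>The factor 4 collects an error \<open>e\<close> at each end and the error of the valley,
  which is counted twice.\<close>

lemma climb_le:
  assumes "\<And>u. u \<in> {min s t..max s t} \<Longrightarrow> \<bar>g u - l\<bar> \<le> e"
  shows "climb g s t \<le> 4 * e"
proof -
  have "l - e \<le> valley g s t"
  proof (rule valley_ge)
    fix u assume "u \<in> {min s t..max s t}"
    then show "l - e \<le> g u" using assms[of u] by linarith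
  qed
  moreover have "\<bar>g s - l\<bar> \<le> e" "\<bar>g t - l\<bar> \<le> e" by (auto intro!: assms)
  ultimately show ?thesis unfolding climb_def by linarith
qed

lemma valley_close:
  assumes "spectrally_positive g" "spectrally_positive f" "s \<in> {-1..1}" "t \<in> {-1..1}"
    "\<And>u. u \<in> {-1..1} \<Longrightarrow> \<bar>g u - f u\<bar> \<le> e"
  shows "\<bar>valley g s t - valley f s t\<bar> \<le> e"
proof -
  have "valley f s t - e \<le> valley g s t"
  proof (rule valley_ge)
    fix u assume u: "u \<in> {min s t..max s t}"
    then have "valley f s t \<le> f u" using assms by (intro valley_le) auto
    moreover have "u \<in> {-1..1}" using u assms by auto
    ultimately show "valley f s t - e \<le> g u" using assms(5)[of u] by linarith
  qed
  moreover have "valley g s t - e \<le> valley f s t"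
  proof (rule valley_ge)
    fix u assume u: "u \<in> {min s t..max s t}"
    then have "valley g s t \<le> g u" using assms by (intro valley_le) auto
    moreover have "u \<in> {-1..1}" using u assms by auto
    ultimately show "valley g s t - e \<le> f u" using assms(5)[of u] by linarith
  qed
  ultimately show ?thesis by linarith
qed

lemma climb_close:
  assumes "spectrally_positive g" "spectrally_positive f" "s \<in> {-1..1}" "t \<in> {-1..1}"
    "\<And>u. u \<in> {-1..1} \<Longrightarrow> \<bar>g u - f u\<bar> \<le> e"
  shows "\<bar>climb g s t - climb f s t\<bar> \<le> 4 * e"
  using valley_close[OF assms] assms(5)[OF assms(3)] assms(5)[OF assms(4)]
  unfolding climb_def by linarith

lemma left_lim_close:
  assumes "cadlag g" "cadlag f" "t \<in> {-1<..1}"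
    "\<And>u. u \<in> {-1..1} \<Longrightarrow> \<bar>g u - f u\<bar> \<le> e"
  shows "\<bar>left_lim g t - left_lim f t\<bar> \<le> e"
proof (rule tendsto_upperbound)
  show "((\<lambda>u. \<bar>g u - f u\<bar>) \<longlongrightarrow> \<bar>left_lim g t - left_lim f t\<bar>) (at_left t)"
    by (intro tendsto_intros cadlag_left_lim assms)
  show "eventually (\<lambda>u. \<bar>g u - f u\<bar> \<le> e) (at_left t)"
    unfolding eventually_at_left_field using assms by (intro exI[of _ "-1"]) auto
qed auto

lemma jump_close:
  assumes "cadlag g" "cadlag f" "t \<in> {-1<..1}"
    "\<And>u. u \<in> {-1..1} \<Longrightarrow> \<bar>g u - f u\<bar> \<le> e"
  shows "\<bar>jump g t - jump f t\<bar> \<le> 2 * e"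
  using left_lim_close[OF assms] assms(4)[of t] assms(3) unfolding jump_def by auto

subsection \<open>Loop coordinates\<close>

lemma xval_eq: "s \<le> t \<Longrightarrow> xval g s t = max (valley g s t - left_lim g s) 0"
  by (simp add: xval_def valley_def)

lemma xval_less: "t < s \<Longrightarrow> xval g s t = 0"
  by (simp add: xval_def)

lemma xval_nonneg [simp]: "0 \<le> xval g s t"
  by (simp add: xval_def)

lemma xval_le_jump:
  assumes "spectrally_positive g" "r \<in> {-1<..1}" "t \<in> {-1..1}"
  shows "xval g r t \<le> jump g r"
proof (cases "r \<le> t")
  case True
  have "valley g r t \<le> g r" using assms True by (intro valley_le) auto
  then show ?thesis using sp_left_lim_le[OF assms(1,2)] True by (auto simp: xval_eq jump_def)
next
  case False
  then show ?thesis using sp_left_lim_le[OF assms(1,2)] by (auto simp: xval_less jump_def)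
qed

lemma xval_same:
  assumes "spectrally_positive g" "r \<in> {-1<..1}"
  shows "xval g r r = jump g r"
  using sp_left_lim_le[OF assms] by (auto simp: xval_eq jump_def)

lemma xval_pos_jump:
  assumes "spectrally_positive g" "r \<in> {-1<..1}" "t \<in> {-1..1}" "0 < xval g r t"
  shows "0 < jump g r" "r \<le> t"
  using xval_le_jump[OF assms(1-3)] assms(4) by (auto simp: xval_def split: if_splits)

text \<open>Subtracting \<open>left_lim g r\<close> and truncating at 0 both commute with the
  minimum of \<open>valley_split\<close>. After time \<open>s\<close> a coordinate thus stays frozen
  until the path drops below the level that it marks.\<close>

lemma xval_step:
  assumes "spectrally_positive g" "r \<in> {-1<..1}" "r \<le> s" "s \<le> t" "t \<le> 1"
  shows "xval g r t = min (xval g r s) (max (valley g s t - left_lim g r) 0)"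
proof -
  have "valley g r t = min (valley g r s) (valley g s t)"
    using assms by (intro valley_split) auto
  then show ?thesis using assms by (auto simp: xval_eq)
qed

lemma xval_antimono:
  assumes "spectrally_positive g" "r \<in> {-1<..1}" "r \<le> s" "s \<le> t" "t \<le> 1"
  shows "xval g r t \<le> xval g r s"
  using xval_step[OF assms] by simp

lemma left_lim_ge_valley:
  assumes "spectrally_positive g" "s \<in> {-1..1}" "t \<in> {-1..1}" "s < r" "r \<le> t"
  shows "valley g s t \<le> left_lim g r"
  using assms by (intro left_lim_ge[of g r s] valley_le) (auto simp: sp_cadlag)

lemma xval_le_height:
  assumes "spectrally_positive g" "r \<in> {-1<..1}" "t \<in> {-1..1}"
  shows "xval g r t \<le> max (g t - left_lim g r) 0"
proof (cases "r \<le> t")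
  case True
  have "valley g r t \<le> g t" using assms True by (intro valley_le) auto
  then show ?thesis using True by (auto simp: xval_eq)
qed (auto simp: xval_less)

lemma xval_top_le:
  assumes "spectrally_positive g" "r \<in> {-1<..1}" "t \<in> {-1..1}" "0 < xval g r t"
  shows "left_lim g r + xval g r t \<le> g t"
  using xval_le_height[OF assms(1-3)] assms(4) by (auto simp: max_def split: if_splits)

text \<open>For a loop opened before both times this is \<open>xval_step\<close>; for one opened
  between them the valley lies below the loop, and both sides vanish. The left side is symmetric in
  \<open>s\<close> and \<open>t\<close>, which later says that two branches agree below their
  valley.\<close>

lemma min_xval_left:
  assumes g: "spectrally_positive g" "r \<in> {-1<..1}" "s \<in> {-1..1}" "t \<in> {-1..1}"
  shows "min (xval g r s) (xval g r t) = min (xval g r s) (max (valley g s t - left_lim g r) 0)"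
proof -
  \<comment> \<open>The two halves exchange roles when \<open>s\<close> and \<open>t\<close> are
    swapped, so proving both for one order settles the other.\<close>
  have main: "min (xval g r s) (xval g r t) = min (xval g r s) (max (valley g s t - left_lim g r) 0)
     \<and> min (xval g r s) (xval g r t) = min (xval g r t) (max (valley g s t - left_lim g r) 0)"
    if st: "s \<le> t" "s \<in> {-1..1}" "t \<in> {-1..1}" for s t
  proof (cases "r \<le> s")
    case True
    then show ?thesis using xval_step[OF g(1,2) True st(1)] st by auto
  next
    case False
    then have x: "xval g r s = 0" by (simp add: xval_less)
    show ?thesis
    proof (cases "r \<le> t")
      case True
      then have "valley g s t \<le> left_lim g r"
        using False st g by (intro left_lim_ge_valley) auto
      then show ?thesis using x by simp
    next
      case F: False
      then show ?thesis using x by (simp add: xval_less)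
    qed
  qed
  show ?thesis
  proof (cases "s \<le> t")
    case True
    then show ?thesis using main assms by blast
  next
    case False
    then show ?thesis using main[of t s] assms by (simp add: valley_commute min.commute)
  qed
qed

lemma xval_diff_le_drop:
  assumes "spectrally_positive g" "r \<in> {-1<..1}" "r \<le> s" "s \<le> t" "t \<le> 1"
  shows "xval g r s - xval g r t \<le> g s - valley g s t"
  using xval_step[OF assms] xval_le_height[OF assms(1,2), of s] assms
    valley_le[OF assms(1), of s t s] by (auto simp: min_def max_def split: if_splits)

text \<open>The climb is the descent from the first time to the valley plus the ascent to the
  second. On a loop open at the first time only the descent can lower the coordinate; a loop opened
  later lies above the valley, and its coordinate is at most the ascent.\<close>

lemma xval_diff_le_climb:
  assumes g: "spectrally_positive g" "r \<in> {-1<..1}" "s \<in> {-1..1}" "t \<in> {-1..1}"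
  shows "\<bar>xval g r s - xval g r t\<bar> \<le> climb g s t"
proof -
  have main: "\<bar>xval g r s - xval g r t\<bar> \<le> climb g s t" if st: "s \<le> t" "s \<in> {-1..1}" "t \<in> {-1..1}" for s t
  proof -
    have v: "valley g s t \<le> g s" "valley g s t \<le> g t" using g st by (auto intro!: valley_le)
    show ?thesis
    proof (cases "r \<le> s")
      case True
      then show ?thesis
        using xval_diff_le_drop[OF g(1,2) True st(1)] xval_antimono[OF g(1,2) True st(1)] st v
        by (auto simp: climb_def)
    next
      case False
      show ?thesis
      proof (cases "r \<le> t")
        case True
        then have "valley g s t \<le> left_lim g r"
          using False st g by (intro left_lim_ge_valley) auto
        then show ?thesis using False v xval_le_height[OF g(1,2) st(3)] by (auto simp: xval_less climb_def)
      next
        case F: False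
        then show ?thesis using False climb_nonneg[OF g(1) st(2,3)] by (simp add: xval_less)
      qed
    qed
  qed
  show ?thesis
  proof (cases "s \<le> t")
    case True
    then show ?thesis using main assms by blast
  next
    case False
    then show ?thesis using main[of t s] assms by (simp add: climb_commute abs_minus_commute)
  qed
qed

lemma xval_close:
  assumes "spectrally_positive g" "spectrally_positive f" "r \<in> {-1<..1}" "t \<in> {-1..1}"
    "\<And>u. u \<in> {-1..1} \<Longrightarrow> \<bar>g u - f u\<bar> \<le> e"
  shows "\<bar>xval g r t - xval f r t\<bar> \<le> 2 * e"
proof (cases "r \<le> t")
  case True
  have "\<bar>valley g r t - valley f r t\<bar> \<le> e"
    using assms by (intro valley_close) auto
  moreover have "\<bar>left_lim g r - left_lim f r\<bar> \<le> e"
    using assms by (intro left_lim_close) (auto simp: sp_cadlag)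
  ultimately show ?thesis using True by (simp add: xval_eq)
next
  case False
  have "0 \<le> e" using assms(5)[of 0] by auto
  then show ?thesis using False by (simp add: xval_less)
qed

text \<open>Seen from time \<open>s\<close>, the level intervals of the loops crossed on the way down are disjoint.\<close>

lemma loop_levels_disjoint:
  assumes "spectrally_positive g" "r \<in> {-1<..1}" "r' \<in> {-1<..1}" "r < r'" "s \<in> {-1..1}"
    "0 < xval g r s" "0 < xval g r' s"
  shows "left_lim g r + xval g r s \<le> left_lim g r'"
proof -
  have rs: "r \<le> s" "r' \<le> s" using assms by (auto intro: xval_pos_jump)
  then have "left_lim g r + xval g r s = valley g r s"
    using assms(6) by (auto simp: xval_eq max_def split: if_splits)
  also have "\<dots> \<le> left_lim g r'"
    using assms rs by (intro left_lim_ge_valley) auto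
  finally show ?thesis .
qed

text \<open>Each summand is the length of the part of a level interval that lies between
  \<open>v\<close> and \<open>w\<close>. The intervals are disjoint by
  \<open>loop_levels_disjoint\<close>, so Lebesgue measure bounds the total.\<close>

lemma sum_loop_levels_le:
  assumes g: "spectrally_positive g" "s \<in> {-1..1}" and F: "finite F" "F \<subseteq> {-1<..1}" and vw: "v \<le> w"
  shows "(\<Sum>r\<in>F. min (xval g r s) (max (w - left_lim g r) 0)
            - min (xval g r s) (max (v - left_lim g r) 0)) \<le> w - v"
proof -
  \<comment> \<open>Half-open intervals, because consecutive level intervals may share an end
    point.\<close>
  define I where "I r = {max v (left_lim g r) ..< min w (left_lim g r + xval g r s)}" for r
  have disj: "disjoint_family_on I F"
    unfolding disjoint_family_on_def
  proof (intro ballI impI)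
    fix r r' assume r: "r \<in> F" "r' \<in> F" "r \<noteq> r'"
    have *: "I r \<inter> I r' = {}" if "r < r'" "r \<in> F" "r' \<in> F" for r r'
    proof (cases "0 < xval g r s \<and> 0 < xval g r' s")
      case True
      then have "left_lim g r + xval g r s \<le> left_lim g r'"
        using that F g by (intro loop_levels_disjoint) auto
      then show ?thesis by (auto simp: I_def)
    next
      case False
      then have "xval g r s = 0 \<or> xval g r' s = 0"
        by (metis less_eq_real_def xval_nonneg)
      then show ?thesis by (auto simp: I_def)
    qed
    show "I r \<inter> I r' = {}" using *[of r r'] *[of r' r] r by (cases "r < r'") auto
  qed
  have len: "min (xval g r s) (max (w - left_lim g r) 0) - min (xval g r s) (max (v - left_lim g r) 0)
      = measure lborel (I r)" for r
    using xval_nonneg[of g r s] vw by (auto simp: I_def measure_def min_def max_def)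
  have fin: "emeasure lborel (I r) \<noteq> \<infinity>" for r
  proof -
    have "emeasure lborel (I r) \<le> emeasure lborel {v..<w}"
      by (intro emeasure_mono) (auto simp: I_def)
    then show ?thesis using vw by (auto simp: top_unique)
  qed
  have "(\<Sum>r\<in>F. measure lborel (I r)) = measure lborel (\<Union>r\<in>F. I r)"
    using F disj fin by (intro measure_finite_Union[symmetric]) (auto simp: I_def[abs_def])
  also have "\<dots> \<le> measure lborel {v..<w}"
    using F(1) vw by (intro measure_mono_fmeasurable) (auto simp: I_def fmeasurable_def)
  also have "\<dots> = w - v" using vw by (simp add: measure_def)
  finally show ?thesis by (simp add: len)
qed

text \<open>All level intervals seen from \<open>s\<close> lie between the levels 0 and
  \<open>g s\<close>, so cutting at these two levels removes nothing.\<close>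

lemma sum_xval_le:
  assumes g: "spectrally_positive g" "s \<in> {-1..1}" and F: "finite F" "F \<subseteq> {-1<..1}"
  shows "(\<Sum>r\<in>F. xval g r s) \<le> g s"
proof -
  have "(\<Sum>r\<in>F. xval g r s) = (\<Sum>r\<in>F. min (xval g r s) (max (g s - left_lim g r) 0)
            - min (xval g r s) (max (0 - left_lim g r) 0))"
  proof (rule sum.cong)
    fix r assume "r \<in> F"
    then have r: "r \<in> {-1<..1}" using F by auto
    show "xval g r s = min (xval g r s) (max (g s - left_lim g r) 0)
            - min (xval g r s) (max (0 - left_lim g r) 0)"
      using xval_le_height[OF g(1) r g(2)] sp_left_lim_nonneg[OF g(1) r] xval_nonneg[of g r s] by auto
  qed simp
  also have "\<dots> \<le> g s - 0"
    using sp_nonneg[OF g] by (intro sum_loop_levels_le g F)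
  finally show ?thesis by simp
qed

lemma xval_summable:
  assumes "spectrally_positive g" "s \<in> {-1..1}"
  shows "(\<lambda>r. xval g r s) summable_on {-1<..1}"
  by (rule nonneg_bdd_above_summable_on)
     (use sum_xval_le[OF assms] in \<open>auto intro!: bdd_aboveI2[of _ _ "g s"]\<close>)

text \<open>Let \<open>s \<le> t\<close> and let two loops be met at both times. The loop opened
  later keeps the path between \<open>s\<close> and \<open>t\<close> above its own base, hence above
  the whole level interval of the earlier loop, whose coordinate cannot change. Only the loop on
  which the two branches separate can be exceptional.\<close>

lemma xval_exceptional_unique:
  assumes g: "spectrally_positive g" "r \<in> {-1<..1}" "r' \<in> {-1<..1}" "s \<in> {-1..1}" "t \<in> {-1..1}"
    and r: "xval g r s \<noteq> xval g r t" "0 < xval g r s" "0 < xval g r t"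
    and r': "xval g r' s \<noteq> xval g r' t" "0 < xval g r' s" "0 < xval g r' t"
  shows "r = r'"
proof -
  have main: False if rr: "r < r'" "s \<le> t" and st: "s \<in> {-1..1}" "t \<in> {-1..1}" and rs: "r \<in> {-1<..1}" "r' \<in> {-1<..1}"
    and r: "xval g r s \<noteq> xval g r t" "0 < xval g r s" "0 < xval g r' t" "0 < xval g r' s" for r r' s t
  proof -
    have le: "r \<le> s" "r' \<le> s" "r' \<le> t" "r \<le> t"
      using g rs st r rr by (auto dest!: xval_pos_jump(2)[rotated -1])
    have "left_lim g r + xval g r s \<le> left_lim g r'"
      using g rs st r rr by (intro loop_levels_disjoint) auto
    moreover have "left_lim g r' < valley g s t"
    proof -
      have "valley g r' t \<le> valley g s t"
        using valley_split[of g r' s t] le rr st rs g by auto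
      moreover have "left_lim g r' < valley g r' t"
        using r le by (auto simp: xval_eq max_def split: if_splits)
      ultimately show ?thesis by simp
    qed
    ultimately show False
      using xval_step[OF g(1) rs(1) le(1) rr(2)] st r by auto
  qed
  show ?thesis
  proof (rule ccontr)
    assume ne: "r \<noteq> r'"
    show False
    proof (cases "s \<le> t")
      case True
      then show False using main[of r r' s t] main[of r' r s t] assms ne by (cases "r < r'") auto
    next
      case False
      then show False using main[of r r' t s] main[of r' r t s] assms ne by (cases "r < r'") auto
    qed
  qed
qed

section \<open>The tree distance\<close>

lemma summable_on_diff_real:
  fixes f g :: "'a \<Rightarrow> real"
  assumes "f summable_on A" "g summable_on A"
  shows "(\<lambda>x. f x - g x) summable_on A"
  using summable_on_add[OF assms(1), of "\<lambda>x. - g x"] assms(2) by (simp add: summable_on_uminus)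

lemma infsum_diff_real:
  fixes f g :: "'a \<Rightarrow> real"
  assumes "f summable_on A" "g summable_on A"
  shows "(\<Sum>\<^sub>\<infinity>x\<in>A. f x - g x) = infsum f A - infsum g A"
  using infsum_add[OF assms(1), of "\<lambda>x. - g x"] assms(2) by (simp add: summable_on_uminus infsum_uminus)

section \<open>The circle, and estimates for shuffles near 0\<close>

lemma circ_commute: "circ a b = circ b a"
  by (simp add: circ_def abs_minus_commute)

lemma circ_self [simp]: "circ a a = 0"
  by (simp add: circ_def)

lemma circ_nonneg: "a \<in> {0..1} \<Longrightarrow> b \<in> {0..1} \<Longrightarrow> 0 \<le> circ a b"
  by (auto simp: circ_def)

lemma circ_le_half: "circ a b \<le> 1 / 2"
  by (auto simp: circ_def min_def)

lemma circ_triangle: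
  "a \<in> {0..1} \<Longrightarrow> b \<in> {0..1} \<Longrightarrow> c \<in> {0..1} \<Longrightarrow> circ a c \<le> circ a b + circ b c"
  by (auto simp: circ_def min_def abs_if)

lemma circ_diff_le:
  assumes "a \<in> {0..1}" "b \<in> {0..1}" "a' \<in> {0..1}" "b' \<in> {0..1}"
  shows "\<bar>circ a b - circ a' b'\<bar> \<le> circ a a' + circ b b'"
  using circ_triangle[of a a' b] circ_triangle[of a' b' b] circ_triangle[of a' a b'] circ_triangle[of a b b']
    assms circ_commute[of a a'] circ_commute[of b b'] by linarith

text \<open>Being caglad is not a separate clause of \<open>shuffle\<close>: it is read off from the
  space of the measure in which the shuffle takes its values.\<close>

lemma shuffle_caglad: "shuffle \<Phi> \<Longrightarrow> 0 < \<Delta> \<Longrightarrow> \<Phi> \<Delta> \<in> caglad_circ"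
  using measurable_space[of \<Phi> "restrict_space borel {0<..}" skorokhod_circ_borel \<Delta>]
  by (auto simp: shuffle_def skorokhod_circ_borel_def space_measure_of_conv space_restrict_space)

lemma shuffle_range: "shuffle \<Phi> \<Longrightarrow> 0 < \<Delta> \<Longrightarrow> x \<in> {0..1} \<Longrightarrow> \<Phi> \<Delta> x \<in> {0..1}"
  using shuffle_caglad[of \<Phi> \<Delta>] unfolding caglad_circ_def by blast

text \<open>A bounded deviation is a Lipschitz bound at 0, uniform over bounded perimeters. It makes
  the loop distances summable and the shuffles continuous at 0.\<close>

lemma shuffle_circ_0_le:
  assumes "shuffle \<Phi>" "0 < M"
  obtains C where "0 < C" "\<And>u x. u \<in> {0<..M} \<Longrightarrow> x \<in> {0..1} \<Longrightarrow> circ (\<Phi> u 0) (\<Phi> u x) \<le> C * x"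
proof -
  have "bdd_above ((\<lambda>(u, x). deviation (\<Phi> u) x) ` ({0<..M} \<times> {0<..1}))"
    using assms by (auto simp: shuffle_def)
  then obtain B where B: "\<And>u x. u \<in> {0<..M} \<Longrightarrow> x \<in> {0<..1} \<Longrightarrow> deviation (\<Phi> u) x \<le> B"
    by (force simp: bdd_above_def)
  show ?thesis
  proof
    show "0 < (\<bar>B\<bar> + 1) / 2" by simp
    fix u x :: real assume ux: "u \<in> {0<..M}" "x \<in> {0..1}"
    show "circ (\<Phi> u 0) (\<Phi> u x) \<le> (\<bar>B\<bar> + 1) / 2 * x"
    proof (cases "x = 0")
      case False
      then have x: "0 < x" using ux by auto
      have "2 / x * circ (\<Phi> u 0) (\<Phi> u x) \<le> \<bar>B\<bar> + 1"
        using B[of u x] ux x by (auto simp: deviation_def)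
      then show ?thesis using x by (simp add: field_simps)
    qed simp
  qed
qed

lemma shuffle_deviation_small:
  assumes "shuffle \<Phi>" "0 < \<omega>"
  obtains \<eta> where "0 < \<eta>" "\<And>u x. u \<in> {0<..\<eta>} \<Longrightarrow> x \<in> {0<..1} \<Longrightarrow> deviation (\<Phi> u) x \<le> \<omega>"
proof -
  have "eventually (\<lambda>u. (SUP x\<in>{0<..1}. deviation (\<Phi> u) x) < \<omega>) (at_right 0)"
    using assms unfolding shuffle_def by (intro order_tendstoD) auto
  then obtain b where b: "0 < b" "\<And>u. 0 < u \<Longrightarrow> u < b \<Longrightarrow> (SUP x\<in>{0<..1}. deviation (\<Phi> u) x) < \<omega>"
    by (auto simp: eventually_at_right_field)
  show ?thesis
  proof
    show "0 < b / 2" using b by simp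
    fix u x :: real assume ux: "u \<in> {0<..b/2}" "x \<in> {0<..1}"
    \<comment> \<open>Only for a bounded family does the real supremum dominate the single
      deviations.\<close>
    have "bdd_above ((\<lambda>(u, x). deviation (\<Phi> u) x) ` ({0<..u} \<times> {0<..1}))"
      using assms ux by (auto simp: shuffle_def)
    then obtain B where "\<And>v x. v \<in> {0<..u} \<Longrightarrow> x \<in> {0<..1} \<Longrightarrow> deviation (\<Phi> v) x \<le> B"
      by (force simp: bdd_above_def)
    then have "bdd_above ((\<lambda>x. deviation (\<Phi> u) x) ` {0<..1})"
      using ux by (intro bdd_aboveI2[of _ _ B]) auto
    then have "deviation (\<Phi> u) x \<le> (SUP x\<in>{0<..1}. deviation (\<Phi> u) x)"
      using ux by (intro cSUP_upper) auto
    also have "\<dots> \<le> \<omega>" using b(2)[of u] ux by auto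
    finally show "deviation (\<Phi> u) x \<le> \<omega>" .
  qed
qed

definition loop_pos :: "(real \<Rightarrow> real \<Rightarrow> real) \<Rightarrow> (real \<Rightarrow> real) \<Rightarrow> real \<Rightarrow> real \<Rightarrow> real" where
  "loop_pos \<Phi> g r s = \<Phi> (jump g r) (xval g r s / jump g r)"

text \<open>The whole contribution of one loop to \<open>dV\<close>: its distance, counted twice,
  minus its term in \<open>dT\<close>. It is this difference that is small on small loops.\<close>

definition loop_excess :: "(real \<Rightarrow> real \<Rightarrow> real) \<Rightarrow> (real \<Rightarrow> real) \<Rightarrow> real \<Rightarrow> real \<Rightarrow> real \<Rightarrow> real" where
  "loop_excess \<Phi> g r s t =
     2 * loop_dist \<Phi> g r (xval g r s) (xval g r t) - \<bar>xval g r s - xval g r t\<bar>"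

text \<open>The distance \<open>dV\<close>, with the sums over all of \<open>(-1, 1]\<close>: unlike that of an excursion,
  the set of jump times of a time-changed excursion need not be contained in \<open>[0, 1]\<close>.\<close>

definition tree_dist :: "(real \<Rightarrow> real \<Rightarrow> real) \<Rightarrow> (real \<Rightarrow> real) \<Rightarrow> real \<Rightarrow> real \<Rightarrow> real" where
  "tree_dist \<Phi> g s t = climb g s t + (\<Sum>\<^sub>\<infinity>r\<in>{-1<..1}. loop_excess \<Phi> g r s t)"

lemma xval_ratio:
  assumes "spectrally_positive g" "r \<in> {-1<..1}" "t \<in> {-1..1}" "0 < jump g r"
  shows "xval g r t / jump g r \<in> {0..1}"
  using xval_le_jump[OF assms(1-3)] assms(4) by auto

lemma loop_pos_range:
  assumes "shuffle \<Phi>" "spectrally_positive g" "r \<in> {-1<..1}" "t \<in> {-1..1}" "0 < jump g r"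
  shows "loop_pos \<Phi> g r t \<in> {0..1}"
  unfolding loop_pos_def using assms by (intro shuffle_range[OF assms(1)] xval_ratio)

lemma loop_dist_eq:
  "0 < jump g r \<Longrightarrow> loop_dist \<Phi> g r (xval g r s) (xval g r t) =
     jump g r * circ (loop_pos \<Phi> g r s) (loop_pos \<Phi> g r t)"
  by (simp add: loop_dist_def loop_pos_def)

lemma loop_dist_nonneg:
  assumes "shuffle \<Phi>" "spectrally_positive g" "r \<in> {-1<..1}" "s \<in> {-1..1}" "t \<in> {-1..1}"
  shows "0 \<le> loop_dist \<Phi> g r (xval g r s) (xval g r t)"
proof (cases "0 < jump g r")
  case True
  then show ?thesis
    using circ_nonneg[OF loop_pos_range[OF assms(1-3) assms(4) True] loop_pos_range[OF assms(1-3) assms(5) True]]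
    by (auto simp: loop_dist_eq)
qed (auto simp: loop_dist_def)

lemma loop_dist_commute: "loop_dist \<Phi> g r x y = loop_dist \<Phi> g r y x"
  by (simp add: loop_dist_def circ_commute)

lemma loop_excess_commute: "loop_excess \<Phi> g r s t = loop_excess \<Phi> g r t s"
  by (simp add: loop_excess_def loop_dist_commute[of _ _ _ "xval g r s"] abs_minus_commute)

lemma loop_dist_triangle:
  assumes "shuffle \<Phi>" "spectrally_positive g" "r \<in> {-1<..1}" "s \<in> {-1..1}" "t \<in> {-1..1}" "u \<in> {-1..1}"
  shows "loop_dist \<Phi> g r (xval g r s) (xval g r u)
    \<le> loop_dist \<Phi> g r (xval g r s) (xval g r t) + loop_dist \<Phi> g r (xval g r t) (xval g r u)"
proof (cases "0 < jump g r")
  case True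
  have "circ (loop_pos \<Phi> g r s) (loop_pos \<Phi> g r u)
      \<le> circ (loop_pos \<Phi> g r s) (loop_pos \<Phi> g r t) + circ (loop_pos \<Phi> g r t) (loop_pos \<Phi> g r u)"
    by (intro circ_triangle loop_pos_range assms True)
  then have "jump g r * circ (loop_pos \<Phi> g r s) (loop_pos \<Phi> g r u)
      \<le> jump g r * (circ (loop_pos \<Phi> g r s) (loop_pos \<Phi> g r t) + circ (loop_pos \<Phi> g r t) (loop_pos \<Phi> g r u))"
    using True by (intro mult_left_mono) auto
  then show ?thesis unfolding loop_dist_eq[OF True] distrib_left .
qed (auto simp: loop_dist_def)

lemma sp_jump_le:
  assumes "spectrally_positive g" "r \<in> {-1<..1}"
  shows "jump g r \<le> g r"
  using sp_left_lim_nonneg[OF assms] by (simp add: jump_def)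

text \<open>Both positions are compared with the image of 0, where the shuffles are Lipschitz. One
  constant serves all loops, since no jump exceeds the maximal height of the path.\<close>

lemma loop_dist_le_sum:
  assumes "shuffle \<Phi>" "spectrally_positive g"
  obtains C where "\<And>r s t. r \<in> {-1<..1} \<Longrightarrow> s \<in> {-1..1} \<Longrightarrow> t \<in> {-1..1} \<Longrightarrow>
    loop_dist \<Phi> g r (xval g r s) (xval g r t) \<le> C * (xval g r s + xval g r t)"
proof -
  obtain M where M: "0 < M" "\<And>t. t \<in> {-1..1} \<Longrightarrow> \<bar>g t\<bar> \<le> M"
    using cadlag_bounded[OF sp_cadlag[OF assms(2)]] by metis
  obtain C where C: "0 < C" "\<And>u x. u \<in> {0<..M} \<Longrightarrow> x \<in> {0..1} \<Longrightarrow> circ (\<Phi> u 0) (\<Phi> u x) \<le> C * x"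
    using shuffle_circ_0_le[OF assms(1) M(1)] by metis
  show ?thesis
  proof
    fix r s t :: real assume rst: "r \<in> {-1<..1}" "s \<in> {-1..1}" "t \<in> {-1..1}"
    show "loop_dist \<Phi> g r (xval g r s) (xval g r t) \<le> C * (xval g r s + xval g r t)"
    proof (cases "0 < jump g r")
      case True
      have "jump g r \<le> g r" using sp_jump_le[OF assms(2) rst(1)] .
      also have "\<dots> \<le> M" using M(2)[of r] rst by auto
      finally have J: "jump g r \<in> {0<..M}" using True by auto
      have "circ (loop_pos \<Phi> g r s) (loop_pos \<Phi> g r t)
          \<le> circ (loop_pos \<Phi> g r s) (\<Phi> (jump g r) 0) + circ (\<Phi> (jump g r) 0) (loop_pos \<Phi> g r t)"
        by (intro circ_triangle loop_pos_range shuffle_range[OF assms(1)] assms rst True) auto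
      also have "\<dots> \<le> C * (xval g r s / jump g r) + C * (xval g r t / jump g r)"
        unfolding loop_pos_def circ_commute[of "\<Phi> (jump g r) (xval g r s / jump g r)"]
        by (intro add_mono C(2) J xval_ratio assms rst True)
      finally have "jump g r * circ (loop_pos \<Phi> g r s) (loop_pos \<Phi> g r t)
          \<le> jump g r * (C * (xval g r s / jump g r) + C * (xval g r t / jump g r))"
        using True by (intro mult_left_mono) auto
      also have "\<dots> = C * (xval g r s + xval g r t)" using True by (simp add: field_simps)
      finally show ?thesis using True by (simp add: loop_dist_eq)
    next
      case False
      then show ?thesis using C by (simp add: loop_dist_def)
    qed
  qed
qed

lemma loop_dist_summable:
  assumes "shuffle \<Phi>" "spectrally_positive g" "s \<in> {-1..1}" "t \<in> {-1..1}"
  shows "(\<lambda>r. loop_dist \<Phi> g r (xval g r s) (xval g r t)) summable_on {-1<..1}"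
proof -
  obtain C where C: "\<And>r s t. r \<in> {-1<..1} \<Longrightarrow> s \<in> {-1..1} \<Longrightarrow> t \<in> {-1..1} \<Longrightarrow>
    loop_dist \<Phi> g r (xval g r s) (xval g r t) \<le> C * (xval g r s + xval g r t)"
    using loop_dist_le_sum[OF assms(1,2)] by metis
  have "(\<lambda>r. C * (xval g r s + xval g r t)) summable_on {-1<..1}"
    by (intro summable_on_cmult_right summable_on_add xval_summable assms)
  then show ?thesis
    by (rule summable_on_comparison_test) (auto intro!: C loop_dist_nonneg assms)
qed

lemma xval_diff_summable:
  assumes "spectrally_positive g" "s \<in> {-1..1}" "t \<in> {-1..1}"
  shows "(\<lambda>r. \<bar>xval g r s - xval g r t\<bar>) summable_on {-1<..1}"
proof -
  have *: "\<bar>xval g r s - xval g r t\<bar> \<le> xval g r s + xval g r t" for r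
    using xval_nonneg[of g r s] xval_nonneg[of g r t] by linarith
  have "(\<lambda>r. xval g r s + xval g r t) summable_on {-1<..1}"
    by (intro summable_on_add xval_summable assms)
  then show ?thesis
    by (rule summable_on_comparison_test) (auto intro!: *)
qed


lemma loop_excess_summable:
  assumes "shuffle \<Phi>" "spectrally_positive g" "s \<in> {-1..1}" "t \<in> {-1..1}"
  shows "(\<lambda>r. loop_excess \<Phi> g r s t) summable_on {-1<..1}"
  unfolding loop_excess_def
  by (intro summable_on_diff_real summable_on_cmult_right loop_dist_summable xval_diff_summable assms)

text \<open>The length of the part of the branch below level \<open>v\<close> that is not in a loop.\<close>

definition branch_length :: "(real \<Rightarrow> real) \<Rightarrow> real \<Rightarrow> real \<Rightarrow> real" where
  "branch_length g s v = v - (\<Sum>\<^sub>\<infinity>r\<in>{-1<..1}. min (xval g r s) (max (v - left_lim g r) 0))"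

lemma min_xval_summable:
  assumes "spectrally_positive g" "s \<in> {-1..1}"
  shows "(\<lambda>r. min (xval g r s) (max (c r) 0)) summable_on {-1<..1}"
  by (rule summable_on_comparison_test[OF xval_summable[OF assms]]) auto

text \<open>Between the levels \<open>v\<close> and \<open>w\<close> the loops occupy at most the
  length \<open>w - v\<close>.\<close>

lemma branch_length_mono:
  assumes "spectrally_positive g" "s \<in> {-1..1}" "v \<le> w"
  shows "branch_length g s v \<le> branch_length g s w"
proof -
  have "(\<Sum>\<^sub>\<infinity>r\<in>{-1<..1}. min (xval g r s) (max (w - left_lim g r) 0)
            - min (xval g r s) (max (v - left_lim g r) 0)) \<le> w - v"
    by (intro infsum_le_finite_sums summable_on_diff_real min_xval_summable sum_loop_levels_le assms)
  then show ?thesis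
    unfolding branch_length_def
    by (subst (asm) infsum_diff_real) (auto intro!: min_xval_summable assms)
qed

text \<open>The right side is symmetric in \<open>s\<close> and \<open>t\<close>: the two branches
  coincide up to the valley.\<close>

lemma branch_length_valley:
  assumes "spectrally_positive g" "s \<in> {-1..1}" "t \<in> {-1..1}"
  shows "branch_length g s (valley g s t)
    = valley g s t - (\<Sum>\<^sub>\<infinity>r\<in>{-1<..1}. min (xval g r s) (xval g r t))"
  unfolding branch_length_def using assms
  by (auto intro!: infsum_cong simp: min_xval_left)

lemma branch_length_top:
  assumes "spectrally_positive g" "s \<in> {-1..1}"
  shows "branch_length g s (g s) = g s - (\<Sum>\<^sub>\<infinity>r\<in>{-1<..1}. xval g r s)"
  using branch_length_valley[OF assms assms(2)] by simp

text \<open>The counterpart of \<open>dT\<close> for paths whose jump times may lie anywhere in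
  \<open>(-1, 1]\<close>.\<close>

definition skeleton_dist :: "(real \<Rightarrow> real) \<Rightarrow> real \<Rightarrow> real \<Rightarrow> real" where
  "skeleton_dist g s t = climb g s t - (\<Sum>\<^sub>\<infinity>r\<in>{-1<..1}. \<bar>xval g r s - xval g r t\<bar>)"

text \<open>Writing \<open>\<bar>a - b\<bar>\<close> as \<open>a + b - 2 * min a b\<close> gives the
  usual distance in a tree: two heights minus twice the height of the branch point, with
  \<open>branch_length\<close> as height.\<close>

lemma skeleton_dist_eq:
  assumes "spectrally_positive g" "s \<in> {-1..1}" "t \<in> {-1..1}"
  shows "skeleton_dist g s t = branch_length g s (g s) + branch_length g t (g t)
    - 2 * branch_length g s (valley g s t)"
proof -
  have m: "(\<lambda>r. min (xval g r s) (xval g r t)) summable_on {-1<..1}"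
    by (rule summable_on_comparison_test[OF xval_summable[OF assms(1,2)]]) auto
  have "(\<Sum>\<^sub>\<infinity>r\<in>{-1<..1}. \<bar>xval g r s - xval g r t\<bar>)
      = (\<Sum>\<^sub>\<infinity>r\<in>{-1<..1}. (xval g r s + xval g r t) - 2 * min (xval g r s) (xval g r t))"
    by (intro infsum_cong) (auto simp: min_def)
  also have "\<dots> = (\<Sum>\<^sub>\<infinity>r\<in>{-1<..1}. xval g r s) + (\<Sum>\<^sub>\<infinity>r\<in>{-1<..1}. xval g r t)
      - 2 * (\<Sum>\<^sub>\<infinity>r\<in>{-1<..1}. min (xval g r s) (xval g r t))"
    using infsum_diff_real[OF summable_on_add[OF xval_summable[OF assms(1,2)] xval_summable[OF assms(1,3)]]
        summable_on_cmult_right[OF m, of 2]]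
      infsum_add[OF xval_summable[OF assms(1,2)] xval_summable[OF assms(1,3)]]
      infsum_cmult_right[OF m, of 2] by simp
  finally show ?thesis
    by (simp add: skeleton_dist_def branch_length_valley[OF assms] branch_length_top[OF assms(1,2)]
      branch_length_top[OF assms(1,3)] climb_def)
qed

lemma branch_length_valley_commute:
  assumes "spectrally_positive g" "s \<in> {-1..1}" "t \<in> {-1..1}"
  shows "branch_length g s (valley g s t) = branch_length g t (valley g s t)"
  using branch_length_valley[OF assms] branch_length_valley[OF assms(1,3,2)]
  by (simp add: valley_commute[of g t s] min.commute)

lemma skeleton_dist_nonneg:
  assumes "spectrally_positive g" "s \<in> {-1..1}" "t \<in> {-1..1}"
  shows "0 \<le> skeleton_dist g s t"
proof -
  have "branch_length g s (valley g s t) \<le> branch_length g s (g s)"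
    by (intro branch_length_mono valley_le assms) auto
  moreover have "branch_length g t (valley g s t) \<le> branch_length g t (g t)"
    by (intro branch_length_mono valley_le assms) auto
  ultimately show ?thesis
    using branch_length_valley_commute[OF assms] by (simp add: skeleton_dist_eq[OF assms])
qed

text \<open>By \<open>valley_triple\<close> one of the valleys through \<open>t\<close> is at most
  the valley of \<open>s\<close> and \<open>u\<close>. The two are compared along the branch of
  \<open>s\<close> or of \<open>u\<close>, and the other valley through \<open>t\<close> is bounded
  by the top of the branch of \<open>t\<close>.\<close>

lemma skeleton_dist_triangle:
  assumes "spectrally_positive g" "s \<in> {-1..1}" "t \<in> {-1..1}" "u \<in> {-1..1}"
  shows "skeleton_dist g s u \<le> skeleton_dist g s t + skeleton_dist g t u"
proof -
  have tri: "valley g s t \<le> valley g s u \<or> valley g t u \<le> valley g s u"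
    using valley_triple[OF assms] by (metis min_def)
  have top: "branch_length g t (valley g s t) \<le> branch_length g t (g t)"
    "branch_length g t (valley g t u) \<le> branch_length g t (g t)"
    by (rule branch_length_mono[OF assms(1,3)], rule valley_le[OF assms(1)], use assms in auto)+
  have "branch_length g s (valley g s t) + branch_length g t (valley g t u)
      \<le> branch_length g s (valley g s u) + branch_length g t (g t)"
    using tri
  proof
    assume "valley g s t \<le> valley g s u"
    from branch_length_mono[OF assms(1,2) this] top show ?thesis by linarith
  next
    assume "valley g t u \<le> valley g s u"
    from branch_length_mono[OF assms(1,4) this] top show ?thesis
      using branch_length_valley_commute[OF assms(1-3)] branch_length_valley_commute[OF assms(1,3,4)]
        branch_length_valley_commute[OF assms(1,2,4)] by linarith
  qed
  then show ?thesis
    unfolding skeleton_dist_eq[OF assms(1,2,4)] skeleton_dist_eq[OF assms(1-3)] skeleton_dist_eq[OF assms(1,3,4)]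
    by linarith
qed

lemma tree_dist_eq:
  assumes "shuffle \<Phi>" "spectrally_positive g" "s \<in> {-1..1}" "t \<in> {-1..1}"
  shows "tree_dist \<Phi> g s t = skeleton_dist g s t
    + 2 * (\<Sum>\<^sub>\<infinity>r\<in>{-1<..1}. loop_dist \<Phi> g r (xval g r s) (xval g r t))"
  unfolding tree_dist_def skeleton_dist_def loop_excess_def
  using infsum_diff_real[OF summable_on_cmult_right[OF loop_dist_summable[OF assms], of 2]
      xval_diff_summable[OF assms(2-4)]]
    infsum_cmult_right[OF loop_dist_summable[OF assms], of 2] by simp

lemma tree_dist_commute: "tree_dist \<Phi> g s t = tree_dist \<Phi> g t s"
  by (simp add: tree_dist_def climb_commute[of g s] loop_excess_commute[of _ _ _ s])

lemma tree_dist_refl [simp]: "tree_dist \<Phi> g s s = 0"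
proof -
  have "loop_excess \<Phi> g r s s = 0" for r
    by (simp add: loop_excess_def loop_dist_def)
  then show ?thesis by (simp add: tree_dist_def climb_def)
qed

lemma tree_dist_nonneg:
  assumes "shuffle \<Phi>" "spectrally_positive g" "s \<in> {-1..1}" "t \<in> {-1..1}"
  shows "0 \<le> tree_dist \<Phi> g s t"
  unfolding tree_dist_eq[OF assms]
  by (intro add_nonneg_nonneg mult_nonneg_nonneg skeleton_dist_nonneg infsum_nonneg loop_dist_nonneg assms) auto

lemma tree_dist_triangle:
  assumes "shuffle \<Phi>" "spectrally_positive g" "s \<in> {-1..1}" "t \<in> {-1..1}" "u \<in> {-1..1}"
  shows "tree_dist \<Phi> g s u \<le> tree_dist \<Phi> g s t + tree_dist \<Phi> g t u"
proof -
  have "(\<Sum>\<^sub>\<infinity>r\<in>{-1<..1}. loop_dist \<Phi> g r (xval g r s) (xval g r u))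
    \<le> (\<Sum>\<^sub>\<infinity>r\<in>{-1<..1}. loop_dist \<Phi> g r (xval g r s) (xval g r t) + loop_dist \<Phi> g r (xval g r t) (xval g r u))"
    by (intro infsum_mono summable_on_add loop_dist_summable loop_dist_triangle assms)
  also have "\<dots> = (\<Sum>\<^sub>\<infinity>r\<in>{-1<..1}. loop_dist \<Phi> g r (xval g r s) (xval g r t))
      + (\<Sum>\<^sub>\<infinity>r\<in>{-1<..1}. loop_dist \<Phi> g r (xval g r t) (xval g r u))"
    by (intro infsum_add loop_dist_summable assms)
  finally show ?thesis
    using skeleton_dist_triangle[OF assms(2-5)]
    by (simp add: tree_dist_eq[OF assms(1-4)] tree_dist_eq[OF assms(1,2,4,5)] tree_dist_eq[OF assms(1,2,3,5)])
qed

text \<open>Up to a small error, only the finitely many loops with large perimeter matter: the others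
  satisfy \<open>2 * loop_dist \<approx> |x - y|\<close>, by the assumption on the deviation when \<open>x\<close> or \<open>y\<close> vanishes
  and trivially when \<open>x = y\<close>, and this covers all loops except one.\<close>

lemma loop_excess_le_deviation:
  assumes "shuffle \<Phi>" "spectrally_positive g" "r \<in> {-1<..1}" "s \<in> {-1..1}" "t \<in> {-1..1}"
    and "\<And>x. 0 < jump g r \<Longrightarrow> x \<in> {0<..1} \<Longrightarrow> deviation (\<Phi> (jump g r)) x \<le> \<omega>" "0 \<le> \<omega>"
    and "xval g r s = 0 \<or> xval g r t = 0 \<or> xval g r s = xval g r t"
  shows "\<bar>loop_excess \<Phi> g r s t\<bar> \<le> \<omega> * (xval g r s + xval g r t)"
proof -
  have main: "\<bar>loop_excess \<Phi> g r s t\<bar> \<le> \<omega> * (xval g r s + xval g r t)"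
    if "xval g r s = 0" "0 < xval g r t" "t \<in> {-1..1}" for s t
  proof -
    have J: "0 < jump g r" using that assms by (auto intro: xval_pos_jump)
    define x where "x = xval g r t / jump g r"
    have x: "x \<in> {0<..1}" using xval_ratio[OF assms(2,3) that(3) J] that J by (auto simp: x_def)
    \<comment> \<open>With one coordinate equal to 0, the excess is the other coordinate times the
      quantity whose absolute value is the deviation.\<close>
    have "\<bar>loop_excess \<Phi> g r s t\<bar> = xval g r t * deviation (\<Phi> (jump g r)) x"
    proof -
      have "loop_excess \<Phi> g r s t = xval g r t * (2 / x * circ (\<Phi> (jump g r) 0) (\<Phi> (jump g r) x) - 1)"
        using J that by (simp add: loop_excess_def loop_dist_def x_def field_simps)
      then show ?thesis by (simp add: abs_mult deviation_def)
    qed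
    also have "\<dots> \<le> xval g r t * \<omega>"
      using that by (intro mult_left_mono assms J x) auto
    finally show ?thesis using that by (simp add: mult.commute)
  qed
  consider "xval g r s = xval g r t" | "xval g r s = 0" "0 < xval g r t" | "xval g r t = 0" "0 < xval g r s"
    using assms(8) xval_nonneg[of g r s] xval_nonneg[of g r t] by linarith
  then show ?thesis
  proof cases
    case 1
    then show ?thesis using assms(7) by (simp add: loop_excess_def loop_dist_def)
  next
    case 2
    then show ?thesis using main assms by auto
  next
    case 3
    then show ?thesis using main[of t s] assms by (simp add: loop_excess_commute[of _ _ _ s] add.commute)
  qed
qed

text \<open>Since \<open>circ\<close> is at most 1/2, the excess is a difference of two numbers
  between 0 and the jump. This crude bound serves the one exceptional loop.\<close>

lemma loop_excess_le_jump:
  assumes "shuffle \<Phi>" "spectrally_positive g" "r \<in> {-1<..1}" "s \<in> {-1..1}" "t \<in> {-1..1}"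
  shows "\<bar>loop_excess \<Phi> g r s t\<bar> \<le> jump g r"
proof (cases "0 < jump g r")
  case True
  have c: "0 \<le> circ (loop_pos \<Phi> g r s) (loop_pos \<Phi> g r t)" "circ (loop_pos \<Phi> g r s) (loop_pos \<Phi> g r t) \<le> 1 / 2"
    by (intro circ_nonneg loop_pos_range[OF assms(1-3)] assms True) (rule circ_le_half)
  have "jump g r * circ (loop_pos \<Phi> g r s) (loop_pos \<Phi> g r t) \<le> jump g r * (1 / 2)"
    using c True by (intro mult_left_mono) auto
  moreover have "0 \<le> jump g r * circ (loop_pos \<Phi> g r s) (loop_pos \<Phi> g r t)" using c True by simp
  moreover have "\<bar>xval g r s - xval g r t\<bar> \<le> jump g r"
    using xval_le_jump[OF assms(2,3,4)] xval_le_jump[OF assms(2,3,5)] xval_nonneg[of g r s] xval_nonneg[of g r t]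
    by linarith
  ultimately show ?thesis unfolding loop_excess_def loop_dist_eq[OF True] by linarith
next
  case False
  then have "jump g r = 0" using sp_left_lim_le[OF assms(2,3)] by (simp add: jump_def)
  moreover have "xval g r s = 0" "xval g r t = 0"
    using xval_le_jump[OF assms(2,3,4)] xval_le_jump[OF assms(2,3,5)] xval_nonneg[of g r s] xval_nonneg[of g r t]
      calculation by linarith+
  ultimately show ?thesis by (simp add: loop_excess_def loop_dist_def)
qed

text \<open>Among the neglected loops, the exceptional one costs at most its jump, hence
  \<open>\<eta>\<close>. The others cost \<open>\<omega>\<close> times their coordinates, whose sums
  are bounded by the heights \<open>g s\<close> and \<open>g t\<close>.\<close>

lemma tree_dist_approx:
  assumes "shuffle \<Phi>" "spectrally_positive g" "s \<in> {-1..1}" "t \<in> {-1..1}"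
    and J: "finite J" "J \<subseteq> {-1<..1}" "\<And>r. r \<in> {-1<..1} - J \<Longrightarrow> jump g r \<le> \<eta>"
    and \<omega>: "\<And>u x. u \<in> {0<..\<eta>} \<Longrightarrow> x \<in> {0<..1} \<Longrightarrow> deviation (\<Phi> u) x \<le> \<omega>" "0 \<le> \<omega>" "0 \<le> \<eta>"
  shows "\<bar>tree_dist \<Phi> g s t - climb g s t - (\<Sum>r\<in>J. loop_excess \<Phi> g r s t)\<bar> \<le> \<omega> * (g s + g t) + \<eta>"
proof -
  let ?I = "{-1<..1} - J" and ?h = "\<lambda>r. loop_excess \<Phi> g r s t"
  \<comment> \<open>The exceptional loops; \<open>xval_exceptional_unique\<close> leaves at most
    one.\<close>
  define X where "X = {r \<in> {-1<..1}. xval g r s \<noteq> xval g r t \<and> 0 < xval g r s \<and> 0 < xval g r t}"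
  have sum: "?h summable_on {-1<..1}" using loop_excess_summable[OF assms(1-4)] .
  have sI: "?h summable_on ?I" by (rule summable_on_subset_banach[OF sum]) auto
  have "?I \<union> J = {-1<..1}" using J by auto
  moreover have "(\<Sum>\<^sub>\<infinity>r\<in>?I \<union> J. ?h r) = (\<Sum>\<^sub>\<infinity>r\<in>?I. ?h r) + (\<Sum>\<^sub>\<infinity>r\<in>J. ?h r)"
    by (intro infsum_Un_disjoint sI summable_on_finite J) auto
  ultimately have "(\<Sum>\<^sub>\<infinity>r\<in>{-1<..1}. ?h r) = (\<Sum>\<^sub>\<infinity>r\<in>?I. ?h r) + (\<Sum>\<^sub>\<infinity>r\<in>J. ?h r)"
    by (simp only:)
  then have eq: "tree_dist \<Phi> g s t - climb g s t - (\<Sum>r\<in>J. ?h r) = (\<Sum>\<^sub>\<infinity>r\<in>?I. ?h r)"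
    using J(1) by (simp add: tree_dist_def)
  have "(\<lambda>r. norm (?h r)) summable_on ?I"
    using sI unfolding summable_on_iff_abs_summable_on_real[of ?h ?I] .
  then have "norm (\<Sum>\<^sub>\<infinity>r\<in>?I. ?h r) \<le> (\<Sum>\<^sub>\<infinity>r\<in>?I. norm (?h r))"
    by (rule norm_infsum_bound)
  also have "\<dots> \<le> \<omega> * (g s + g t) + \<eta>"
  proof (rule infsum_le_finite_sums)
    show "(\<lambda>r. norm (?h r)) summable_on ?I" by fact
    fix F assume F: "finite F" "F \<subseteq> ?I"
    have X1: "r = r'" if "r \<in> X" "r' \<in> X" for r r'
      using that unfolding X_def by (intro xval_exceptional_unique[OF assms(2) _ _ assms(3,4)]) blast+
    have "(\<Sum>r\<in>F. norm (?h r)) = (\<Sum>r\<in>F - X. norm (?h r)) + (\<Sum>r\<in>F \<inter> X. norm (?h r))"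
      using F by (metis add.commute sum.Int_Diff)
    also have "(\<Sum>r\<in>F - X. norm (?h r)) \<le> (\<Sum>r\<in>F - X. \<omega> * (xval g r s + xval g r t))"
    proof (rule sum_mono)
      fix r assume r: "r \<in> F - X"
      have "xval g r s = 0 \<or> xval g r t = 0 \<or> xval g r s = xval g r t"
        using r F xval_nonneg[of g r s] xval_nonneg[of g r t] by (auto simp: X_def order_le_less)
      then show "norm (?h r) \<le> \<omega> * (xval g r s + xval g r t)"
        unfolding real_norm_def using r F J(3)[of r]
        by (intro loop_excess_le_deviation assms(1-4) \<omega>) auto
    qed
    also have "\<dots> = \<omega> * ((\<Sum>r\<in>F - X. xval g r s) + (\<Sum>r\<in>F - X. xval g r t))"
      by (simp only: sum.distrib[symmetric] sum_distrib_left)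
    also have "\<dots> \<le> \<omega> * (g s + g t)"
      using F \<omega> by (intro mult_left_mono add_mono sum_xval_le assms) auto
    also have "(\<Sum>r\<in>F \<inter> X. norm (?h r)) \<le> \<eta>"
    proof (cases "F \<inter> X = {}")
      case False
      then obtain r where r: "r \<in> F \<inter> X" by auto
      then have "F \<inter> X = {r}" using X1 by blast
      then have "(\<Sum>r\<in>F \<inter> X. norm (?h r)) = norm (?h r)" by simp
      also have "\<dots> \<le> jump g r"
        unfolding real_norm_def using r F by (intro loop_excess_le_jump assms) auto
      also have "\<dots> \<le> \<eta>" using r F J(3)[of r] by auto
      finally show ?thesis .
    qed (use \<omega> in simp)
    finally show "(\<Sum>r\<in>F. norm (?h r)) \<le> \<omega> * (g s + g t) + \<eta>" by simp
  qed
  finally show ?thesis by (simp add: eq)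
qed

lemma loop_excess_eq:
  assumes "0 < jump g r"
  shows "loop_excess \<Phi> g r s t = 2 * jump g r * circ (loop_pos \<Phi> g r s) (loop_pos \<Phi> g r t)
    - \<bar>xval g r s - xval g r t\<bar>"
  using assms by (simp add: loop_excess_def loop_dist_eq)

section \<open>Excursions and time changes\<close>

lemma excursion_before_0:
  assumes "excursion f" "r \<in> {-1<..<0}"
  shows "left_lim f r = 0" "jump f r = 0"
proof -
  have "eventually (\<lambda>u. u \<in> {-1<..<r}) (at_left r)"
    using assms by (intro eventually_at_leftI[of "-1"]) auto
  then have "eventually (\<lambda>u. f u = 0) (at_left r)"
    by eventually_elim (use assms in \<open>auto simp: excursion_def\<close>)
  then show "left_lim f r = 0" by (intro left_lim_eqI tendsto_eventually)
  then show "jump f r = 0" using assms by (auto simp: jump_def excursion_def)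
qed

lemma excursion_spectrally_positive:
  assumes "excursion f"
  shows "spectrally_positive f"
  unfolding spectrally_positive_def
proof (intro conjI ballI)
  fix t :: real assume "t \<in> {-1<..1}"
  then show "0 \<le> jump f t"
    using assms excursion_before_0(2)[OF assms, of t] by (cases "t < 0") (auto simp: excursion_def)
qed (use assms in \<open>auto simp: excursion_def\<close>)

lemma excursion_valley_neg:
  assumes "excursion f" "s \<in> {-1..<0}" "t \<in> {-1..1}"
  shows "valley f s t = 0"
proof (rule antisym)
  have "valley f s t \<le> f s"
    using assms excursion_spectrally_positive by (intro valley_le) auto
  then show "valley f s t \<le> 0" using assms by (auto simp: excursion_def)
  show "0 \<le> valley f s t"
    using assms excursion_spectrally_positive by (intro valley_nonneg) auto
qed

lemma excursion_xval_eq_0: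
  assumes "excursion f" "r \<in> {-1<..1}" "t \<in> {-1..1}" "r < 0 \<or> t < 0 \<or> t = 1"
  shows "xval f r t = 0"
proof -
  note sp = excursion_spectrally_positive[OF assms(1)]
  consider "t < r" | "r < 0" "r \<le> t" | "t = 1" using assms(4) by linarith
  then show ?thesis
  proof cases
    case 1
    then show ?thesis by (rule xval_less)
  next
    case 2
    then have "jump f r = 0" using assms(2) by (intro excursion_before_0(2)[OF assms(1)]) auto
    then show ?thesis
      using xval_le_jump[OF sp assms(2,3)] xval_nonneg[of f r t] by linarith
  next
    case 3
    then have "f t = 0" using assms(1) by (simp add: excursion_def)
    then show ?thesis
      using xval_le_height[OF sp assms(2,3)] sp_left_lim_nonneg[OF sp assms(2)] xval_nonneg[of f r t] by simp
  qed
qed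

lemma excursion_xval_pos:
  assumes "excursion f" "r \<in> {-1<..1}" "t \<in> {-1..1}" "0 < xval f r t"
  shows "r \<in> {0..1}" "t \<in> {0..1}"
  using excursion_xval_eq_0[OF assms(1-3)] assms by (auto simp: not_less[symmetric])

text \<open>An excursion has no jump before 0, so the additional indices contribute nothing.\<close>

lemma dV_eq_tree_dist:
  assumes \<Phi>: "shuffle \<Phi>" and f: "excursion f" and s: "s \<in> {0..1}" and t: "t \<in> {0..1}"
  shows "dV \<Phi> f s t = tree_dist \<Phi> f s t"
proof -
  note sp = excursion_spectrally_positive[OF f]
  have st: "s \<in> {-1..1}" "t \<in> {-1..1}" using s t by auto
  have x: "xval f r s = 0" "xval f r t = 0" if "r \<in> {-1<..1} - {0..1}" for r
    using that st by (auto intro!: excursion_xval_eq_0[OF f])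
  have "(\<Sum>\<^sub>\<infinity>r\<in>{-1<..1}. \<bar>xval f r s - xval f r t\<bar>) = (\<Sum>\<^sub>\<infinity>r\<in>{0..1}. \<bar>xval f r s - xval f r t\<bar>)"
    using x by (intro infsum_cong_neutral) auto
  moreover have "(\<Sum>\<^sub>\<infinity>r\<in>{-1<..1}. loop_dist \<Phi> f r (xval f r s) (xval f r t)) = dL \<Phi> f s t"
    unfolding dL_def using x by (intro infsum_cong_neutral) (auto simp: loop_dist_def)
  ultimately show ?thesis
    unfolding tree_dist_eq[OF \<Phi> sp st] skeleton_dist_def dV_def dT_def climb_def valley_def by simp
qed

lemma excursion_tree_dist_base:
  assumes "excursion f" "t \<in> {-1..<0}"
  shows "tree_dist \<Phi> f t 1 = 0"
proof -
  have "loop_excess \<Phi> f r t 1 = 0" if "r \<in> {-1<..1}" for r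
    using excursion_xval_eq_0[OF assms(1) that, of t] excursion_xval_eq_0[OF assms(1) that, of 1] assms
    by (simp add: loop_excess_def loop_dist_def)
  then have "(\<Sum>\<^sub>\<infinity>r\<in>{-1<..1}. loop_excess \<Phi> f r t 1) = 0" by (rule infsum_0)
  moreover have "climb f t 1 = 0"
    using excursion_valley_neg[OF assms, of 1] assms by (auto simp: climb_def excursion_def)
  ultimately show ?thesis by (simp add: tree_dist_def)
qed

text \<open>Around every time there are two one-sided neighbourhoods on which the path stays within
  \<open>\<eta> / 2\<close> of a constant, and inside them no jump exceeds \<open>\<eta>\<close>.
  Large jumps can only sit at the centres of a finite cover.\<close>

lemma finite_large_jumps:
  assumes f: "spectrally_positive f" and e: "0 < \<eta>"
  shows "finite {r \<in> {-1<..1}. \<eta> < jump f r}"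
proof -
  have "\<exists>d>0. (\<forall>u. u \<in> {t..<t + d} \<inter> {-1..1} \<longrightarrow> \<bar>f u - f t\<bar> < \<eta> / 2) \<and>
    (\<forall>u. u \<in> {t - d<..<t} \<inter> {-1..1} \<longrightarrow> \<bar>f u - left_lim f t\<bar> < \<eta> / 2)" if "t \<in> {-1..1}" for t
    using cadlag_two_sided[OF sp_cadlag[OF f] that, of "\<eta> / 2"] e by (metis half_gt_zero)
  then obtain d where d: "\<And>t. t \<in> {-1..1} \<Longrightarrow> 0 < d t"
    "\<And>t u. t \<in> {-1..1} \<Longrightarrow> u \<in> {t..<t + d t} \<inter> {-1..1} \<Longrightarrow> \<bar>f u - f t\<bar> < \<eta> / 2"
    "\<And>t u. t \<in> {-1..1} \<Longrightarrow> u \<in> {t - d t<..<t} \<inter> {-1..1} \<Longrightarrow> \<bar>f u - left_lim f t\<bar> < \<eta> / 2"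
    by metis
  obtain E where E: "finite E" "E \<subseteq> {-1..1}" "\<And>t. t \<in> {-1..1} \<Longrightarrow> \<exists>s\<in>E. \<bar>t - s\<bar> < d s"
    using finite_ball_cover[of "-1" 1 d] d(1) by metis
  have jump_le: "jump f r \<le> \<eta>" if r: "r \<in> {-1<..1}" "a < r" "-1 \<le> a"
    and u: "\<And>u. u \<in> {a<..r} \<Longrightarrow> \<bar>f u - c\<bar> < \<eta> / 2" for r a c
  proof -
    have "c - \<eta> / 2 \<le> left_lim f r"
    proof (rule left_lim_ge[OF sp_cadlag[OF f] r(1)])
      show "(a + r) / 2 < r" using r by simp
      fix v assume "v \<in> {(a + r) / 2..<r}"
      then have "v \<in> {a<..r}" using r by auto
      from u[OF this] show "c - \<eta> / 2 \<le> f v" unfolding abs_less_iff by linarith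
    qed
    moreover have "f r < c + \<eta> / 2" using u[of r] r unfolding abs_less_iff by auto
    ultimately show ?thesis by (simp add: jump_def)
  qed
  have "r \<in> E" if r: "r \<in> {-1<..1}" "\<eta> < jump f r" for r
  proof (rule ccontr)
    assume "r \<notin> E"
    obtain s where s: "s \<in> E" "\<bar>r - s\<bar> < d s" using E(3)[of r] r by auto
    have s1: "s \<in> {-1..1}" using s E by auto
    have "s \<noteq> r" using s \<open>r \<notin> E\<close> by auto
    then consider "s < r" | "r < s" by linarith
    then have "jump f r \<le> \<eta>"
    proof cases
      case 1
      show ?thesis
      proof (rule jump_le[of r s "f s"])
        show "\<bar>f u - f s\<bar> < \<eta> / 2" if "u \<in> {s<..r}" for u
          using that s s1 r by (intro d(2)) auto
      qed (use 1 r s1 in auto)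
    next
      case 2
      show ?thesis
      proof (rule jump_le[of r "max (-1) (s - d s)" "left_lim f s"])
        show "\<bar>f u - left_lim f s\<bar> < \<eta> / 2" if "u \<in> {max (-1) (s - d s)<..r}" for u
          using that s s1 r 2 by (intro d(3)) auto
      qed (use 2 r s in auto)
    qed
    with r show False by simp
  qed
  then show ?thesis by (intro finite_subset[OF _ E(1)]) auto
qed

section \<open>Increasing bijections and invariance under time changes\<close>

lemma increasing_bijectionsD:
  assumes "l \<in> increasing_bijections a b"
  shows "\<And>x y. x \<in> {a..b} \<Longrightarrow> y \<in> {a..b} \<Longrightarrow> l x < l y \<longleftrightarrow> x < y"
    "\<And>x y. x \<in> {a..b} \<Longrightarrow> y \<in> {a..b} \<Longrightarrow> l x \<le> l y \<longleftrightarrow> x \<le> y"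
    "\<And>x. x \<in> {a..b} \<Longrightarrow> l x \<in> {a..b}"
    "\<And>y. y \<in> {a..b} \<Longrightarrow> \<exists>x\<in>{a..b}. l x = y"
proof -
  have m: "strict_mono_on {a..b} l" and b: "bij_betw l {a..b} {a..b}"
    using assms by (auto simp: increasing_bijections_def)
  show lt: "l x < l y \<longleftrightarrow> x < y" if "x \<in> {a..b}" "y \<in> {a..b}" for x y
    using strict_mono_onD[OF m that] strict_mono_onD[OF m that(2,1)]
    by (cases x y rule: linorder_cases) auto
  show "l x \<le> l y \<longleftrightarrow> x \<le> y" if "x \<in> {a..b}" "y \<in> {a..b}" for x y
    using lt[OF that(2,1)] by linarith
  show "l x \<in> {a..b}" if "x \<in> {a..b}" for x using b that by (auto simp: bij_betw_def)
  show "\<exists>x\<in>{a..b}. l x = y" if "y \<in> {a..b}" for y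
    using b that by (metis bij_betw_imp_surj_on imageE)
qed

lemma increasing_bijections_inverse:
  assumes "l \<in> increasing_bijections a b"
  obtains k where "k \<in> increasing_bijections a b"
    "\<And>x. x \<in> {a..b} \<Longrightarrow> k (l x) = x" "\<And>x. x \<in> {a..b} \<Longrightarrow> l (k x) = x"
proof -
  define k where "k = the_inv_into {a..b} l"
  have b: "bij_betw l {a..b} {a..b}" and inj: "inj_on l {a..b}"
    using assms by (auto simp: increasing_bijections_def bij_betw_def)
  have kb: "bij_betw k {a..b} {a..b}" unfolding k_def by (rule bij_betw_the_inv_into[OF b])
  have kl: "k (l x) = x" if "x \<in> {a..b}" for x
    using that inj by (simp add: k_def the_inv_into_f_f)
  have lk: "l (k x) = x" if "x \<in> {a..b}" for x
    using that b unfolding k_def by (intro f_the_inv_into_f_bij_betw) auto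
  have "strict_mono_on {a..b} k"
  proof (rule strict_mono_onI)
    fix x y assume xy: "x \<in> {a..b}" "y \<in> {a..b}" "x < y"
    have "k x \<in> {a..b}" "k y \<in> {a..b}" using kb xy by (auto simp: bij_betw_def)
    then show "k x < k y" using increasing_bijectionsD(1)[OF assms, of "k x" "k y"] lk xy by simp
  qed
  then have "k \<in> increasing_bijections a b" using kb by (simp add: increasing_bijections_def)
  then show ?thesis using that kl lk by blast
qed

lemma increasing_bijections_endpoints:
  assumes "l \<in> increasing_bijections a b" "a \<le> b"
  shows "l a = a" "l b = b"
proof -
  note D = increasing_bijectionsD[OF assms(1)]
  obtain x where x: "x \<in> {a..b}" "l x = a" using D(4)[of a] assms by auto
  have "l a \<le> l x" using D(2)[of a x] x assms by auto
  then show "l a = a" using x D(3)[of a] assms by auto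
  obtain y where y: "y \<in> {a..b}" "l y = b" using D(4)[of b] assms by auto
  have "l y \<le> l b" using D(2)[of y b] y assms by auto
  then show "l b = b" using y D(3)[of b] assms by auto
qed

lemma increasing_bijections_image:
  assumes "l \<in> increasing_bijections a b" "s \<in> {a..b}" "t \<in> {a..b}"
  shows "l ` {s..t} = {l s..l t}"
proof -
  note D = increasing_bijectionsD[OF assms(1)]
  show ?thesis
  proof (intro equalityI subsetI)
    fix y assume "y \<in> l ` {s..t}"
    then obtain x where x: "x \<in> {s..t}" "y = l x" by auto
    then show "y \<in> {l s..l t}" using D(2)[of s x] D(2)[of x t] assms by auto
  next
    fix y assume y: "y \<in> {l s..l t}"
    then have "y \<in> {a..b}" using D(3)[of s] D(3)[of t] assms by auto
    then obtain x where x: "x \<in> {a..b}" "l x = y" using D(4) by blast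
    then have "x \<in> {s..t}" using D(2)[of s x] D(2)[of x t] assms y by auto
    then show "y \<in> l ` {s..t}" using x by auto
  qed
qed

text \<open>Continuity is not part of \<open>increasing_bijections\<close>. It follows from
  surjectivity: a level just below \<open>l t\<close> has a preimage, and monotonicity makes this
  preimage the end of a left neighbourhood of \<open>t\<close>.\<close>

lemma increasing_bijections_at_left:
  assumes "l \<in> increasing_bijections a b" "t \<in> {a<..b}"
  shows "filterlim l (at_left (l t)) (at_left t)"
  unfolding filterlim_iff
proof (intro allI impI)
  note D = increasing_bijectionsD[OF assms(1)]
  have ab: "a \<le> b" using assms by auto
  fix P assume "eventually P (at_left (l t))"
  then obtain y where y: "y < l t" "\<And>u. y < u \<Longrightarrow> u < l t \<Longrightarrow> P u"
    by (auto simp: eventually_at_left_field)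
  have "max y a \<in> {a..b}" using y(1) D(3)[of t] assms by auto
  then obtain x where x: "x \<in> {a..b}" "l x = max y a" using D(4) by blast
  have "l a < l t" using D(1)[of a t] assms ab by auto
  then have "l x < l t" using x y increasing_bijections_endpoints[OF assms(1) ab] by auto
  then have xt: "x < t" using D(1)[of x t] x assms by auto
  show "eventually (\<lambda>u. P (l u)) (at_left t)"
    unfolding eventually_at_left_field
  proof (intro exI[of _ x] conjI allI impI xt)
    fix u assume u: "x < u" "u < t"
    have "l x < l u" "l u < l t" using D(1)[of x u] D(1)[of u t] x u assms by auto
    then show "P (l u)" using y(2) x by auto
  qed
qed

lemma increasing_bijections_at_right:
  assumes "l \<in> increasing_bijections a b" "t \<in> {a..<b}"
  shows "filterlim l (at_right (l t)) (at_right t)"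
  unfolding filterlim_iff
proof (intro allI impI)
  note D = increasing_bijectionsD[OF assms(1)]
  have ab: "a \<le> b" using assms by auto
  fix P assume "eventually P (at_right (l t))"
  then obtain y where y: "l t < y" "\<And>u. l t < u \<Longrightarrow> u < y \<Longrightarrow> P u"
    by (auto simp: eventually_at_right_field)
  have "min y b \<in> {a..b}" using y(1) D(3)[of t] assms by auto
  then obtain x where x: "x \<in> {a..b}" "l x = min y b" using D(4) by blast
  have "l t < l b" using D(1)[of t b] assms ab by auto
  then have "l t < l x" using x y increasing_bijections_endpoints[OF assms(1) ab] by auto
  then have xt: "t < x" using D(1)[of t x] x assms by auto
  show "eventually (\<lambda>u. P (l u)) (at_right t)"
    unfolding eventually_at_right_field
  proof (intro exI[of _ x] conjI allI impI xt)
    fix u assume u: "t < u" "u < x"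
    have "l t < l u" "l u < l x" using D(1)[of u x] D(1)[of t u] x u assms by auto
    then show "P (l u)" using y(2) x by auto
  qed
qed

lemma left_lim_time_change:
  assumes "l \<in> increasing_bijections (-1) 1" "cadlag f" "t \<in> {-1<..1}"
  shows "((\<lambda>u. f (l u)) \<longlongrightarrow> left_lim f (l t)) (at_left t)"
    "left_lim (\<lambda>u. f (l u)) t = left_lim f (l t)" "l t \<in> {-1<..1}"
proof -
  note D = increasing_bijectionsD[OF assms(1)]
  have "l (-1) < l t" using D(1)[of "-1" t] assms by auto
  then show lt: "l t \<in> {-1<..1}"
    using D(3)[of t] assms increasing_bijections_endpoints[OF assms(1)] by auto
  show "((\<lambda>u. f (l u)) \<longlongrightarrow> left_lim f (l t)) (at_left t)"
    by (rule filterlim_compose[OF cadlag_left_lim[OF assms(2) lt] increasing_bijections_at_left[OF assms(1,3)]])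
  then show "left_lim (\<lambda>u. f (l u)) t = left_lim f (l t)" by (rule left_lim_eqI)
qed

lemma spectrally_positive_time_change:
  assumes l: "l \<in> increasing_bijections (-1) 1" and f: "spectrally_positive f"
  shows "spectrally_positive (\<lambda>u. f (l u))"
  unfolding spectrally_positive_def cadlag_def
proof (intro conjI ballI)
  note D = increasing_bijectionsD[OF l]
  note cf = sp_cadlag[OF f]
  show "continuous (at_right t) (\<lambda>u. f (l u))" if t: "t \<in> {-1..<1}" for t
  proof -
    have "l t < l 1" using D(1)[of t 1] t by auto
    then have "l t \<in> {-1..<1}" using D(3)[of t] increasing_bijections_endpoints[OF l] t by auto
    then have "(f \<longlongrightarrow> f (l t)) (at_right (l t))"
      using cf by (auto simp: cadlag_def continuous_within)
    from filterlim_compose[OF this increasing_bijections_at_right[OF l t]]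
    show ?thesis by (simp add: continuous_within)
  qed
  show "\<exists>c. ((\<lambda>u. f (l u)) \<longlongrightarrow> c) (at_left t)" if "t \<in> {-1<..1}" for t
    using left_lim_time_change(1)[OF l cf that] by blast
  show "0 \<le> f (l t)" if "t \<in> {-1..1}" for t using sp_nonneg[OF f] D(3) that by blast
  show "0 \<le> jump (\<lambda>u. f (l u)) t" if t: "t \<in> {-1<..1}" for t
    using left_lim_time_change[OF l cf t] f by (auto simp: jump_def spectrally_positive_def)
qed

lemma valley_time_change:
  assumes l: "l \<in> increasing_bijections (-1) 1" and "s \<in> {-1..1}" "t \<in> {-1..1}"
  shows "valley (\<lambda>u. f (l u)) s t = valley f (l s) (l t)"
proof -
  note D = increasing_bijectionsD[OF l]
  have mm: "min (l s) (l t) = l (min s t)" "max (l s) (l t) = l (max s t)"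
    using D(2)[of s t] D(2)[of t s] assms by (auto simp: min_def max_def)
  have "l ` {min s t..max s t} = {l (min s t)..l (max s t)}"
    using assms by (intro increasing_bijections_image[OF l]) (auto simp: min_def max_def)
  then have "{min (l s) (l t)..max (l s) (l t)} = l ` {min s t..max s t}" by (simp add: mm)
  then show ?thesis unfolding valley_def by (simp add: image_image)
qed

lemma xval_time_change:
  assumes l: "l \<in> increasing_bijections (-1) 1" and "cadlag f" "r \<in> {-1<..1}" "t \<in> {-1..1}"
  shows "xval (\<lambda>u. f (l u)) r t = xval f (l r) (l t)"
proof -
  have r: "r \<in> {-1..1}" using assms by auto
  have "r \<le> t \<longleftrightarrow> l r \<le> l t" using increasing_bijectionsD(2)[OF l r assms(4)] by simp
  then show ?thesis
    using left_lim_time_change(2)[OF l assms(2,3)] valley_time_change[OF l r assms(4), of f]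
    by (cases "r \<le> t") (auto simp: xval_eq xval_less)
qed

text \<open>An increasing bijection fixes both endpoints, so it permutes the index set
  \<open>(-1, 1]\<close> and the infinite sum is merely reindexed.\<close>

lemma tree_dist_time_change:
  assumes l: "l \<in> increasing_bijections (-1) 1" and f: "cadlag f" and st: "s \<in> {-1..1}" "t \<in> {-1..1}"
  shows "tree_dist \<Phi> (\<lambda>u. f (l u)) s t = tree_dist \<Phi> f (l s) (l t)"
proof -
  note D = increasing_bijectionsD[OF l]
  have im: "l ` {-1<..1} = {-1<..1}"
  proof (intro equalityI subsetI)
    fix y assume "y \<in> l ` {-1<..1}"
    then show "y \<in> {-1<..1}" using left_lim_time_change(3)[OF l f] by auto
  next
    fix y :: real assume y: "y \<in> {-1<..1}"
    then obtain x where x: "x \<in> {-1..1}" "l x = y" using D(4)[of y] by auto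
    then have "x \<noteq> -1" using increasing_bijections_endpoints[OF l] y by auto
    then show "y \<in> l ` {-1<..1}" using x by force
  qed
  have inj: "inj_on l {-1<..1}"
  proof (rule inj_on_subset)
    show "inj_on l {-1..1}" using l by (auto simp: increasing_bijections_def bij_betw_def)
  qed auto
  have "loop_excess \<Phi> (\<lambda>u. f (l u)) r s t = loop_excess \<Phi> f (l r) (l s) (l t)" if "r \<in> {-1<..1}" for r
    using left_lim_time_change(2)[OF l f that] st
    by (simp add: loop_excess_def loop_dist_def jump_def xval_time_change[OF l f that])
  then have "(\<Sum>\<^sub>\<infinity>r\<in>{-1<..1}. loop_excess \<Phi> (\<lambda>u. f (l u)) r s t)
      = (\<Sum>\<^sub>\<infinity>r\<in>{-1<..1}. loop_excess \<Phi> f (l r) (l s) (l t))"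
    by (intro infsum_cong)
  also have "\<dots> = (\<Sum>\<^sub>\<infinity>r\<in>l ` {-1<..1}. loop_excess \<Phi> f r (l s) (l t))"
    using infsum_reindex[OF inj, of "\<lambda>r. loop_excess \<Phi> f r (l s) (l t)"] by (simp add: o_def)
  finally show ?thesis
    by (simp add: tree_dist_def climb_def valley_time_change[OF l st] im)
qed

text \<open>The boundedness assumption guarantees that the supremum inside the infimum dominates the
  individual distances; for the displacement of \<open>l\<close> this is automatic.\<close>

lemma skorokhod_distD:
  assumes "skorokhod_dist a b D f g < e" "a \<le> b"
    and "\<And>l. l \<in> increasing_bijections a b \<Longrightarrow> bdd_above ((\<lambda>x. D (f x) (g (l x))) ` {a..b})"
  obtains l where "l \<in> increasing_bijections a b" "\<And>x. x \<in> {a..b} \<Longrightarrow> \<bar>l x - x\<bar> < e"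
    "\<And>x. x \<in> {a..b} \<Longrightarrow> D (f x) (g (l x)) < e"
proof -
  have "(\<lambda>x. x) \<in> increasing_bijections a b"
    by (auto simp: increasing_bijections_def strict_mono_on_def bij_betw_def inj_on_def)
  then have ne: "increasing_bijections a b \<noteq> {}" by auto
  obtain l where l: "l \<in> increasing_bijections a b"
    "max (SUP x\<in>{a..b}. \<bar>l x - x\<bar>) (SUP x\<in>{a..b}. D (f x) (g (l x))) < e"
  proof -
    let ?m = "\<lambda>l. max (SUP x\<in>{a..b}. \<bar>l x - x\<bar>) (SUP x\<in>{a..b}. D (f x) (g (l x)))"
    have "\<exists>z\<in>?m ` increasing_bijections a b. z < e"
      by (rule cInf_lessD[OF _ assms(1)[unfolded skorokhod_dist_def]]) (use ne in blast)
    then show thesis using that by blast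
  qed
  show ?thesis
  proof
    show "l \<in> increasing_bijections a b" by fact
    fix x assume x: "x \<in> {a..b}"
    have "bdd_above ((\<lambda>x. \<bar>l x - x\<bar>) ` {a..b})"
    proof (rule bdd_aboveI2)
      fix x assume "x \<in> {a..b}"
      then show "\<bar>l x - x\<bar> \<le> b - a" using increasing_bijectionsD(3)[OF l(1), of x] by auto
    qed
    then have "\<bar>l x - x\<bar> \<le> (SUP x\<in>{a..b}. \<bar>l x - x\<bar>)" using x by (intro cSUP_upper)
    then show "\<bar>l x - x\<bar> < e" using l(2) by auto
    have "D (f x) (g (l x)) \<le> (SUP x\<in>{a..b}. D (f x) (g (l x)))"
      using x assms(3)[OF l(1)] by (intro cSUP_upper)
    then show "D (f x) (g (l x)) < e" using l(2) by auto
  qed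
qed

section \<open>One-sided limits and compactness\<close>

text \<open>The bound \<open>b\<close> may depend on \<open>e\<close>. This fits tree distances,
  where each choice of finitely many loops leaves an error that is small but does not
  vanish.\<close>

lemma tendsto_zero_approx:
  fixes a :: "'a \<Rightarrow> real"
  assumes "eventually (\<lambda>k. 0 \<le> a k) F"
    and "\<And>e. 0 < e \<Longrightarrow> \<exists>b. (b \<longlongrightarrow> 0) F \<and> eventually (\<lambda>k. a k \<le> b k + e) F"
  shows "(a \<longlongrightarrow> 0) F"
proof (rule tendstoI)
  fix e :: real assume "0 < e"
  then obtain b where b: "(b \<longlongrightarrow> 0) F" "eventually (\<lambda>k. a k \<le> b k + e / 2) F"
    using assms(2)[of "e / 2"] by auto
  have "eventually (\<lambda>k. b k < e / 2) F" using order_tendstoD(2)[OF b(1), of "e / 2"] \<open>0 < e\<close> by simp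
  with assms(1) b(2) show "eventually (\<lambda>k. dist (a k) 0 < e) F"
    by eventually_elim (auto simp: dist_real_def)
qed

definition close_path :: "real \<Rightarrow> (real \<Rightarrow> real) \<Rightarrow> (real \<Rightarrow> real) \<Rightarrow> bool" where
  "close_path \<rho> f g \<longleftrightarrow> spectrally_positive g \<and> (\<forall>u\<in>{-1..1}. \<bar>g u - f u\<bar> \<le> \<rho>)"

lemma close_pathD:
  assumes "close_path \<rho> f g"
  shows "spectrally_positive g" "\<And>u. u \<in> {-1..1} \<Longrightarrow> \<bar>g u - f u\<bar> \<le> \<rho>"
  using assms unfolding close_path_def by blast+

lemma close_path_mono: "close_path \<rho> f g \<Longrightarrow> \<rho> \<le> \<rho>' \<Longrightarrow> close_path \<rho>' f g"
  by (force simp: close_path_def)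

lemma close_path_refl: "spectrally_positive f \<Longrightarrow> 0 \<le> \<rho> \<Longrightarrow> close_path \<rho> f f"
  by (simp add: close_path_def)

text \<open>One finite set of loops must serve every path close to \<open>f\<close>. The estimate is
  required for all larger finite sets \<open>K\<close> too, so that prescribed loops can be added;
  positive jumps make the positions on these loops meaningful for \<open>g\<close>.\<close>

definition dominant_loops ::
  "(real \<Rightarrow> real \<Rightarrow> real) \<Rightarrow> (real \<Rightarrow> real) \<Rightarrow> real \<Rightarrow> real set \<Rightarrow> real \<Rightarrow> bool" where
  "dominant_loops \<Phi> f \<epsilon> J \<rho> \<longleftrightarrow> finite J \<and> J \<subseteq> {-1<..1} \<and> 0 < \<rho> \<and>
    (\<forall>g. close_path \<rho> f g \<longrightarrow> (\<forall>r\<in>J. 0 < jump g r) \<and>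
      (\<forall>s\<in>{-1..1}. \<forall>t\<in>{-1..1}. \<forall>K. finite K \<and> J \<subseteq> K \<and> K \<subseteq> {-1<..1} \<longrightarrow>
        \<bar>tree_dist \<Phi> g s t - climb g s t - (\<Sum>r\<in>K. loop_excess \<Phi> g r s t)\<bar> \<le> \<epsilon>))"

lemma dominant_loopsD:
  assumes "dominant_loops \<Phi> f \<epsilon> J \<rho>"
  shows "finite J" "J \<subseteq> {-1<..1}" "0 < \<rho>"
    and "\<And>g r. close_path \<rho> f g \<Longrightarrow> r \<in> J \<Longrightarrow> 0 < jump g r"
    and "\<And>g s t K. close_path \<rho> f g \<Longrightarrow> s \<in> {-1..1} \<Longrightarrow> t \<in> {-1..1} \<Longrightarrow> finite K \<Longrightarrow> J \<subseteq> K \<Longrightarrow>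
      K \<subseteq> {-1<..1} \<Longrightarrow> \<bar>tree_dist \<Phi> g s t - climb g s t - (\<Sum>r\<in>K. loop_excess \<Phi> g r s t)\<bar> \<le> \<epsilon>"
  using assms unfolding dominant_loops_def by blast+

lemma dominant_loops_exist:
  assumes \<Phi>: "shuffle \<Phi>" and f: "spectrally_positive f" and e: "0 < \<epsilon>"
  obtains J \<rho> where "dominant_loops \<Phi> f \<epsilon> J \<rho>"
proof -
  obtain M where M: "0 < M" "\<And>t. t \<in> {-1..1} \<Longrightarrow> \<bar>f t\<bar> \<le> M"
    using cadlag_bounded[OF sp_cadlag[OF f]] by metis
  \<comment> \<open>Paths within distance 1 of \<open>f\<close> have height at most
    \<open>M + 1\<close>, so two heights times \<open>\<omega>\<close> make up
    \<open>\<epsilon> / 2\<close>. The other half pays for the exceptional loop.\<close>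
  define \<omega> where "\<omega> = \<epsilon> / (4 * (M + 1))"
  have \<omega>: "0 < \<omega>" using e M by (simp add: \<omega>_def)
  obtain \<eta>0 where \<eta>0: "0 < \<eta>0" "\<And>u x. u \<in> {0<..\<eta>0} \<Longrightarrow> x \<in> {0<..1} \<Longrightarrow> deviation (\<Phi> u) x \<le> \<omega>"
    using shuffle_deviation_small[OF \<Phi> \<omega>] by metis
  define \<eta> where "\<eta> = min \<eta>0 (\<epsilon> / 2)"
  have \<eta>: "0 < \<eta>" "\<eta> \<le> \<epsilon> / 2" "\<eta> \<le> \<eta>0" using \<eta>0 e by (auto simp: \<eta>_def)
  \<comment> \<open>The threshold is half of \<open>\<eta>\<close>: jumps move by at most
    \<open>2 * \<rho> \<le> \<eta> / 4\<close>, so for every nearby path the loops outside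
    \<open>J\<close> have jump at most \<open>\<eta>\<close> and those in \<open>J\<close> keep a
    positive jump.\<close>
  define J where "J = {r \<in> {-1<..1}. \<eta> / 2 < jump f r}"
  define \<rho> where "\<rho> = min 1 (\<eta> / 8)"
  have \<rho>: "0 < \<rho>" "\<rho> \<le> 1" "\<rho> \<le> \<eta> / 8" using \<eta> by (auto simp: \<rho>_def)
  have big: "0 < jump g r" if g: "close_path \<rho> f g" and r: "r \<in> J" for g r
  proof -
    have "r \<in> {-1<..1}" using r by (simp add: J_def)
    from jump_close[OF sp_cadlag[OF close_pathD(1)[OF g]] sp_cadlag[OF f] this close_pathD(2)[OF g]]
    have "\<bar>jump g r - jump f r\<bar> \<le> 2 * \<rho>" by simp
    moreover have "\<eta> / 2 < jump f r" using r by (simp add: J_def)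
    ultimately show ?thesis using \<rho> \<eta> by linarith
  qed
  have approx: "\<bar>tree_dist \<Phi> g s t - climb g s t - (\<Sum>r\<in>K. loop_excess \<Phi> g r s t)\<bar> \<le> \<epsilon>"
    if g: "close_path \<rho> f g" and st: "s \<in> {-1..1}" "t \<in> {-1..1}"
      and K: "finite K" "J \<subseteq> K" "K \<subseteq> {-1<..1}" for g s t K
  proof -
    note gD = close_pathD[OF g]
    have small: "jump g r \<le> \<eta>" if "r \<in> {-1<..1} - K" for r
    proof -
      have "\<bar>jump g r - jump f r\<bar> \<le> 2 * \<rho>"
        using that by (intro jump_close sp_cadlag gD f) auto
      moreover have "jump f r \<le> \<eta> / 2" using that K by (auto simp: J_def not_less)
      ultimately show ?thesis using \<rho> \<eta> by linarith
    qed
    have "\<bar>tree_dist \<Phi> g s t - climb g s t - (\<Sum>r\<in>K. loop_excess \<Phi> g r s t)\<bar> \<le> \<omega> * (g s + g t) + \<eta>"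
      by (rule tree_dist_approx[OF \<Phi> gD(1) st K(1,3) small]) (use \<eta>0(2) \<eta> \<omega> in auto)
    also have "\<omega> * (g s + g t) \<le> \<omega> * (2 * (M + 1))"
    proof (rule mult_left_mono)
      have "g s \<le> M + 1" using M(2)[OF st(1)] gD(2)[OF st(1)] \<rho> by linarith
      moreover have "g t \<le> M + 1" using M(2)[OF st(2)] gD(2)[OF st(2)] \<rho> by linarith
      ultimately have "g s + g t \<le> (M + 1) + (M + 1)" by (rule add_mono)
      then show "g s + g t \<le> 2 * (M + 1)" by simp
    qed (use \<omega> in simp)
    also have "\<omega> * (2 * (M + 1)) = \<epsilon> / 2" using M by (simp add: \<omega>_def field_simps)
    finally show ?thesis using \<eta> by linarith
  qed
  have "finite J" unfolding J_def using finite_large_jumps[OF f, of "\<eta> / 2"] \<eta> by simp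
  moreover have "J \<subseteq> {-1<..1}" by (auto simp: J_def)
  ultimately have "dominant_loops \<Phi> f \<epsilon> J \<rho>"
    unfolding dominant_loops_def using \<rho>(1) big approx by blast
  then show ?thesis by (rule that)
qed

section \<open>Continuity of a shuffle at a position\<close>

definition circ_continuous :: "(real \<Rightarrow> real) \<Rightarrow> real \<Rightarrow> bool" where
  "circ_continuous \<phi> y \<longleftrightarrow> ((\<lambda>y'. circ (\<phi> y') (\<phi> y)) \<longlongrightarrow> 0) (at y within {0..1})"

lemma circ_continuousD:
  assumes "circ_continuous \<phi> y" "0 < e"
  obtains \<theta> where "0 < \<theta>" "\<And>y'. y' \<in> {0..1} \<Longrightarrow> \<bar>y' - y\<bar> < \<theta> \<Longrightarrow> circ (\<phi> y') (\<phi> y) < e"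
proof -
  have "eventually (\<lambda>y'. circ (\<phi> y') (\<phi> y) < e) (at y within {0..1})"
    using assms unfolding circ_continuous_def by (auto dest: order_tendstoD)
  then obtain \<theta> where \<theta>: "0 < \<theta>" "\<And>y'. y' \<in> {0..1} \<Longrightarrow> y' \<noteq> y \<Longrightarrow> dist y' y < \<theta> \<Longrightarrow> circ (\<phi> y') (\<phi> y) < e"
    by (auto simp: eventually_at)
  show ?thesis
  proof
    show "circ (\<phi> y') (\<phi> y) < e" if "y' \<in> {0..1}" "\<bar>y' - y\<bar> < \<theta>" for y'
      using \<theta>(2)[of y'] that assms(2) by (cases "y' = y") (auto simp: dist_real_def)
  qed fact
qed

lemma circ_continuousI:
  assumes "\<phi> \<in> caglad_circ" "y \<in> {0..1}"
    and "\<And>e. 0 < e \<Longrightarrow> \<exists>\<theta>>0. \<forall>y'\<in>{0..1}. \<bar>y' - y\<bar> < \<theta> \<longrightarrow> circ (\<phi> y') (\<phi> y) \<le> e"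
  shows "circ_continuous \<phi> y"
  unfolding circ_continuous_def
proof (rule tendstoI)
  fix e :: real assume e: "0 < e"
  then obtain \<theta> where \<theta>: "0 < \<theta>" "\<And>y'. y' \<in> {0..1} \<Longrightarrow> \<bar>y' - y\<bar> < \<theta> \<Longrightarrow> circ (\<phi> y') (\<phi> y) \<le> e / 2"
    using assms(3)[of "e / 2"] by auto
  have nn: "0 \<le> circ (\<phi> y') (\<phi> y)" if "y' \<in> {0..1}" for y'
    using assms(1,2) that unfolding caglad_circ_def by (intro circ_nonneg) blast+
  have "dist (circ (\<phi> y') (\<phi> y)) 0 < e" if "y' \<in> {0..1}" "dist y' y < \<theta>" for y'
    using \<theta>(2)[of y'] nn[of y'] that e by (auto simp: dist_real_def)
  then show "eventually (\<lambda>y'. dist (circ (\<phi> y') (\<phi> y)) 0 < e) (at y within {0..1})"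
    using \<theta>(1) unfolding eventually_at by blast
qed

text \<open>A caglad function only has some right limit at 0; the Lipschitz bound forces it to be
  the value there. So coordinate 0, which \<open>bset2\<close> excludes, is harmless.\<close>

lemma circ_continuous_0:
  assumes "shuffle \<Phi>" "0 < \<Delta>"
  shows "circ_continuous (\<Phi> \<Delta>) 0"
proof (rule circ_continuousI)
  obtain C where C: "0 < C" "\<And>u x. u \<in> {0<..\<Delta>} \<Longrightarrow> x \<in> {0..1} \<Longrightarrow> circ (\<Phi> u 0) (\<Phi> u x) \<le> C * x"
    using shuffle_circ_0_le[OF assms] by metis
  fix e :: real assume "0 < e"
  have "circ (\<Phi> \<Delta> y') (\<Phi> \<Delta> 0) \<le> e" if "y' \<in> {0..1}" "\<bar>y' - 0\<bar> < e / C" for y'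
  proof -
    have "circ (\<Phi> \<Delta> y') (\<Phi> \<Delta> 0) \<le> C * y'"
      using C(2)[of \<Delta> y'] that assms(2) by (simp add: circ_commute)
    also have "\<dots> \<le> e" using that C(1) by (auto simp: field_simps)
    finally show ?thesis .
  qed
  then show "\<exists>\<theta>>0. \<forall>y'\<in>{0..1}. \<bar>y' - 0\<bar> < \<theta> \<longrightarrow> circ (\<Phi> \<Delta> y') (\<Phi> \<Delta> 0) \<le> e"
    using \<open>0 < e\<close> C(1) by (intro exI[of _ "e / C"]) auto
qed (use assms shuffle_caglad in auto)

text \<open>Near \<open>y\<close> the function has two limiting values: its own on the left,
  \<open>c\<close> on the right. At \<open>y = 1\<close> the right side is empty and
  \<open>c\<close> can be the value itself.\<close>

lemma caglad_circ_sides: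
  assumes "\<phi> \<in> caglad_circ" "y \<in> {0..1}"
  obtains c where "c \<in> {0..1}" "circ_continuous \<phi> y \<Longrightarrow> c = \<phi> y"
    "\<And>e. 0 < e \<Longrightarrow> \<exists>\<theta>>0. \<forall>y'\<in>{0..1}. \<bar>y' - y\<bar> < \<theta> \<longrightarrow>
      (y' \<le> y \<longrightarrow> circ (\<phi> y') (\<phi> y) < e) \<and> (y < y' \<longrightarrow> circ (\<phi> y') c < e)"
proof -
  have rng: "\<phi> y \<in> {0..1}" using assms unfolding caglad_circ_def by blast
  have left: "\<exists>\<theta>>0. \<forall>y'\<in>{0..1}. \<bar>y' - y\<bar> < \<theta> \<longrightarrow> y' \<le> y \<longrightarrow> circ (\<phi> y') (\<phi> y) < e" if e: "0 < e" for e
  proof (cases "y = 0")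
    case True
    then show ?thesis using e by (intro exI[of _ 1]) auto
  next
    case False
    then have "((\<lambda>y'. circ (\<phi> y') (\<phi> y)) \<longlongrightarrow> 0) (at_left y)"
      using assms unfolding caglad_circ_def by auto
    then have "eventually (\<lambda>y'. circ (\<phi> y') (\<phi> y) < e) (at_left y)"
      using e by (auto dest: order_tendstoD)
    then obtain b where b: "b < y" "\<And>y'. b < y' \<Longrightarrow> y' < y \<Longrightarrow> circ (\<phi> y') (\<phi> y) < e"
      by (auto simp: eventually_at_left_field)
    show ?thesis
    proof (intro exI[of _ "y - b"] conjI ballI impI)
      fix y' assume "y' \<in> {0..1}" "\<bar>y' - y\<bar> < y - b" "y' \<le> y"
      then show "circ (\<phi> y') (\<phi> y) < e" using b(2)[of y'] e by (cases "y' = y") auto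
    qed (use b in simp)
  qed
  show ?thesis
  proof (cases "circ_continuous \<phi> y \<or> y = 1")
    case True
    show ?thesis
    proof (rule that[OF rng])
      fix e :: real assume e: "0 < e"
      show "\<exists>\<theta>>0. \<forall>y'\<in>{0..1}. \<bar>y' - y\<bar> < \<theta> \<longrightarrow>
        (y' \<le> y \<longrightarrow> circ (\<phi> y') (\<phi> y) < e) \<and> (y < y' \<longrightarrow> circ (\<phi> y') (\<phi> y) < e)"
      proof (cases "y = 1")
        case True
        then show ?thesis using left[OF e] by force
      next
        case False
        then have "circ_continuous \<phi> y" using True by simp
        from circ_continuousD[OF this e] show ?thesis by metis
      qed
    qed simp
  next
    case False
    then have "y \<in> {0..<1}" using assms(2) by auto
    then obtain c where c: "c \<in> {0..1}" "((\<lambda>y'. circ (\<phi> y') c) \<longlongrightarrow> 0) (at_right y)"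
      using assms(1) unfolding caglad_circ_def by blast
    show ?thesis
    proof (rule that[OF c(1)])
      show "c = \<phi> y" if "circ_continuous \<phi> y" using that False by simp
      fix e :: real assume e: "0 < e"
      have "eventually (\<lambda>y'. circ (\<phi> y') c < e) (at_right y)"
        using e c(2) by (auto dest: order_tendstoD)
      then obtain b where b: "y < b" "\<And>y'. y < y' \<Longrightarrow> y' < b \<Longrightarrow> circ (\<phi> y') c < e"
        by (auto simp: eventually_at_right_field)
      obtain \<theta> where \<theta>: "0 < \<theta>" "\<And>y'. y' \<in> {0..1} \<Longrightarrow> \<bar>y' - y\<bar> < \<theta> \<Longrightarrow> y' \<le> y \<Longrightarrow> circ (\<phi> y') (\<phi> y) < e"
        using left[OF e] by blast
      show "\<exists>\<theta>>0. \<forall>y'\<in>{0..1}. \<bar>y' - y\<bar> < \<theta> \<longrightarrow>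
        (y' \<le> y \<longrightarrow> circ (\<phi> y') (\<phi> y) < e) \<and> (y < y' \<longrightarrow> circ (\<phi> y') c < e)"
      proof (intro exI[of _ "min \<theta> (b - y)"] conjI ballI impI)
        fix y' assume "y' \<in> {0..1}" "\<bar>y' - y\<bar> < min \<theta> (b - y)"
        then show "circ (\<phi> y') (\<phi> y) < e" if "y' \<le> y" using that \<theta>(2) by auto
        show "circ (\<phi> y') c < e" if "y < y'"
          using that b(2)[of y'] \<open>\<bar>y' - y\<bar> < min \<theta> (b - y)\<close> by auto
      qed (use \<theta> b in auto)
    qed
  qed
qed

section \<open>Small climbs, and criteria for convergence in the tree\<close>

lemma climb_right_small:
  assumes "cadlag f" "s \<in> {-1..1}" "0 < e"
  obtains d where "0 < d" "\<And>u v. u \<in> {s..<s + d} \<inter> {-1..1} \<Longrightarrow> v \<in> {s..<s + d} \<inter> {-1..1} \<Longrightarrow> climb f u v \<le> e"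
proof -
  obtain d where d: "0 < d" "\<And>u. u \<in> {s..<s + d} \<inter> {-1..1} \<Longrightarrow> \<bar>f u - f s\<bar> < e / 4"
    using cadlag_two_sided[OF assms(1,2), of "e / 4"] assms(3) by (metis zero_less_divide_iff zero_less_numeral)
  show ?thesis
  proof (rule that[OF d(1)])
    fix u v assume uv: "u \<in> {s..<s + d} \<inter> {-1..1}" "v \<in> {s..<s + d} \<inter> {-1..1}"
    have "climb f u v \<le> 4 * (e / 4)"
    proof (rule climb_le)
      fix w assume "w \<in> {min u v..max u v}"
      then have "w \<in> {s..<s + d} \<inter> {-1..1}" using uv by auto
      from d(2)[OF this] show "\<bar>f w - f s\<bar> \<le> e / 4" by simp
    qed
    then show "climb f u v \<le> e" by simp
  qed
qed

lemma climb_left_small: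
  assumes "cadlag f" "s \<in> {-1..1}" "0 < e"
  obtains d where "0 < d" "\<And>u v. u \<in> {s - d<..<s} \<inter> {-1..1} \<Longrightarrow> v \<in> {s - d<..<s} \<inter> {-1..1} \<Longrightarrow> climb f u v \<le> e"
proof -
  obtain d where d: "0 < d" "\<And>u. u \<in> {s - d<..<s} \<inter> {-1..1} \<Longrightarrow> \<bar>f u - left_lim f s\<bar> < e / 4"
    using cadlag_two_sided[OF assms(1,2), of "e / 4"] assms(3) by (metis zero_less_divide_iff zero_less_numeral)
  show ?thesis
  proof (rule that[OF d(1)])
    fix u v assume uv: "u \<in> {s - d<..<s} \<inter> {-1..1}" "v \<in> {s - d<..<s} \<inter> {-1..1}"
    have "climb f u v \<le> 4 * (e / 4)"
    proof (rule climb_le)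
      fix w assume "w \<in> {min u v..max u v}"
      then have "w \<in> {s - d<..<s} \<inter> {-1..1}" using uv by auto
      from d(2)[OF this] show "\<bar>f w - left_lim f s\<bar> \<le> e / 4" by simp
    qed
    then show "climb f u v \<le> e" by simp
  qed
qed

text \<open>Without a jump both one-sided limits equal \<open>f s\<close>. The case
  \<open>s = -1\<close> is separate because \<open>jump f (-1)\<close> has no meaning there and the
  left side is empty.\<close>

lemma climb_two_sided_small:
  assumes "cadlag f" "s \<in> {-1..1}" "jump f s = 0 \<or> s = -1" "0 < e"
  obtains d where "0 < d" "\<And>u v. u \<in> {s - d<..<s + d} \<inter> {-1..1} \<Longrightarrow> v \<in> {s - d<..<s + d} \<inter> {-1..1} \<Longrightarrow> climb f u v \<le> e"
proof -
  obtain d where d: "0 < d" "\<And>u. u \<in> {s..<s + d} \<inter> {-1..1} \<Longrightarrow> \<bar>f u - f s\<bar> < e / 4"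
      "\<And>u. u \<in> {s - d<..<s} \<inter> {-1..1} \<Longrightarrow> \<bar>f u - left_lim f s\<bar> < e / 4"
    using cadlag_two_sided[OF assms(1,2), of "e / 4"] assms(4) by (metis zero_less_divide_iff zero_less_numeral)
  have close: "\<bar>f w - f s\<bar> < e / 4" if "w \<in> {s - d<..<s + d} \<inter> {-1..1}" for w
  proof (cases "s \<le> w")
    case True
    then show ?thesis using that by (intro d(2)) auto
  next
    case False
    then have "s \<noteq> -1" using that by auto
    then have "left_lim f s = f s" using assms(3) by (simp add: jump_def)
    then show ?thesis using d(3)[of w] False that by auto
  qed
  show ?thesis
  proof (rule that[OF d(1)])
    fix u v assume uv: "u \<in> {s - d<..<s + d} \<inter> {-1..1}" "v \<in> {s - d<..<s + d} \<inter> {-1..1}"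
    have "climb f u v \<le> 4 * (e / 4)"
    proof (rule climb_le)
      fix w assume "w \<in> {min u v..max u v}"
      then have "w \<in> {s - d<..<s + d} \<inter> {-1..1}" using uv by auto
      from close[OF this] show "\<bar>f w - f s\<bar> \<le> e / 4" by simp
    qed
    then show "climb f u v \<le> e" by simp
  qed
qed

lemma climb_tendsto_right:
  assumes "spectrally_positive f" "s \<in> {-1..<1}"
  shows "((\<lambda>u. climb f u s) \<longlongrightarrow> 0) (at_right s)"
proof (rule tendsto_zero_approx)
  have ev: "eventually (\<lambda>u. u \<in> {s..1}) (at_right s)"
    using assms by (auto simp: eventually_at_right_field intro!: exI[of _ 1])
  show "eventually (\<lambda>u. 0 \<le> climb f u s) (at_right s)"
    using ev by eventually_elim (use assms in \<open>auto intro!: climb_nonneg\<close>)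
  fix e :: real assume e: "0 < e"
  obtain d where d: "0 < d" "\<And>u v. u \<in> {s..<s + d} \<inter> {-1..1} \<Longrightarrow> v \<in> {s..<s + d} \<inter> {-1..1} \<Longrightarrow> climb f u v \<le> e"
    using climb_right_small[OF sp_cadlag[OF assms(1)] _ e, of s] assms(2) by auto
  have "eventually (\<lambda>u. u \<in> {s..<s+d}) (at_right s)"
    using d by (auto simp: eventually_at_right_field intro!: exI[of _ "s + d"])
  with ev have "eventually (\<lambda>u. climb f u s \<le> 0 + e) (at_right s)"
    by eventually_elim (use assms d in auto)
  then show "\<exists>b. (b \<longlongrightarrow> 0) (at_right s) \<and> eventually (\<lambda>u. climb f u s \<le> b u + e) (at_right s)"
    by (intro exI[of _ "\<lambda>_. 0"]) auto
qed

lemma tree_dist_tendsto_0I: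
  assumes \<Phi>: "shuffle \<Phi>" and f: "spectrally_positive f" and u: "u \<in> {-1..1}"
    and ev: "eventually (\<lambda>k. \<sigma> k \<in> {-1..1}) F"
    and K: "finite K" "K \<subseteq> {-1<..1}"
    and main: "(b \<longlongrightarrow> 0) F"
      "eventually (\<lambda>k. climb f (\<sigma> k) u + (\<Sum>r\<in>K. loop_excess \<Phi> f r (\<sigma> k) u) \<le> b k) F"
    and rest: "\<And>r. r \<in> {-1<..1} - K \<Longrightarrow> 0 < jump f r \<Longrightarrow>
      ((\<lambda>k. circ (loop_pos \<Phi> f r (\<sigma> k)) (loop_pos \<Phi> f r u)) \<longlongrightarrow> 0) F"
  shows "((\<lambda>k. tree_dist \<Phi> f (\<sigma> k) u) \<longlongrightarrow> 0) F"
proof (rule tendsto_zero_approx)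
  show "eventually (\<lambda>k. 0 \<le> tree_dist \<Phi> f (\<sigma> k) u) F"
    using ev by eventually_elim (use \<Phi> f u in \<open>auto intro: tree_dist_nonneg\<close>)
  fix e :: real assume e: "0 < e"
  obtain J \<rho> where "dominant_loops \<Phi> f e J \<rho>"
    using dominant_loops_exist[OF \<Phi> f e] by blast
  note J = dominant_loopsD[OF this]
  have ff: "close_path \<rho> f f" using f J(3) by (intro close_path_refl) auto
  define B where "B k = b k + (\<Sum>r\<in>J - K. 2 * jump f r * circ (loop_pos \<Phi> f r (\<sigma> k)) (loop_pos \<Phi> f r u))" for k
  have "(B \<longlongrightarrow> 0 + (\<Sum>r\<in>J - K. 2 * jump f r * 0)) F"
    unfolding B_def by (intro tendsto_add tendsto_sum tendsto_mult_left main rest) (use J(2) J(4)[OF ff] in auto)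
  then have B: "(B \<longlongrightarrow> 0) F" by simp
  have "eventually (\<lambda>k. tree_dist \<Phi> f (\<sigma> k) u \<le> B k + e) F"
    using ev main(2)
  proof eventually_elim
    case (elim k)
    have "\<bar>tree_dist \<Phi> f (\<sigma> k) u - climb f (\<sigma> k) u - (\<Sum>r\<in>K \<union> (J - K). loop_excess \<Phi> f r (\<sigma> k) u)\<bar> \<le> e"
      using J(1,2) K elim(1) u by (intro J(5)[OF ff]) auto
    moreover have "(\<Sum>r\<in>K \<union> (J - K). loop_excess \<Phi> f r (\<sigma> k) u)
        = (\<Sum>r\<in>K. loop_excess \<Phi> f r (\<sigma> k) u) + (\<Sum>r\<in>J - K. loop_excess \<Phi> f r (\<sigma> k) u)"
      using J(1) K(1) by (intro sum.union_disjoint) auto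
    moreover have "(\<Sum>r\<in>J - K. loop_excess \<Phi> f r (\<sigma> k) u)
        \<le> (\<Sum>r\<in>J - K. 2 * jump f r * circ (loop_pos \<Phi> f r (\<sigma> k)) (loop_pos \<Phi> f r u))"
      using J(4)[OF ff] by (intro sum_mono) (simp add: loop_excess_eq)
    ultimately show ?case using elim(2) unfolding B_def by linarith
  qed
  with B show "\<exists>b. (b \<longlongrightarrow> 0) F \<and> eventually (\<lambda>k. tree_dist \<Phi> f (\<sigma> k) u \<le> b k + e) F"
    by blast
qed

text \<open>If the coordinates approach from below, left-continuity of the shuffle suffices;
  otherwise continuity at the limit position is required.\<close>

lemma circ_loop_pos_tendsto:
  assumes \<Phi>: "shuffle \<Phi>" and f: "spectrally_positive f" and r: "r \<in> {-1<..1}" "0 < jump f r" and u: "u \<in> {-1..1}"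
    and ev: "eventually (\<lambda>k. \<sigma> k \<in> {-1..1}) F"
    and x: "((\<lambda>k. xval f r (\<sigma> k)) \<longlongrightarrow> xval f r u) F"
    and side: "circ_continuous (\<Phi> (jump f r)) (xval f r u / jump f r)
      \<or> eventually (\<lambda>k. xval f r (\<sigma> k) \<le> xval f r u) F"
  shows "((\<lambda>k. circ (loop_pos \<Phi> f r (\<sigma> k)) (loop_pos \<Phi> f r u)) \<longlongrightarrow> 0) F"
proof (rule tendsto_zero_approx)
  show "eventually (\<lambda>k. 0 \<le> circ (loop_pos \<Phi> f r (\<sigma> k)) (loop_pos \<Phi> f r u)) F"
    using ev by eventually_elim (intro circ_nonneg loop_pos_range \<Phi> f r u)
  fix e :: real assume e: "0 < e"
  let ?\<phi> = "\<Phi> (jump f r)" and ?y = "xval f r u / jump f r"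
  have y: "?y \<in> {0..1}" by (intro xval_ratio f r u)
  have "\<exists>\<theta>>0. \<forall>y'\<in>{0..1}. \<bar>y' - ?y\<bar> < \<theta> \<longrightarrow> (y' \<le> ?y \<or> circ_continuous ?\<phi> ?y) \<longrightarrow> circ (?\<phi> y') (?\<phi> ?y) < e"
    using caglad_circ_sides[OF shuffle_caglad[OF \<Phi> r(2)] y] e by (metis linorder_not_less)
  then obtain \<theta> where \<theta>: "0 < \<theta>" "\<And>y'. y' \<in> {0..1} \<Longrightarrow> \<bar>y' - ?y\<bar> < \<theta> \<Longrightarrow> y' \<le> ?y \<or> circ_continuous ?\<phi> ?y
      \<Longrightarrow> circ (?\<phi> y') (?\<phi> ?y) < e" by blast
  have "((\<lambda>k. xval f r (\<sigma> k) / jump f r) \<longlongrightarrow> ?y) F"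
    using r by (intro tendsto_divide x tendsto_const) auto
  then have "eventually (\<lambda>k. dist (xval f r (\<sigma> k) / jump f r) ?y < \<theta>) F" using \<theta>(1) by (rule tendstoD)
  moreover have "eventually (\<lambda>k. xval f r (\<sigma> k) \<le> xval f r u \<or> circ_continuous ?\<phi> ?y) F"
    using side by (auto elim: eventually_mono)
  ultimately have "eventually (\<lambda>k. circ (loop_pos \<Phi> f r (\<sigma> k)) (loop_pos \<Phi> f r u) \<le> 0 + e) F"
    using ev
  proof eventually_elim
    case (elim k)
    have "circ (?\<phi> (xval f r (\<sigma> k) / jump f r)) (?\<phi> ?y) < e"
    proof (rule \<theta>(2))
      show "xval f r (\<sigma> k) / jump f r \<in> {0..1}" by (intro xval_ratio f r elim(3))
      show "xval f r (\<sigma> k) / jump f r \<le> ?y \<or> circ_continuous ?\<phi> ?y"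
        using elim(2) r(2) by (auto simp: divide_right_mono)
    qed (use elim(1) in \<open>simp add: dist_real_def\<close>)
    then show ?case by (simp add: loop_pos_def)
  qed
  then show "\<exists>b. (b \<longlongrightarrow> 0) F \<and> eventually (\<lambda>k. circ (loop_pos \<Phi> f r (\<sigma> k)) (loop_pos \<Phi> f r u) \<le> b k + e) F"
    by (intro exI[of _ "\<lambda>_. 0"]) auto
qed

lemma xval_tendsto_of_climb:
  assumes "spectrally_positive f" "r \<in> {-1<..1}" "u \<in> {-1..1}" "eventually (\<lambda>k. \<sigma> k \<in> {-1..1}) F"
    "((\<lambda>k. climb f (\<sigma> k) u) \<longlongrightarrow> 0) F"
  shows "((\<lambda>k. xval f r (\<sigma> k)) \<longlongrightarrow> xval f r u) F"
proof (rule Lim_transform_bound[of _ "\<lambda>k. climb f (\<sigma> k) u", THEN Lim_null[THEN iffD2]])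
  show "eventually (\<lambda>k. norm (xval f r (\<sigma> k) - xval f r u) \<le> norm (climb f (\<sigma> k) u)) F"
    using assms(4)
  proof eventually_elim
    case (elim k)
    then show ?case
      using xval_diff_le_climb[OF assms(1,2) elim assms(3)] by simp
  qed
qed fact

text \<open>A loop open at \<open>s\<close> has nonincreasing coordinate afterwards, so its position
  is approached from below, where shuffles are continuous. A loop opened after \<open>s\<close> is
  not yet open at times close enough to \<open>s\<close>.\<close>

lemma tree_dist_right_continuous:
  assumes \<Phi>: "shuffle \<Phi>" and f: "spectrally_positive f" and s: "s \<in> {-1..<1}"
  shows "((\<lambda>u. tree_dist \<Phi> f u s) \<longlongrightarrow> 0) (at_right s)"
proof (rule tree_dist_tendsto_0I[OF \<Phi> f])
  show s1: "s \<in> {-1..1}" using s by auto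
  have ev: "eventually (\<lambda>u. u \<in> {s<..1}) (at_right s)"
    using s by (auto simp: eventually_at_right_field intro!: exI[of _ 1])
  then show ev1: "eventually (\<lambda>u. u \<in> {-1..1}) (at_right s)"
    by eventually_elim (use s in auto)
  have climb0: "((\<lambda>u. climb f u s) \<longlongrightarrow> 0) (at_right s)" by (rule climb_tendsto_right[OF f s])
  then show "((\<lambda>u. climb f u s) \<longlongrightarrow> 0) (at_right s)" .
  show "eventually (\<lambda>u. climb f u s + (\<Sum>r\<in>{}. loop_excess \<Phi> f r u s) \<le> climb f u s) (at_right s)" by simp
  fix r :: real assume r: "r \<in> {-1<..1} - {}" "0 < jump f r"
  have "eventually (\<lambda>u. xval f r u \<le> xval f r s) (at_right s)"
  proof (cases "r \<le> s")
    case True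
    show ?thesis using ev by eventually_elim (use True r f in \<open>auto intro!: xval_antimono\<close>)
  next
    case False
    then have "eventually (\<lambda>u. u < r) (at_right s)"
      by (auto simp: eventually_at_right_field intro!: exI[of _ r])
    then show ?thesis by eventually_elim (simp add: xval_less)
  qed
  moreover have "r \<in> {-1<..1}" using r by simp
  ultimately show "((\<lambda>u. circ (loop_pos \<Phi> f r u) (loop_pos \<Phi> f r s)) \<longlongrightarrow> 0) (at_right s)"
    by (intro circ_loop_pos_tendsto[OF \<Phi> f _ r(2) s1 ev1] xval_tendsto_of_climb[OF f _ s1 ev1 climb0]) auto
qed auto

section \<open>First passages and left limits of the projection\<close>

text \<open>Without negative jumps the path cannot leap over a level on its way down.
  Right-continuity gives \<open>f u \<le> v\<close> at the infimum, and the left limit there gives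
  the reverse inequality.\<close>

lemma first_passage:
  assumes f: "spectrally_positive f" and r: "r \<in> {-1<..1}" and v: "left_lim f r \<le> v" "v \<le> f r" "f 1 \<le> v"
  obtains u where "u \<in> {r..1}" "f u = v" "\<And>w. w \<in> {r..u} \<Longrightarrow> v \<le> f w"
proof -
  define S where "S = {u \<in> {r..1}. f u \<le> v}"
  define u where "u = Inf S"
  have S1: "1 \<in> S" using r v by (auto simp: S_def)
  have bdd: "bdd_below S" by (auto simp: S_def bdd_below_def)
  have u: "u \<in> {r..1}"
    using S1 bdd by (auto simp: u_def S_def intro!: cInf_greatest cInf_lower)
  have above: "v < f w" if "w \<in> {r..<u}" for w
  proof (rule ccontr)
    assume "\<not> v < f w"
    then have "w \<in> S" using that u by (auto simp: S_def)
    then have "u \<le> w" unfolding u_def using bdd by (intro cInf_lower)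
    then show False using that by simp
  qed
  have fu: "f u \<le> v"
  proof (rule ccontr)
    assume "\<not> f u \<le> v"
    then have lt: "v < f u" by simp
    have u1: "u < 1"
    proof (rule ccontr)
      assume "\<not> u < 1"
      then have "u = 1" using u by auto
      then show False using lt v(3) by simp
    qed
    then have "u \<in> {-1..<1}" using u r by auto
    then obtain d where d: "0 < d" "\<And>w. w \<in> {u..<u + d} \<Longrightarrow> \<bar>f w - f u\<bar> < f u - v"
      using cadlag_right_close[OF sp_cadlag[OF f], of u "f u - v"] lt by (metis diff_gt_0_iff_gt)
    have "Inf S < u + d" using d u_def by simp
    then obtain w where w: "w \<in> S" "w < u + d" using cInf_lessD[of S] S1 by blast
    have "u \<le> w" unfolding u_def using w bdd by (intro cInf_lower)
    then have "\<bar>f w - f u\<bar> < f u - v" using w by (intro d) auto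
    then show False using w(1) by (auto simp: S_def)
  qed
  have "v \<le> f u"
  proof (cases "u = r")
    case False
    then have ru: "r < u" using u by simp
    have u': "u \<in> {-1<..1}" using u r by auto
    have "v \<le> left_lim f u"
      using above by (intro left_lim_ge[OF sp_cadlag[OF f] u' ru]) (auto intro: less_imp_le)
    then show ?thesis using sp_left_lim_le[OF f u'] by simp
  qed (use v in simp)
  with fu have eq: "f u = v" by simp
  show ?thesis
  proof (rule that[OF u eq])
    fix w assume "w \<in> {r..u}"
    then show "v \<le> f w" using above[of w] eq by (cases "w = u") auto
  qed
qed

text \<open>A first passage visits the prescribed point of the loop opened at \<open>r\<close>, and
  at that moment no later loop is open, because the path has been at least at level \<open>v\<close>
  since \<open>r\<close>.\<close>

lemma first_passage_xval:
  assumes f: "spectrally_positive f" and r: "r \<in> {-1<..1}" and v: "left_lim f r \<le> v"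
    and u: "u \<in> {r..1}" "f u = v" "\<And>w. w \<in> {r..u} \<Longrightarrow> v \<le> f w"
  shows "xval f r u = v - left_lim f r" "\<And>r'. r < r' \<Longrightarrow> r' \<le> 1 \<Longrightarrow> xval f r' u = 0"
proof -
  have u1: "u \<in> {-1..1}" and r1: "r \<in> {-1..1}" using u r by auto
  have "valley f r u = v"
  proof (rule antisym)
    show "valley f r u \<le> v" using u by (metis valley_le[OF f r1 u1] atLeastAtMost_iff max.cobounded2 min.cobounded2)
    show "v \<le> valley f r u" using u by (intro valley_ge) auto
  qed
  then show "xval f r u = v - left_lim f r" using u v by (simp add: xval_eq)
  fix r' assume r': "r < r'" "r' \<le> 1"
  then have r'': "r' \<in> {-1<..1}" using r by auto
  show "xval f r' u = 0"
  proof (cases "r' \<le> u")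
    case True
    have "v \<le> left_lim f r'"
      using u True by (intro left_lim_ge[OF sp_cadlag[OF f] r'' r'(1)]) auto
    then show ?thesis using xval_le_height[OF f r'' u1] u(2) xval_nonneg[of f r' u] by linarith
  qed (simp add: xval_less)
qed

text \<open>If no loop is being explored just before \<open>s\<close>, then the left limit of the projection at \<open>s\<close> is the
  point that closes the loop opened at \<open>s\<close> (which is \<open>s\<close> itself if \<open>f\<close> does not jump).\<close>

lemma left_limit_point_plain:
  assumes \<Phi>: "shuffle \<Phi>" and f: "spectrally_positive f" "f 1 = 0" and s: "s \<in> {-1<..1}"
    and \<sigma>: "\<And>k. \<sigma> k \<in> {-1..<s}" "\<sigma> \<longlonglongrightarrow> s"
    and plain: "\<And>r. r \<in> {-1<..<s} \<Longrightarrow> left_lim f r < left_lim f s \<Longrightarrow> \<exists>w\<in>{r..<s}. f w < left_lim f s"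
  obtains u where "u \<in> {s..1}" "(\<lambda>k. tree_dist \<Phi> f (\<sigma> k) u) \<longlonglongrightarrow> 0"
proof -
  let ?L = "left_lim f s"
  have s1: "s \<in> {-1..1}" using s by auto
  \<comment> \<open>The first passage at the level of the left limit is the time at which the loop
    opened at \<open>s\<close> closes.\<close>
  obtain u where u: "u \<in> {s..1}" "f u = ?L" "\<And>w. w \<in> {s..u} \<Longrightarrow> ?L \<le> f w"
    using first_passage[OF f(1) s, of ?L] sp_left_lim_le[OF f(1) s] sp_left_lim_nonneg[OF f(1) s] f(2) by auto
  note ux = first_passage_xval[OF f(1) s order.refl u]
  have u1: "u \<in> {-1..1}" using u s by auto
  have \<sigma>1: "\<sigma> k \<in> {-1..1}" for k using \<sigma>(1)[of k] s by auto
  have near: "eventually (\<lambda>k. \<forall>w\<in>{\<sigma> k..<s}. \<bar>f w - ?L\<bar> < e) sequentially" if pos: "0 < e" for e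
  proof -
    obtain d where d: "0 < d" "d \<le> s + 1" "\<And>w. w \<in> {s - d<..<s} \<Longrightarrow> \<bar>f w - ?L\<bar> < e"
      using cadlag_left_close[OF sp_cadlag[OF f(1)] s pos] by metis
    have "eventually (\<lambda>k. s - d < \<sigma> k) sequentially"
      using \<sigma>(2) d(1) by (intro order_tendstoD) auto
    then show ?thesis
    proof eventually_elim
      case (elim k)
      then show ?case using d(3) by auto
    qed
  qed
  have climb0: "(\<lambda>k. climb f (\<sigma> k) u) \<longlonglongrightarrow> 0"
  proof (rule tendsto_zero_approx)
    show "eventually (\<lambda>k. 0 \<le> climb f (\<sigma> k) u) sequentially"
      by (intro always_eventually allI climb_nonneg f \<sigma>1 u1)
    fix e :: real assume e: "0 < e"
    then have "0 < e / 3" by simp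
    from near[OF this] have "eventually (\<lambda>k. climb f (\<sigma> k) u \<le> 0 + e) sequentially"
    proof eventually_elim
      case (elim k)
      have \<sigma>s: "\<sigma> k < s" using \<sigma>(1)[of k] by simp
      have "?L - e / 3 \<le> valley f (\<sigma> k) u"
      proof (rule valley_ge)
        fix w assume w: "w \<in> {min (\<sigma> k) u..max (\<sigma> k) u}"
        then have w': "w \<in> {\<sigma> k..u}" using \<sigma>s u by auto
        show "?L - e / 3 \<le> f w"
        proof (cases "w < s")
          case True
          then have "\<bar>f w - ?L\<bar> < e / 3" using elim w' by auto
          then show ?thesis by linarith
        next
          case False
          then have "?L \<le> f w" using w' by (intro u(3)) auto
          then show ?thesis using e by linarith
        qed
      qed
      moreover have "\<bar>f (\<sigma> k) - ?L\<bar> < e / 3" using elim \<sigma>s by auto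
      ultimately show ?case unfolding climb_def u(2) by linarith
    qed
    then show "\<exists>b. b \<longlonglongrightarrow> 0 \<and> eventually (\<lambda>k. climb f (\<sigma> k) u \<le> b k + e) sequentially"
      by (intro exI[of _ "\<lambda>_. 0"]) auto
  qed
  have "(\<lambda>k. tree_dist \<Phi> f (\<sigma> k) u) \<longlonglongrightarrow> 0"
  proof (rule tree_dist_tendsto_0I[OF \<Phi> f(1) u1])
    show ev: "eventually (\<lambda>k. \<sigma> k \<in> {-1..1}) sequentially" using \<sigma>1 by simp
    show "(\<lambda>k. climb f (\<sigma> k) u) \<longlonglongrightarrow> 0" by fact
    show "eventually (\<lambda>k. climb f (\<sigma> k) u + (\<Sum>r\<in>{}. loop_excess \<Phi> f r (\<sigma> k) u) \<le> climb f (\<sigma> k) u) sequentially"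
      by simp
    fix r :: real assume "r \<in> {-1<..1} - {}" and J: "0 < jump f r"
    then have r: "r \<in> {-1<..1}" by simp
    have x: "(\<lambda>k. xval f r (\<sigma> k)) \<longlonglongrightarrow> xval f r u"
      by (rule xval_tendsto_of_climb[OF f(1) r u1 ev climb0])
    \<comment> \<open>A loop with positive coordinate at \<open>u\<close> was opened before
      \<open>s\<close>. By \<open>plain\<close> the path then dipped below the left limit before
      \<open>s\<close>; the minimum reached in this dip decides the coordinate, which no longer
      changes between \<open>\<sigma> k\<close> and \<open>u\<close>.\<close>
    have "circ_continuous (\<Phi> (jump f r)) (xval f r u / jump f r)
        \<or> eventually (\<lambda>k. xval f r (\<sigma> k) \<le> xval f r u) sequentially"
    proof (cases "xval f r u = 0")
      case True
      then show ?thesis using circ_continuous_0[OF \<Phi> J] by simp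
    next
      case False
      have rs: "r < s"
      proof (rule ccontr)
        assume "\<not> r < s"
        then show False using ux False r by (cases "r = s") auto
      qed
      have "left_lim f r + xval f r u \<le> f u"
        using False by (intro xval_top_le[OF f(1) r u1]) (simp add: less_le)
      then have lt: "left_lim f r < ?L" using False u(2) xval_nonneg[of f r u] by linarith
      then obtain w where w: "w \<in> {r..<s}" "f w < ?L" using plain[of r] r rs by auto
      have "eventually (\<lambda>k. w < \<sigma> k) sequentially"
        using \<sigma>(2) w by (intro order_tendstoD) auto
      moreover have "eventually (\<lambda>k. \<forall>w'\<in>{\<sigma> k..<s}. \<bar>f w' - ?L\<bar> < ?L - f w) sequentially"
        using w by (intro near) auto
      ultimately have "eventually (\<lambda>k. xval f r (\<sigma> k) \<le> xval f r u) sequentially"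
      proof eventually_elim
        case (elim k)
        have \<sigma>s: "\<sigma> k < s" using \<sigma>(1)[of k] by simp
        have le: "r \<le> \<sigma> k" "\<sigma> k \<le> u" "u \<le> 1" using elim(1) w \<sigma>s u by auto
        have "f w \<le> valley f (\<sigma> k) u"
        proof (rule valley_ge)
          fix w' assume w'0: "w' \<in> {min (\<sigma> k) u..max (\<sigma> k) u}"
          then have w': "w' \<in> {\<sigma> k..u}" using le by auto
          show "f w \<le> f w'"
          proof (cases "w' < s")
            case True
            then have "\<bar>f w' - ?L\<bar> < ?L - f w" using elim w' by auto
            then show ?thesis by linarith
          next
            case False
            then have "?L \<le> f w'" using w' by (intro u(3)) auto
            then show ?thesis using w by linarith
          qed
        qed
        moreover have "valley f r (\<sigma> k) \<le> f w"
          using le elim(1) w r \<sigma>1[of k] by (intro valley_le f) auto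
        ultimately have "xval f r (\<sigma> k) \<le> max (valley f (\<sigma> k) u - left_lim f r) 0"
          using le by (auto simp: xval_eq)
        then show ?case using xval_step[OF f(1) r le] by simp
      qed
      then show ?thesis by simp
    qed
    then show "(\<lambda>k. circ (loop_pos \<Phi> f r (\<sigma> k)) (loop_pos \<Phi> f r u)) \<longlonglongrightarrow> 0"
      by (rule circ_loop_pos_tendsto[OF \<Phi> f(1) r J u1 ev x])
  qed auto
  then show ?thesis using that u by blast
qed

text \<open>If the loop opened at \<open>r\<close> is being explored just before \<open>s\<close>, the left limit lies on that loop,
  and surjectivity provides a time at which this point is visited.\<close>

lemma left_limit_point_loop:
  assumes \<Phi>: "shuffle \<Phi>" and f: "spectrally_positive f" "f 1 = 0" and s: "s \<in> {-1<..1}"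
    and \<sigma>: "\<And>k. \<sigma> k \<in> {-1..<s}" "\<sigma> \<longlonglongrightarrow> s" "incseq \<sigma>"
    and r: "r \<in> {-1<..<s}" "left_lim f r < left_lim f s" "\<And>w. w \<in> {r..<s} \<Longrightarrow> left_lim f s \<le> f w"
  obtains u where "u \<in> {r..1}" "(\<lambda>k. tree_dist \<Phi> f (\<sigma> k) u) \<longlonglongrightarrow> 0"
proof -
  let ?L = "left_lim f s" and ?l = "left_lim f r" and ?\<Delta> = "jump f r" and ?\<phi> = "\<Phi> (jump f r)"
  have s1: "s \<in> {-1..1}" using s by auto
  have r1: "r \<in> {-1<..1}" "r \<in> {-1..1}" using r s by auto
  have \<sigma>1: "\<sigma> k \<in> {-1..1}" for k using \<sigma>(1)[of k] s by auto
  have \<sigma>s: "\<sigma> k < s" for k using \<sigma>(1)[of k] by simp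
  have fr: "?L \<le> f r" using r by auto
  then have J: "0 < ?\<Delta>" using r(2) by (simp add: jump_def)
  define y where "y = (?L - ?l) / ?\<Delta>"
  have y: "y \<in> {0..1}" "0 < y" using r fr J by (auto simp: y_def jump_def field_simps)
  define Y where "Y k = xval f r (\<sigma> k) / ?\<Delta>" for k
  have Y01: "Y k \<in> {0..1}" for k unfolding Y_def by (intro xval_ratio f r1 \<sigma>1 J)
  have evr: "eventually (\<lambda>k. r \<le> \<sigma> k) sequentially"
    using order_tendstoD(1)[OF \<sigma>(2), of r] r by (auto elim: eventually_mono)
  have val: "?L \<le> valley f r (\<sigma> k)" "valley f r (\<sigma> k) \<le> f (\<sigma> k)" "xval f r (\<sigma> k) = valley f r (\<sigma> k) - ?l"
    if "r \<le> \<sigma> k" for k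
  proof -
    show L: "?L \<le> valley f r (\<sigma> k)"
      using that \<sigma>s[of k] by (intro valley_ge r(3)) auto
    show "valley f r (\<sigma> k) \<le> f (\<sigma> k)" using that by (intro valley_le f r1 \<sigma>1) auto
    show "xval f r (\<sigma> k) = valley f r (\<sigma> k) - ?l" using that L r(2) by (simp add: xval_eq)
  qed
  have f\<sigma>: "(\<lambda>k. f (\<sigma> k)) \<longlonglongrightarrow> ?L"
  proof (rule filterlim_compose[OF cadlag_left_lim[OF sp_cadlag[OF f(1)] s]])
    show "filterlim \<sigma> (at_left s) sequentially"
      using \<sigma>(2) \<sigma>s by (auto simp: filterlim_at intro!: always_eventually)
  qed
  have vl: "(\<lambda>k. valley f r (\<sigma> k)) \<longlonglongrightarrow> ?L"
  proof (rule tendsto_sandwich[OF _ _ tendsto_const f\<sigma>])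
    show "eventually (\<lambda>k. ?L \<le> valley f r (\<sigma> k)) sequentially"
      using evr by eventually_elim (rule val)
    show "eventually (\<lambda>k. valley f r (\<sigma> k) \<le> f (\<sigma> k)) sequentially"
      using evr by eventually_elim (rule val)
  qed
  have Yy: "Y \<longlonglongrightarrow> y"
  proof (rule Lim_transform_eventually)
    show "(\<lambda>k. (valley f r (\<sigma> k) - ?l) / ?\<Delta>) \<longlonglongrightarrow> y"
      unfolding y_def using J by (intro tendsto_intros vl) auto
    show "eventually (\<lambda>k. (valley f r (\<sigma> k) - ?l) / ?\<Delta> = Y k) sequentially"
      using evr by eventually_elim (simp add: Y_def val)
  qed
  have Yge: "y \<le> Y k" if "r \<le> \<sigma> k" for k
    unfolding y_def Y_def using val[OF that] J by (intro divide_right_mono) auto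
  \<comment> \<open>Either the limit position \<open>y\<close> is reached and then kept by
    monotonicity, or it is approached strictly from above and \<open>c\<close> is the right limit of
    the shuffle at \<open>y\<close>.\<close>
  obtain c where c: "c \<in> {0..1}" "(\<lambda>k. circ (?\<phi> (Y k)) c) \<longlonglongrightarrow> 0"
  proof (cases "\<exists>k0. r \<le> \<sigma> k0 \<and> Y k0 = y")
    case True
    then obtain k0 where k0: "r \<le> \<sigma> k0" "Y k0 = y" by blast
    have "Y k = y" if "k0 \<le> k" for k
    proof (rule antisym)
      have le: "\<sigma> k0 \<le> \<sigma> k" using \<sigma>(3) that by (simp add: incseqD)
      then have "xval f r (\<sigma> k) \<le> xval f r (\<sigma> k0)"
        using k0 \<sigma>1[of k] by (intro xval_antimono f r1) auto
      then have "Y k \<le> Y k0" unfolding Y_def using J by (intro divide_right_mono) auto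
      then show "Y k \<le> y" using k0 by simp
      show "y \<le> Y k" using k0 le by (intro Yge) auto
    qed
    then have "eventually (\<lambda>k. circ (?\<phi> (Y k)) (?\<phi> y) = 0) sequentially"
      by (intro eventually_sequentiallyI[of k0]) simp
    then have "(\<lambda>k. circ (?\<phi> (Y k)) (?\<phi> y)) \<longlonglongrightarrow> 0" by (rule tendsto_eventually)
    then show ?thesis using that[of "?\<phi> y"] shuffle_range[OF \<Phi> J y(1)] by simp
  next
    case False
    then have Ygt: "y < Y k" if "r \<le> \<sigma> k" for k using Yge[OF that] that by (metis less_le)
    have "\<exists>k. r \<le> \<sigma> k" using evr by (auto simp: eventually_sequentially)
    then have "y < 1" using Ygt Y01 by (meson atLeastAtMost_iff order_less_le_trans)
    then have "y \<in> {0..<1}" using y by auto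
    then obtain c where c: "c \<in> {0..1}" "((\<lambda>y'. circ (?\<phi> y') c) \<longlongrightarrow> 0) (at_right y)"
      using shuffle_caglad[OF \<Phi> J] unfolding caglad_circ_def by blast
    have "filterlim Y (at_right y) sequentially"
      unfolding filterlim_at
    proof
      show "eventually (\<lambda>k. Y k \<in> {y<..} \<and> Y k \<noteq> y) sequentially"
        using evr by eventually_elim (use Ygt in fastforce)
    qed (rule Yy)
    from filterlim_compose[OF c(2) this] show ?thesis using that c(1) by blast
  qed
  \<comment> \<open>The right limit \<open>c\<close> need not be the image of \<open>y\<close>;
    surjectivity provides a position with this image.\<close>
  obtain z where z: "z \<in> {0..1}" "circ (?\<phi> z) c = 0"
    using \<Phi> J c(1) unfolding shuffle_def surj_circ_def by blast
  have Yz: "(\<lambda>k. circ (?\<phi> (Y k)) (?\<phi> z)) \<longlonglongrightarrow> 0"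
  proof (rule tendsto_sandwich[OF _ _ tendsto_const c(2)])
    have rng: "?\<phi> (Y k) \<in> {0..1}" "?\<phi> z \<in> {0..1}" for k
      using shuffle_range[OF \<Phi> J] Y01 z by blast+
    show "eventually (\<lambda>k. 0 \<le> circ (?\<phi> (Y k)) (?\<phi> z)) sequentially"
      by (intro always_eventually allI circ_nonneg rng)
    have "circ (?\<phi> (Y k)) (?\<phi> z) \<le> circ (?\<phi> (Y k)) c" for k
      using circ_triangle[OF rng(1) c(1) rng(2), of k] z(2) by (simp add: circ_commute)
    then show "eventually (\<lambda>k. circ (?\<phi> (Y k)) (?\<phi> z) \<le> circ (?\<phi> (Y k)) c) sequentially" by simp
  qed
  \<comment> \<open>The level that corresponds to position \<open>z\<close> on the loop opened at
    \<open>r\<close>; its first passage is the required time.\<close>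
  define v where "v = ?l + z * ?\<Delta>"
  have v: "?l \<le> v" using z J by (simp add: v_def)
  have "z * ?\<Delta> \<le> 1 * ?\<Delta>" using z J by (intro mult_right_mono) auto
  then have "v \<le> f r" by (simp add: v_def jump_def)
  moreover have "f 1 \<le> v" using v f(2) sp_left_lim_nonneg[OF f(1) r1(1)] by simp
  ultimately obtain u where u: "u \<in> {r..1}" "f u = v" "\<And>w. w \<in> {r..u} \<Longrightarrow> v \<le> f w"
    using first_passage[OF f(1) r1(1) v] by metis
  note ux = first_passage_xval[OF f(1) r1(1) v u]
  have u1: "u \<in> {-1..1}" using u r1 by auto
  have xu: "xval f r u = v - ?l" "xval f r u / ?\<Delta> = z" using ux(1) J by (auto simp: v_def)
  have "(\<lambda>k. tree_dist \<Phi> f (\<sigma> k) u) \<longlonglongrightarrow> 0"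
  proof (rule tree_dist_tendsto_0I[OF \<Phi> f(1) u1])
    show ev: "eventually (\<lambda>k. \<sigma> k \<in> {-1..1}) sequentially" using \<sigma>1 by simp
    show "finite {r}" "{r} \<subseteq> {-1<..1}" using r1 by auto
    \<comment> \<open>The climb itself need not tend to 0, since \<open>\<sigma> k\<close> and
      \<open>u\<close> may sit at different levels of the loop. The level difference is the
      difference of the two coordinates, which the excess of this loop subtracts.\<close>
    let ?b = "\<lambda>k. f (\<sigma> k) - ?L + 2 * ?\<Delta> * circ (?\<phi> (Y k)) (?\<phi> z)"
    have "?b \<longlonglongrightarrow> ?L - ?L + 2 * ?\<Delta> * 0"
      by (intro tendsto_intros f\<sigma> Yz)
    then show "?b \<longlonglongrightarrow> 0" by simp
    show "eventually (\<lambda>k. climb f (\<sigma> k) u + (\<Sum>r\<in>{r}. loop_excess \<Phi> f r (\<sigma> k) u) \<le> ?b k) sequentially"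
      using evr
    proof eventually_elim
      case (elim k)
      have "min (valley f r (\<sigma> k)) v \<le> valley f (\<sigma> k) u"
      proof (rule valley_ge)
        fix w assume w: "w \<in> {min (\<sigma> k) u..max (\<sigma> k) u}"
        then have "r \<le> w" using elim u by auto
        show "min (valley f r (\<sigma> k)) v \<le> f w"
        proof (cases "w \<le> u")
          case True
          then have "v \<le> f w" using \<open>r \<le> w\<close> by (intro u(3)) auto
          then show ?thesis by simp
        next
          case False
          then have "w \<le> \<sigma> k" using w by auto
          then have "valley f r (\<sigma> k) \<le> f w" using \<open>r \<le> w\<close> elim by (intro valley_le f r1 \<sigma>1) auto
          then show ?thesis by simp
        qed
      qed
      then have "climb f (\<sigma> k) u \<le> (f (\<sigma> k) - valley f r (\<sigma> k)) + \<bar>xval f r (\<sigma> k) - xval f r u\<bar>"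
        unfolding climb_def u(2) val(3)[OF elim] xu(1) by (auto simp: min_def split: if_splits)
      moreover have "loop_excess \<Phi> f r (\<sigma> k) u = 2 * ?\<Delta> * circ (?\<phi> (Y k)) (?\<phi> z) - \<bar>xval f r (\<sigma> k) - xval f r u\<bar>"
        unfolding loop_excess_eq[OF J] loop_pos_def xu(2) Y_def ..
      ultimately show ?case using val(1)[OF elim] by simp
    qed
    fix r' :: real assume "r' \<in> {-1<..1} - {r}" and J': "0 < jump f r'"
    then have r': "r' \<in> {-1<..1}" "r' \<noteq> r" by auto
    show "(\<lambda>k. circ (loop_pos \<Phi> f r' (\<sigma> k)) (loop_pos \<Phi> f r' u)) \<longlonglongrightarrow> 0"
    \<comment> \<open>Loops opened before \<open>r\<close> keep the coordinate they have at
      \<open>r\<close>. Loops opened after \<open>r\<close> have coordinate 0 at \<open>u\<close>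
      and, at \<open>\<sigma> k\<close>, at most the height above the left limit, which tends to
      0.\<close>
    proof (cases "r' < r")
      case True
      have cst: "xval f r' t = xval f r' r" if t: "r \<le> t" "t \<le> 1" "?l \<le> valley f r t" for t
      proof -
        have "valley f r' r \<le> ?l" using r' True r1 by (intro left_lim_ge_valley f) auto
        then have "xval f r' r \<le> max (valley f r t - left_lim f r') 0"
          using True t by (simp add: xval_eq)
        then show ?thesis using xval_step[OF f(1) r'(1) _ t(1,2)] True by simp
      qed
      have "?l \<le> valley f r u" using u v by (intro valley_ge) (auto intro: order.trans)
      then have xu': "xval f r' u = xval f r' r" using u by (intro cst) auto
      have "eventually (\<lambda>k. circ (loop_pos \<Phi> f r' (\<sigma> k)) (loop_pos \<Phi> f r' u) = 0) sequentially"
        using evr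
      proof eventually_elim
        case (elim k)
        have "xval f r' (\<sigma> k) = xval f r' r"
          using elim val(1)[OF elim] r \<sigma>1[of k] by (intro cst) auto
        then show ?case by (simp add: loop_pos_def xu')
      qed
      then show ?thesis by (rule tendsto_eventually)
    next
      case False
      then have rr': "r < r'" using r' by simp
      have xu': "xval f r' u = 0" using rr' r' by (intro ux(2)) auto
      have "(\<lambda>k. xval f r' (\<sigma> k)) \<longlonglongrightarrow> 0"
      proof (rule tendsto_sandwich[OF _ _ tendsto_const])
        show "eventually (\<lambda>k. 0 \<le> xval f r' (\<sigma> k)) sequentially" by simp
        show "(\<lambda>k. f (\<sigma> k) - ?L) \<longlonglongrightarrow> 0" using f\<sigma> by (simp add: LIM_zero)
        show "eventually (\<lambda>k. xval f r' (\<sigma> k) \<le> f (\<sigma> k) - ?L) sequentially"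
          using evr
        proof eventually_elim
          case (elim k)
          have L: "?L \<le> f (\<sigma> k)" using val(1,2)[OF elim] by simp
          show ?case
          proof (cases "r' \<le> \<sigma> k")
            case True
            then have "?L \<le> left_lim f r'"
              using r(3) \<sigma>s[of k] by (intro left_lim_ge[OF sp_cadlag[OF f(1)] r'(1) rr']) auto
            then show ?thesis using xval_le_height[OF f(1) r'(1) \<sigma>1, of k] L by linarith
          next
            case False
            then show ?thesis using L by (simp add: xval_less)
          qed
        qed
      qed
      then have x: "(\<lambda>k. xval f r' (\<sigma> k)) \<longlonglongrightarrow> xval f r' u" by (simp add: xu')
      show ?thesis
        by (rule circ_loop_pos_tendsto[OF \<Phi> f(1) r'(1) J' u1 ev x]) (simp add: xu' circ_continuous_0[OF \<Phi> J'])
    qed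
  qed
  then show ?thesis using that u by blast
qed

text \<open>A monotone subsequence of times suffices. From the right its limit time serves; from the
  left one of the two preceding lemmas applies, according to whether some loop is still being
  explored just before the limit.\<close>

lemma tree_dist_sequentially_compact:
  assumes \<Phi>: "shuffle \<Phi>" and f: "excursion f" and \<sigma>: "\<And>k. \<sigma> k \<in> {0..1}"
  obtains u h where "u \<in> {0..1}" "strict_mono (h :: nat \<Rightarrow> nat)" "(\<lambda>k. tree_dist \<Phi> f (\<sigma> (h k)) u) \<longlonglongrightarrow> 0"
proof -
  note sp = excursion_spectrally_positive[OF f] and result = that
  have f1: "f 1 = 0" using f by (simp add: excursion_def)
  obtain h0 where h0: "strict_mono h0" "monoseq (\<lambda>k. \<sigma> (h0 k))"
    using seq_monosub[of \<sigma>] by blast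
  define \<tau> where "\<tau> k = \<sigma> (h0 k)" for k
  have \<tau>: "\<tau> k \<in> {0..1}" for k using \<sigma> by (simp add: \<tau>_def)
  have "Bseq \<tau>" by (rule BseqI'[of _ 1]) (use \<tau> in auto)
  then have "convergent \<tau>" using h0(2) unfolding \<tau>_def[symmetric] by (intro Bseq_monoseq_convergent)
  then obtain s where s: "\<tau> \<longlonglongrightarrow> s" by (auto simp: convergent_def)
  have s01: "s \<in> {0..1}"
  proof -
    have "0 \<le> s" by (rule LIMSEQ_le_const[OF s]) (use \<tau> in auto)
    moreover have "s \<le> 1" by (rule LIMSEQ_le_const2[OF s]) (use \<tau> in auto)
    ultimately show ?thesis by simp
  qed
  have goal: thesis if "u \<in> {0..1}" "(\<lambda>k. tree_dist \<Phi> f (\<tau> k) u) \<longlonglongrightarrow> 0" for u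
    using result[OF that(1) h0(1)] that(2) unfolding \<tau>_def .
  have cst: thesis if "\<And>k. k0 \<le> k \<Longrightarrow> \<tau> k = s" for k0
  proof -
    have "eventually (\<lambda>k. tree_dist \<Phi> f (\<tau> k) s = 0) sequentially"
      using that by (intro eventually_sequentiallyI[of k0]) simp
    then show thesis by (intro goal[OF s01]) (rule tendsto_eventually)
  qed
  show thesis
  proof (cases "\<exists>k0. \<tau> k0 = s")
    case True
    then obtain k0 where k0: "\<tau> k0 = s" by blast
    have "incseq \<tau> \<or> decseq \<tau>" using h0(2) unfolding \<tau>_def[symmetric] monoseq_iff .
    then have "\<tau> k = s" if "k0 \<le> k" for k
      using incseq_le[OF _ s, of k] incseqD[of \<tau>, OF _ that] decseq_ge[OF _ s, of k] decseqD[of \<tau>, OF _ that] k0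
      by fastforce
    then show ?thesis using cst by blast
  next
    case False
    have "incseq \<tau> \<or> decseq \<tau>" using h0(2) unfolding \<tau>_def[symmetric] monoseq_iff .
    then show ?thesis
    proof
      assume dec: "decseq \<tau>"
      have gt: "s < \<tau> k" for k using decseq_ge[OF dec s, of k] False by (metis less_le)
      have "s \<in> {-1..<1}" using gt[of 0] \<tau>[of 0] s01 by auto
      moreover have "filterlim \<tau> (at_right s) sequentially"
        using s gt by (auto simp: filterlim_at intro!: always_eventually)
      ultimately have "(\<lambda>k. tree_dist \<Phi> f (\<tau> k) s) \<longlonglongrightarrow> 0"
        using filterlim_compose[OF tree_dist_right_continuous[OF \<Phi> sp]] by blast
      then show ?thesis by (rule goal[OF s01])
    next
      assume inc: "incseq \<tau>"
      have lt: "\<tau> k < s" for k using incseq_le[OF inc s, of k] False by (metis less_le)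
      then have \<tau>s: "\<tau> k \<in> {-1..<s}" for k using \<tau>[of k] by auto
      have s': "s \<in> {-1<..1}" using s01 by auto
      show ?thesis
      proof (cases "\<exists>r\<in>{-1<..<s}. left_lim f r < left_lim f s \<and> (\<forall>w\<in>{r..<s}. left_lim f s \<le> f w)")
        case True
        then obtain r where r: "r \<in> {-1<..<s}" "left_lim f r < left_lim f s"
          "\<And>w. w \<in> {r..<s} \<Longrightarrow> left_lim f s \<le> f w" by blast
        obtain u where u: "u \<in> {r..1}" "(\<lambda>k. tree_dist \<Phi> f (\<tau> k) u) \<longlonglongrightarrow> 0"
          using left_limit_point_loop[OF \<Phi> sp f1 s' \<tau>s s inc r] by blast
        \<comment> \<open>The time \<open>u\<close> is only known to follow \<open>r\<close>. Before
          0 an excursion does not jump, whereas the conditions on \<open>r\<close> force a jump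
          there.\<close>
        have "0 \<le> r"
        proof (rule ccontr)
          assume "\<not> 0 \<le> r"
          then have "jump f r = 0" using r by (intro excursion_before_0[OF f]) auto
          moreover have "left_lim f s \<le> f r" using r by auto
          ultimately show False using r(2) by (simp add: jump_def)
        qed
        then show ?thesis using u by (intro goal[of u]) auto
      next
        case False
        then have plain: "\<exists>w\<in>{r..<s}. f w < left_lim f s"
          if "r \<in> {-1<..<s}" "left_lim f r < left_lim f s" for r
          using that by (metis not_less)
        obtain u where u: "u \<in> {s..1}" "(\<lambda>k. tree_dist \<Phi> f (\<tau> k) u) \<longlonglongrightarrow> 0"
          using left_limit_point_plain[OF \<Phi> sp f1 s' \<tau>s s plain] by blast
        then show ?thesis using s01 by (intro goal[of u]) auto
      qed
    qed
  qed
qed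

section \<open>Uniform approximation by finite nets\<close>

text \<open>Unlike punctured filters, \<open>around\<close> and \<open>from_right\<close> include
  \<open>s\<close> itself: the local statements must also hold at the centres of a cover.\<close>

definition around :: "real \<Rightarrow> real filter" where
  "around s = inf (nhds s) (principal {-1..1})"

definition from_right :: "real \<Rightarrow> real filter" where
  "from_right s = inf (nhds s) (principal {s..1})"

lemma eventually_around:
  "eventually P (around s) \<longleftrightarrow> (\<exists>d>0. \<forall>u\<in>{-1..1}. \<bar>u - s\<bar> < d \<longrightarrow> P u)"
  unfolding around_def eventually_inf_principal eventually_nhds_metric by (auto simp: dist_real_def)

lemma eventually_from_right:
  "eventually P (from_right s) \<longleftrightarrow> (\<exists>d>0. \<forall>u\<in>{s..1}. \<bar>u - s\<bar> < d \<longrightarrow> P u)"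
  unfolding from_right_def eventually_inf_principal eventually_nhds_metric by (auto simp: dist_real_def)

lemma eventually_at_left_iff:
  "eventually P (at_left s) \<longleftrightarrow> (\<exists>d>0. \<forall>u::real. u < s \<and> \<bar>u - s\<bar> < d \<longrightarrow> P u)"
proof
  assume "eventually P (at_left s)"
  then obtain b where "b < s" "\<And>u. b < u \<Longrightarrow> u < s \<Longrightarrow> P u" by (auto simp: eventually_at_left_field)
  then show "\<exists>d>0. \<forall>u. u < s \<and> \<bar>u - s\<bar> < d \<longrightarrow> P u" by (intro exI[of _ "s - b"]) auto
next
  assume "\<exists>d>0. \<forall>u. u < s \<and> \<bar>u - s\<bar> < d \<longrightarrow> P u"
  then obtain d where d: "0 < d" "\<And>u. u < s \<Longrightarrow> \<bar>u - s\<bar> < d \<Longrightarrow> P u" by auto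
  have "P u" if "s - d < u" "u < s" for u using d(2)[of u] that by auto
  then show "eventually P (at_left s)"
    unfolding eventually_at_left_field using d(1) by (intro exI[of _ "s - d"]) auto
qed

lemma eventually_around_sides:
  assumes "eventually P (from_right s)" "eventually P (at_left s)"
  shows "eventually P (around s)"
proof -
  obtain d1 where d1: "0 < d1" "\<And>u. u \<in> {s..1} \<Longrightarrow> \<bar>u - s\<bar> < d1 \<Longrightarrow> P u"
    using assms(1) unfolding eventually_from_right by blast
  obtain d2 where d2: "0 < d2" "\<And>u. u < s \<Longrightarrow> \<bar>u - s\<bar> < d2 \<Longrightarrow> P u"
    using assms(2) unfolding eventually_at_left_iff by blast
  show ?thesis
    unfolding eventually_around
  proof (intro exI[of _ "min d1 d2"] conjI ballI impI)
    fix u :: real assume "u \<in> {-1..1}" "\<bar>u - s\<bar> < min d1 d2"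
    then show "P u" using d1(2)[of u] d2(2)[of u] by (cases "s \<le> u") auto
  qed (use d1 d2 in auto)
qed

lemma at_right_le_from_right: "s < 1 \<Longrightarrow> at_right s \<le> from_right s"
proof (rule filter_leI)
  fix P assume s: "s < 1" and "eventually P (from_right s)"
  then obtain d where d: "0 < d" "\<And>u. u \<in> {s..1} \<Longrightarrow> \<bar>u - s\<bar> < d \<Longrightarrow> P u"
    unfolding eventually_from_right by blast
  have "P u" if "s < u" "u < min 1 (s + d)" for u using d(2)[of u] that by auto
  then show "eventually P (at_right s)"
    unfolding eventually_at_right_field using d(1) s by (intro exI[of _ "min 1 (s + d)"]) auto
qed

lemma xval_tendsto_from_right:
  assumes f: "spectrally_positive f" and r: "r \<in> {-1<..1}" and s: "s \<in> {-1..1}"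
  shows "(xval f r \<longlongrightarrow> xval f r s) (from_right s)"
proof (rule xval_tendsto_of_climb[OF f r s])
  show ev: "eventually (\<lambda>u. u \<in> {-1..1}) (from_right s)"
    using s unfolding eventually_from_right by (intro exI[of _ 1]) auto
  show "((\<lambda>u. climb f u s) \<longlongrightarrow> 0) (from_right s)"
  proof (rule tendsto_zero_approx)
    show "eventually (\<lambda>u. 0 \<le> climb f u s) (from_right s)"
      using ev by eventually_elim (intro climb_nonneg f s)
    fix e :: real assume "0 < e"
    then obtain d where d: "0 < d" "\<And>u v. u \<in> {s..<s + d} \<inter> {-1..1} \<Longrightarrow> v \<in> {s..<s + d} \<inter> {-1..1} \<Longrightarrow> climb f u v \<le> e"
      using climb_right_small[OF sp_cadlag[OF f] s] by metis
    have "climb f u s \<le> 0 + e" if "u \<in> {s..1}" "\<bar>u - s\<bar> < d" for u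
      using d(2)[of u s] that s d(1) by auto
    then have "eventually (\<lambda>u. climb f u s \<le> 0 + e) (from_right s)"
      using d(1) unfolding eventually_from_right by blast
    then show "\<exists>b. (b \<longlongrightarrow> 0) (from_right s) \<and> eventually (\<lambda>u. climb f u s \<le> b u + e) (from_right s)"
      by (intro exI[of _ "\<lambda>_. 0"]) auto
  qed
qed

text \<open>For \<open>r < s\<close> the coordinate is continuous at \<open>s\<close> even if
  \<open>f\<close> jumps there, because an upward jump does not lower the running minimum. Only the
  loop opened at \<open>s\<close> has a different left limit, namely 0.\<close>

lemma xval_tendsto_left:
  assumes f: "spectrally_positive f" and r: "r \<in> {-1<..1}" and s: "s \<in> {-1<..1}"
  shows "(xval f r \<longlongrightarrow> (if r = s then 0 else xval f r s)) (at_left s)"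
proof (cases "r < s")
  case False
  have "eventually (\<lambda>u. u < s) (at_left s)" unfolding eventually_at_left_iff by (intro exI[of _ 1]) auto
  then have "eventually (\<lambda>u. xval f r u = (if r = s then 0 else xval f r s)) (at_left s)"
    by eventually_elim (use False in \<open>auto simp: xval_less\<close>)
  then show ?thesis by (rule tendsto_eventually)
next
  case True
  have "(xval f r \<longlongrightarrow> xval f r s) (at_left s)"
  proof (rule tendstoI)
    fix e :: real assume "0 < e"
    then have "0 < e / 3" by simp
    then obtain d where d: "0 < d" "d \<le> s + 1" "\<And>w. w \<in> {s - d<..<s} \<Longrightarrow> \<bar>f w - left_lim f s\<bar> < e / 3"
      using cadlag_left_close[OF sp_cadlag[OF f] s] by metis
    have "dist (xval f r u) (xval f r s) < e" if u: "u < s" "\<bar>u - s\<bar> < min d (s - r)" for u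
    proof -
      have le: "r \<le> u" "u \<le> s" "s \<le> 1" using u s by auto
      have ud: "u \<in> {s - d<..<s}" using u by auto
      have "left_lim f s - e / 3 \<le> valley f u s"
      proof (rule valley_ge)
        fix w assume w: "w \<in> {min u s..max u s}"
        show "left_lim f s - e / 3 \<le> f w"
        proof (cases "w = s")
          case True
          then show ?thesis using sp_left_lim_le[OF f s] \<open>0 < e\<close> by simp
        next
          case False
          then have "w \<in> {s - d<..<s}" using w ud by auto
          then show ?thesis using d(3)[of w] by linarith
        qed
      qed
      moreover have "f u < left_lim f s + e / 3" using d(3)[OF ud] by linarith
      moreover have "xval f r u - xval f r s \<le> f u - valley f u s" "xval f r s \<le> xval f r u"
        using xval_diff_le_drop[OF f r le] xval_antimono[OF f r le] by auto
      ultimately have "xval f r u - xval f r s < e" using \<open>0 < e\<close> by linarith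
      with \<open>xval f r s \<le> xval f r u\<close> show ?thesis by (simp add: dist_real_def)
    qed
    then show "eventually (\<lambda>u. dist (xval f r u) (xval f r s) < e) (at_left s)"
      unfolding eventually_at_left_iff using d(1) True by (intro exI[of _ "min d (s - r)"]) auto
  qed
  then show ?thesis using True by simp
qed

lemma xval_tendsto_around:
  assumes f: "spectrally_positive f" and r: "r \<in> {-1<..1}" and s: "s \<in> {-1..1}" "r \<noteq> s"
  shows "(xval f r \<longlongrightarrow> xval f r s) (around s)"
proof (rule tendstoI)
  fix e :: real assume e: "0 < e"
  have R: "eventually (\<lambda>u. dist (xval f r u) (xval f r s) < e) (from_right s)"
    using xval_tendsto_from_right[OF f r s(1)] e by (rule tendstoD)
  show "eventually (\<lambda>u. dist (xval f r u) (xval f r s) < e) (around s)"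
  proof (cases "s = -1")
    case True
    then have "around s = from_right s" by (simp add: around_def from_right_def)
    then show ?thesis using R by simp
  next
    case False
    then have "s \<in> {-1<..1}" using s by auto
    from tendstoD[OF xval_tendsto_left[OF f r this] e] show ?thesis
      using s(2) R by (intro eventually_around_sides) auto
  qed
qed

lemma ratio_close:
  fixes x \<Delta> :: real
  assumes "0 < \<Delta>" "0 < \<theta>"
  obtains \<kappa> where "0 < \<kappa>" "\<And>x' \<Delta>'. \<bar>x' - x\<bar> < \<kappa> \<Longrightarrow> \<bar>\<Delta>' - \<Delta>\<bar> < \<kappa> \<Longrightarrow> \<bar>x' / \<Delta>' - x / \<Delta>\<bar> < \<theta>"
proof -
  have "isCont (\<lambda>p. fst p / snd p) (x, \<Delta>)"
    using assms by (intro continuous_intros) auto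
  then obtain d where d: "0 < d" "\<And>p. dist p (x, \<Delta>) < d \<Longrightarrow> dist (fst p / snd p) (x / \<Delta>) < \<theta>"
    unfolding continuous_at_eps_delta using assms by (metis fst_conv snd_conv)
  show ?thesis
  proof
    show "0 < d / 2" using d by simp
    fix x' \<Delta>' assume "\<bar>x' - x\<bar> < d / 2" "\<bar>\<Delta>' - \<Delta>\<bar> < d / 2"
    then have "\<bar>x' - x\<bar> + \<bar>\<Delta>' - \<Delta>\<bar> < d" by linarith
    moreover have "dist (x', \<Delta>') (x, \<Delta>) \<le> \<bar>x' - x\<bar> + \<bar>\<Delta>' - \<Delta>\<bar>"
      unfolding dist_Pair_Pair dist_real_def using sqrt_sum_squares_le_sum_abs[of "\<bar>x' - x\<bar>" "\<bar>\<Delta>' - \<Delta>\<bar>"] by simp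
    ultimately show "\<bar>x' / \<Delta>' - x / \<Delta>\<bar> < \<theta>" using d(2)[of "(x', \<Delta>')"] by (simp add: dist_real_def)
  qed
qed

lemma skorokhod_circ_close:
  fixes \<Phi> :: "real \<Rightarrow> real \<Rightarrow> real"
  assumes "((\<lambda>u. skorokhod_circ (\<Phi> u) (\<Phi> \<Delta>)) \<longlongrightarrow> 0) (at \<Delta>)" "0 < \<Delta>" "0 < e"
  obtains \<kappa> where "0 < \<kappa>" "\<And>u. \<bar>u - \<Delta>\<bar> < \<kappa> \<Longrightarrow> 0 < u"
    "\<And>u. \<bar>u - \<Delta>\<bar> < \<kappa> \<Longrightarrow> \<exists>l\<in>increasing_bijections 0 1. \<forall>x\<in>{0..1}. \<bar>l x - x\<bar> < e \<and> circ (\<Phi> u x) (\<Phi> \<Delta> (l x)) < e"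
proof -
  have "eventually (\<lambda>u. skorokhod_circ (\<Phi> u) (\<Phi> \<Delta>) < e) (at \<Delta>)"
    using order_tendstoD(2)[OF assms(1,3)] .
  then obtain d where d: "0 < d" "\<And>u. u \<noteq> \<Delta> \<Longrightarrow> \<bar>u - \<Delta>\<bar> < d \<Longrightarrow> skorokhod_circ (\<Phi> u) (\<Phi> \<Delta>) < e"
    unfolding eventually_at by (auto simp: dist_real_def)
  show ?thesis
  proof
    show "0 < min d \<Delta>" using d assms by simp
    fix u assume u: "\<bar>u - \<Delta>\<bar> < min d \<Delta>"
    show "0 < u" using u by auto
    show "\<exists>l\<in>increasing_bijections 0 1. \<forall>x\<in>{0..1}. \<bar>l x - x\<bar> < e \<and> circ (\<Phi> u x) (\<Phi> \<Delta> (l x)) < e"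
    proof (cases "u = \<Delta>")
      case True
      have "(\<lambda>x. x) \<in> increasing_bijections 0 1"
        by (auto simp: increasing_bijections_def strict_mono_on_def bij_betw_def inj_on_def)
      then show ?thesis using True assms(3) by (intro bexI[of _ "\<lambda>x. x"]) auto
    next
      case False
      then have lt: "skorokhod_circ (\<Phi> u) (\<Phi> \<Delta>) < e" using d u by auto
      have bdd: "bdd_above ((\<lambda>x. circ (\<Phi> u x) (\<Phi> \<Delta> (l x))) ` {0..1})" for l
        by (intro bdd_aboveI2[of _ _ "1/2"] circ_le_half)
      show ?thesis using skorokhod_distD[OF lt zero_le_one bdd] by metis
    qed
  qed
qed

text \<open>Skorokhod closeness compares shuffles only after a time change. The position of
  \<open>g\<close> is therefore near the image of some \<open>y\<close> close to
  \<open>x / jump f r\<close>, and this \<open>y\<close> may lie on either side of a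
  discontinuity.\<close>

lemma loop_pos_transfer:
  assumes \<Phi>: "shuffle \<Phi>" and f: "spectrally_positive f" and r: "r \<in> {-1<..1}" "0 < jump f r"
    and cont: "((\<lambda>u. skorokhod_circ (\<Phi> u) (\<Phi> (jump f r))) \<longlongrightarrow> 0) (at (jump f r))"
    and F: "eventually (\<lambda>s. s \<in> {-1..1}) F" "(xval f r \<longlongrightarrow> x) F"
    and e: "0 < e" "0 < \<theta>"
  shows "\<exists>\<rho>>0. eventually (\<lambda>s. \<forall>g. close_path \<rho> f g \<longrightarrow>
    (\<exists>y\<in>{0..1}. \<bar>y - x / jump f r\<bar> < \<theta> \<and> circ (loop_pos \<Phi> g r s) (\<Phi> (jump f r) y) < e)) F"
proof -
  let ?\<Delta> = "jump f r"
  \<comment> \<open>The same bound controls the error of the value, allowed up to \<open>e\<close>,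
    and the shift of the argument; the other half of \<open>\<theta>\<close> is left for the change
    of the ratio.\<close>
  define \<theta>' where "\<theta>' = min e (\<theta> / 2)"
  have \<theta>': "0 < \<theta>'" "\<theta>' \<le> e" "\<theta>' \<le> \<theta> / 2" using e by (auto simp: \<theta>'_def)
  obtain \<kappa>1 where \<kappa>1: "0 < \<kappa>1" "\<And>u. \<bar>u - ?\<Delta>\<bar> < \<kappa>1 \<Longrightarrow> 0 < u"
    "\<And>u. \<bar>u - ?\<Delta>\<bar> < \<kappa>1 \<Longrightarrow> \<exists>l\<in>increasing_bijections 0 1. \<forall>x\<in>{0..1}. \<bar>l x - x\<bar> < \<theta>' \<and> circ (\<Phi> u x) (\<Phi> ?\<Delta> (l x)) < \<theta>'"
    using skorokhod_circ_close[OF cont r(2) \<theta>'(1)] by metis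
  have "0 < \<theta> / 2" using e by simp
  then obtain \<kappa>2 where \<kappa>2: "0 < \<kappa>2"
    "\<And>x' \<Delta>'. \<bar>x' - x\<bar> < \<kappa>2 \<Longrightarrow> \<bar>\<Delta>' - ?\<Delta>\<bar> < \<kappa>2 \<Longrightarrow> \<bar>x' / \<Delta>' - x / ?\<Delta>\<bar> < \<theta> / 2"
    using ratio_close[OF r(2), of "\<theta> / 2" x] by metis
  define \<rho> where "\<rho> = min \<kappa>1 \<kappa>2 / 5"
  have \<rho>: "0 < \<rho>" "2 * \<rho> < \<kappa>1" "2 * \<rho> < \<kappa>2 / 2" using \<kappa>1(1) \<kappa>2(1) by (auto simp: \<rho>_def min_def)
  have "eventually (\<lambda>s. dist (xval f r s) x < \<kappa>2 / 2) F"
    using \<kappa>2(1) by (intro tendstoD[OF F(2)]) auto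
  with F(1) have "eventually (\<lambda>s. \<forall>g. close_path \<rho> f g \<longrightarrow>
    (\<exists>y\<in>{0..1}. \<bar>y - x / ?\<Delta>\<bar> < \<theta> \<and> circ (loop_pos \<Phi> g r s) (\<Phi> ?\<Delta> y) < e)) F"
  proof eventually_elim
    case (elim s)
    show ?case
    proof (intro allI impI)
      fix g assume "close_path \<rho> f g"
      note g = close_pathD[OF this]
      have j: "\<bar>jump g r - ?\<Delta>\<bar> \<le> 2 * \<rho>"
        by (intro jump_close sp_cadlag g f r)
      then have "\<bar>jump g r - ?\<Delta>\<bar> < \<kappa>1" using \<rho> by simp
      from \<kappa>1(2,3)[OF this] obtain l where l: "0 < jump g r" "l \<in> increasing_bijections 0 1"
        "\<And>x. x \<in> {0..1} \<Longrightarrow> \<bar>l x - x\<bar> < \<theta>' \<and> circ (\<Phi> (jump g r) x) (\<Phi> ?\<Delta> (l x)) < \<theta>'" by blast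
      have "\<bar>xval g r s - xval f r s\<bar> \<le> 2 * \<rho>" by (intro xval_close g f r elim(1))
      then have "\<bar>xval g r s - x\<bar> < \<kappa>2" using elim(2) \<rho> unfolding dist_real_def by linarith
      moreover have "\<bar>jump g r - ?\<Delta>\<bar> < \<kappa>2" using j \<rho> \<kappa>2(1) by linarith
      ultimately have near: "\<bar>xval g r s / jump g r - x / ?\<Delta>\<bar> < \<theta> / 2" by (rule \<kappa>2(2))
      have y: "xval g r s / jump g r \<in> {0..1}" by (intro xval_ratio g r elim(1) l(1))
      show "\<exists>y\<in>{0..1}. \<bar>y - x / ?\<Delta>\<bar> < \<theta> \<and> circ (loop_pos \<Phi> g r s) (\<Phi> ?\<Delta> y) < e"
      proof (intro bexI[of _ "l (xval g r s / jump g r)"] conjI)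
        show "l (xval g r s / jump g r) \<in> {0..1}" using increasing_bijectionsD(3)[OF l(2) y] .
        show "\<bar>l (xval g r s / jump g r) - x / ?\<Delta>\<bar> < \<theta>" using l(3)[OF y] near \<theta>' by linarith
        show "circ (loop_pos \<Phi> g r s) (\<Phi> ?\<Delta> (l (xval g r s / jump g r))) < e"
          using l(3)[OF y] \<theta>' unfolding loop_pos_def by linarith
      qed
    qed
  qed
  with \<rho>(1) show ?thesis by blast
qed

lemma uniform_ball_finite:
  assumes "finite J" "\<And>r. r \<in> J \<Longrightarrow> \<exists>\<rho>>0. eventually (\<lambda>s. \<forall>g. close_path \<rho> f g \<longrightarrow> Q r g s) F"
  shows "\<exists>\<rho>>0. eventually (\<lambda>s. \<forall>g. close_path \<rho> f g \<longrightarrow> (\<forall>r\<in>J. Q r g s)) F"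
  using assms
proof (induction J rule: finite_induct)
  case empty
  then show ?case by (intro exI[of _ 1]) auto
next
  case (insert a J)
  obtain \<rho>1 where \<rho>1: "0 < \<rho>1" "eventually (\<lambda>s. \<forall>g. close_path \<rho>1 f g \<longrightarrow> (\<forall>r\<in>J. Q r g s)) F"
    using insert by blast
  obtain \<rho>2 where \<rho>2: "0 < \<rho>2" "eventually (\<lambda>s. \<forall>g. close_path \<rho>2 f g \<longrightarrow> Q a g s) F"
    using insert by blast
  have "eventually (\<lambda>s. \<forall>g. close_path (min \<rho>1 \<rho>2) f g \<longrightarrow> (\<forall>r\<in>insert a J. Q r g s)) F"
    using \<rho>1(2) \<rho>2(2)
  proof eventually_elim
    case (elim s)
    then show ?case using close_path_mono[of "min \<rho>1 \<rho>2" f] by (metis insertE min.cobounded1 min.cobounded2)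
  qed
  then show ?case using \<rho>1(1) \<rho>2(1) by (intro exI[of _ "min \<rho>1 \<rho>2"]) auto
qed

section \<open>Consequences of the disjointness of the B-sets\<close>

locale shuffled_excursion =
  fixes \<Phi> :: "real \<Rightarrow> real \<Rightarrow> real" and f :: "real \<Rightarrow> real"
  assumes \<Phi>: "shuffle \<Phi>" and exc: "excursion f" and disjoint: "bset f \<inter> disc \<Phi> = {}"
begin

lemma sp: "spectrally_positive f"
  by (rule excursion_spectrally_positive[OF exc])

lemma f_1: "f 1 = 0"
  using exc by (simp add: excursion_def)

lemma jump_pos_range:
  assumes "r \<in> {-1<..1}" "0 < jump f r"
  shows "r \<in> {0..1}"
proof -
  have "\<not> r < 0" using excursion_before_0(2)[OF exc, of r] assms by auto
  then show ?thesis using assms by auto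
qed

lemma skorokhod_tendsto:
  assumes "r \<in> {-1<..1}" "0 < jump f r"
  shows "((\<lambda>u. skorokhod_circ (\<Phi> u) (\<Phi> (jump f r))) \<longlongrightarrow> 0) (at (jump f r))"
proof -
  have "jump f r \<in> bset1 f" using jump_pos_range[OF assms] assms by (auto simp: bset1_def)
  then have "Inl (jump f r) \<notin> disc \<Phi>" using disjoint unfolding bset_def by blast
  then have "jump f r \<notin> disc1 \<Phi>" unfolding disc_def by blast
  then show ?thesis using assms(2) unfolding disc1_def by blast
qed

lemma circ_continuous_repeated:
  assumes r: "r \<in> {-1<..1}" and st: "s \<in> {-1..1}" "t \<in> {-1..1}" "s \<noteq> t"
    and x: "xval f r s = xval f r t" "0 < xval f r t"
  shows "circ_continuous (\<Phi> (jump f r)) (xval f r t / jump f r)"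
proof -
  have J: "0 < jump f r" using xval_pos_jump(1)[OF sp r st(2) x(2)] .
  have "(jump f r, xval f r t / jump f r) \<in> bset2 f"
    unfolding bset2_def using J x st excursion_xval_pos[OF exc r st(1)] excursion_xval_pos[OF exc r st(2)]
    by force
  then have "Inr (jump f r, xval f r t / jump f r) \<notin> disc \<Phi>" using disjoint unfolding bset_def by blast
  then have "(jump f r, xval f r t / jump f r) \<notin> disc2 \<Phi>" unfolding disc_def by blast
  then show ?thesis
    using J xval_ratio[OF sp r st(2) J] unfolding disc2_def circ_continuous_def by blast
qed

text \<open>\<open>bset2\<close> covers positive coordinates only; at 0 every shuffle is continuous
  anyway.\<close>

lemma circ_continuous_repeated_or_0:
  assumes r: "r \<in> {-1<..1}" "0 < jump f r" and st: "s \<in> {-1..1}" "t \<in> {-1..1}" "s \<noteq> t"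
    and x: "xval f r s = xval f r t"
  shows "circ_continuous (\<Phi> (jump f r)) (xval f r t / jump f r)"
proof (cases "xval f r t = 0")
  case True
  then show ?thesis using circ_continuous_0[OF \<Phi> r(2)] by simp
next
  case False
  then show ?thesis using circ_continuous_repeated[OF r(1) st x] by (simp add: less_le)
qed

text \<open>Within \<open>[0, 1]\<close>, left-continuity at the right end is full
  continuity.\<close>

lemma circ_continuous_1:
  assumes "0 < \<Delta>"
  shows "circ_continuous (\<Phi> \<Delta>) 1"
proof (rule circ_continuousI[OF shuffle_caglad[OF \<Phi> assms]])
  fix e :: real assume "0 < e"
  then show "\<exists>\<theta>>0. \<forall>y'\<in>{0..1}. \<bar>y' - 1\<bar> < \<theta> \<longrightarrow> circ (\<Phi> \<Delta> y') (\<Phi> \<Delta> 1) \<le> e"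
    using caglad_circ_sides[OF shuffle_caglad[OF \<Phi> assms], of 1]
    by (metis atLeastAtMost_iff less_imp_le order_refl zero_le_one)
qed simp

text \<open>Positions 0 and 1 are never discontinuities, so the loop was opened strictly before
  \<open>s\<close> and is still open. If \<open>f\<close> jumped at \<open>s\<close>, it would stay
  above the left limit for a while, the coordinate would recur at a later time, and the B-sets would
  meet.\<close>

lemma discontinuity_no_jump:
  assumes r: "r \<in> {-1<..1}" "0 < jump f r" and s: "s \<in> {-1<..<1}"
    and bad: "\<not> circ_continuous (\<Phi> (jump f r)) (xval f r s / jump f r)"
  shows "r < s" "0 < xval f r s" "jump f s = 0"
proof -
  have s1: "s \<in> {-1..1}" "s \<in> {-1<..1}" using s by auto
  have pos: "0 < xval f r s"
  proof (rule ccontr)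
    assume "\<not> 0 < xval f r s"
    then have "xval f r s = 0" using xval_nonneg[of f r s] by linarith
    then show False using bad circ_continuous_0[OF \<Phi> r(2)] by simp
  qed
  then show "0 < xval f r s" .
  have "r \<noteq> s"
  proof
    assume "r = s"
    then have "xval f r s / jump f r = 1" using xval_same[OF sp r(1)] r(2) by simp
    then show False using bad circ_continuous_1[OF r(2)] by simp
  qed
  then show rs: "r < s" using xval_pos_jump(2)[OF sp r(1) s1(1) pos] by simp
  show "jump f s = 0"
  proof (rule ccontr)
    assume "jump f s \<noteq> 0"
    then have lt: "left_lim f s < f s" using sp_left_lim_le[OF sp s1(2)] by (simp add: jump_def)
    have "s \<in> {-1..<1}" using s by auto
    then obtain d where d: "0 < d" "d \<le> 1 - s" "\<And>w. w \<in> {s..<s + d} \<Longrightarrow> \<bar>f w - f s\<bar> < f s - left_lim f s"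
      using cadlag_right_close[OF sp_cadlag[OF sp], of s "f s - left_lim f s"] lt by (metis diff_gt_0_iff_gt)
    define u where "u = s + d / 2"
    have u: "s < u" "u < s + d" "u \<le> 1" "u \<in> {-1..1}" using d(1,2) s by (auto simp: u_def)
    have "left_lim f s \<le> valley f s u"
    proof (rule valley_ge)
      fix w assume "w \<in> {min s u..max s u}"
      then have "w \<in> {s..<s + d}" using u by auto
      from d(3)[OF this] show "left_lim f s \<le> f w" by linarith
    qed
    moreover have "valley f r s \<le> left_lim f s"
      using rs r s by (intro left_lim_ge_valley sp) auto
    ultimately have "xval f r s \<le> max (valley f s u - left_lim f r) 0" using rs by (simp add: xval_eq)
    then have "xval f r u = xval f r s" using xval_step[OF sp r(1) _ _ u(3), of s] rs u by simp
    then show False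
      using circ_continuous_repeated_or_0[OF r u(4) s1(1)] u(1) bad by auto
  qed
qed

text \<open>Of two such loops, the one opened later at \<open>r'\<close> is still open at
  \<open>s\<close>. The path has then stayed above its base since \<open>r'\<close>, so the
  coordinate on the earlier loop is the same at \<open>r'\<close> and at \<open>s\<close>: a
  repetition, at which the shuffle is continuous.\<close>

lemma discontinuity_unique:
  assumes r: "r \<in> {-1<..1}" "0 < jump f r" and r': "r' \<in> {-1<..1}" "0 < jump f r'" and s: "s \<in> {-1<..<1}"
    and bad: "\<not> circ_continuous (\<Phi> (jump f r)) (xval f r s / jump f r)"
    and bad': "\<not> circ_continuous (\<Phi> (jump f r')) (xval f r' s / jump f r')"
  shows "r = r'"
proof -
  have s1: "s \<in> {-1..1}" using s by auto
  have main: False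
    if lt: "r < r'" and r: "r \<in> {-1<..1}" "0 < jump f r" and r': "r' \<in> {-1<..1}" "0 < jump f r'"
      and bad: "\<not> circ_continuous (\<Phi> (jump f r)) (xval f r s / jump f r)"
      and bad': "\<not> circ_continuous (\<Phi> (jump f r')) (xval f r' s / jump f r')" for r r'
  proof -
    note D = discontinuity_no_jump[OF r' s bad']
    have "left_lim f r' < valley f r' s" using D by (auto simp: xval_eq max_def split: if_splits)
    moreover have "valley f r r' \<le> left_lim f r'" using lt r r' by (intro left_lim_ge_valley sp) auto
    ultimately have "xval f r r' \<le> max (valley f r' s - left_lim f r) 0" using lt by (simp add: xval_eq)
    then have "xval f r s = xval f r r'"
      using xval_step[OF sp r(1), of r' s] lt D(1) s by simp
    moreover have "r' \<in> {-1..1}" using r' by auto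
    ultimately show False
      using circ_continuous_repeated_or_0[OF r _ s1, of r'] D(1) bad by auto
  qed
  show ?thesis
    using main[OF _ r r' bad bad'] main[OF _ r' r bad' bad] by (cases r r' rule: linorder_cases) auto
qed

definition loop_limit_left :: "real \<Rightarrow> real \<Rightarrow> real" where
  "loop_limit_left r s = (if r = s then 0 else xval f r s)"

lemma loop_limit_left_ratio:
  assumes "r \<in> {-1<..1}" "0 < jump f r" "s \<in> {-1..1}"
  shows "loop_limit_left r s / jump f r \<in> {0..1}"
  using xval_ratio[OF sp assms(1,3,2)] by (simp add: loop_limit_left_def)

text \<open>Times before \<open>s\<close> approach their limit position from above, hence see the
  right limit of the shuffle there.\<close>

lemma loop_limit_left_le:
  assumes "r \<in> {-1<..1}" "u < s" "s \<le> 1" "r \<le> u \<or> s \<le> r"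
  shows "loop_limit_left r s \<le> xval f r u"
proof (cases "r \<le> u")
  case True
  then have "xval f r s \<le> xval f r u" using assms by (intro xval_antimono sp) auto
  then show ?thesis using True assms by (auto simp: loop_limit_left_def)
next
  case False
  then show ?thesis using assms by (auto simp: loop_limit_left_def xval_less)
qed

text \<open>Good times are the candidates for the points of the net: there, and at all nearby times, a nearby path
  sits almost at the position of \<open>f\<close> on each of the finitely many loops in \<open>J\<close>. A time at which
  \<open>f\<close> meets a discontinuity of a shuffle need not be good.\<close>

definition good :: "real set \<Rightarrow> real \<Rightarrow> real \<Rightarrow> bool" where
  "good J e p \<longleftrightarrow> (\<exists>\<rho>>0. eventually (\<lambda>s. \<forall>g. close_path \<rho> f g \<longrightarrow>
     climb g s p \<le> e \<and> (\<forall>r\<in>J. circ (loop_pos \<Phi> g r s) (loop_pos \<Phi> f r p) \<le> e)) (around p))"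

text \<open>By \<open>climb_close\<close> the change of path costs \<open>4 * \<rho>\<close>, which
  is at most \<open>e / 2\<close>.\<close>

lemma climb_transfer:
  assumes "close_path \<rho> f g" "\<rho> \<le> e / 8" "s \<in> {-1..1}" "p \<in> {-1..1}" "climb f s p \<le> e / 2"
  shows "climb g s p \<le> e"
  using climb_close[OF close_pathD(1)[OF assms(1)] sp assms(3,4) close_pathD(2)[OF assms(1)]] assms(2,5)
  by linarith

text \<open>Half of \<open>e\<close> pays for the transfer from \<open>g\<close> to
  \<open>f\<close>, the other half for the oscillation of the shuffle near the position of
  \<open>p\<close>. The time \<open>p\<close> must avoid \<open>J\<close> because the coordinate on
  a loop is discontinuous at its opening time.\<close>

lemma goodI:
  assumes J: "finite J" "J \<subseteq> {-1<..1}" "\<And>r. r \<in> J \<Longrightarrow> 0 < jump f r" and e: "0 < e"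
    and p: "p \<in> {-1..1}" "p \<notin> J"
    and climb: "eventually (\<lambda>s. climb f s p \<le> e / 2) (around p)"
    and loop: "\<And>r. r \<in> J \<Longrightarrow> \<exists>\<theta>>0. \<forall>y\<in>{0..1}. \<bar>y - xval f r p / jump f r\<bar> < \<theta> \<longrightarrow>
      circ (\<Phi> (jump f r) y) (loop_pos \<Phi> f r p) \<le> e / 2"
  shows "good J e p"
proof -
  have ev: "eventually (\<lambda>s. s \<in> {-1..1}) (around p)"
    unfolding eventually_around by (intro exI[of _ 1]) auto
  have "\<exists>\<rho>>0. eventually (\<lambda>s. \<forall>g. close_path \<rho> f g \<longrightarrow> (\<forall>r\<in>J.
    (s \<in> {-1..1} \<longrightarrow> circ (loop_pos \<Phi> g r s) (loop_pos \<Phi> f r p) \<le> e))) (around p)"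
  proof (rule uniform_ball_finite[OF J(1)])
    fix r assume r: "r \<in> J"
    then have r1: "r \<in> {-1<..1}" "0 < jump f r" "r \<noteq> p" using J p by auto
    obtain \<theta> where \<theta>: "0 < \<theta>" "\<And>y. y \<in> {0..1} \<Longrightarrow> \<bar>y - xval f r p / jump f r\<bar> < \<theta> \<Longrightarrow>
      circ (\<Phi> (jump f r) y) (loop_pos \<Phi> f r p) \<le> e / 2" using loop[OF r] by blast
    have "0 < e / 2" using e by simp
    from loop_pos_transfer[OF \<Phi> sp r1(1,2) skorokhod_tendsto[OF r1(1,2)] ev
        xval_tendsto_around[OF sp r1(1) p(1) r1(3)] this \<theta>(1)]
    obtain \<rho> where \<rho>: "0 < \<rho>" "eventually (\<lambda>s. \<forall>g. close_path \<rho> f g \<longrightarrow>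
      (\<exists>y\<in>{0..1}. \<bar>y - xval f r p / jump f r\<bar> < \<theta> \<and> circ (loop_pos \<Phi> g r s) (\<Phi> (jump f r) y) < e / 2)) (around p)"
      by blast
    define \<rho>' where "\<rho>' = min \<rho> (jump f r / 3)"
    have \<rho>': "0 < \<rho>'" "\<rho>' \<le> \<rho>" "2 * \<rho>' < jump f r" using \<rho>(1) r1(2) by (auto simp: \<rho>'_def min_def)
    have "eventually (\<lambda>s. \<forall>g. close_path \<rho>' f g \<longrightarrow>
      (s \<in> {-1..1} \<longrightarrow> circ (loop_pos \<Phi> g r s) (loop_pos \<Phi> f r p) \<le> e)) (around p)"
      using \<rho>(2)
    proof eventually_elim
      case (elim s)
      show ?case
      proof (intro allI impI)
        fix g assume g: "close_path \<rho>' f g" and s: "s \<in> {-1..1}"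
        note gD = close_pathD[OF g]
        obtain y where y: "y \<in> {0..1}" "\<bar>y - xval f r p / jump f r\<bar> < \<theta>"
          "circ (loop_pos \<Phi> g r s) (\<Phi> (jump f r) y) < e / 2"
          using elim close_path_mono[OF g \<rho>'(2)] by blast
        have "\<bar>jump g r - jump f r\<bar> \<le> 2 * \<rho>'" by (intro jump_close sp_cadlag gD sp r1)
        then have jg: "0 < jump g r" using \<rho>' by linarith
        have "circ (loop_pos \<Phi> g r s) (loop_pos \<Phi> f r p)
          \<le> circ (loop_pos \<Phi> g r s) (\<Phi> (jump f r) y) + circ (\<Phi> (jump f r) y) (loop_pos \<Phi> f r p)"
          by (intro circ_triangle loop_pos_range[OF \<Phi>] shuffle_range[OF \<Phi>] gD sp r1 y s p jg)
        then show "circ (loop_pos \<Phi> g r s) (loop_pos \<Phi> f r p) \<le> e" using y(3) \<theta>(2)[OF y(1,2)] by linarith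
      qed
    qed
    with \<rho>'(1) show "\<exists>\<rho>>0. eventually (\<lambda>s. \<forall>g. close_path \<rho> f g \<longrightarrow>
      (s \<in> {-1..1} \<longrightarrow> circ (loop_pos \<Phi> g r s) (loop_pos \<Phi> f r p) \<le> e)) (around p)" by blast
  qed
  then obtain \<rho> where \<rho>: "0 < \<rho>" "eventually (\<lambda>s. \<forall>g. close_path \<rho> f g \<longrightarrow> (\<forall>r\<in>J.
    (s \<in> {-1..1} \<longrightarrow> circ (loop_pos \<Phi> g r s) (loop_pos \<Phi> f r p) \<le> e))) (around p)" by blast
  have "eventually (\<lambda>s. \<forall>g. close_path (min \<rho> (e / 8)) f g \<longrightarrow>
     climb g s p \<le> e \<and> (\<forall>r\<in>J. circ (loop_pos \<Phi> g r s) (loop_pos \<Phi> f r p) \<le> e)) (around p)"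
    using ev climb \<rho>(2)
  proof eventually_elim
    case (elim s)
    show ?case
    proof (intro allI impI conjI)
      fix g assume g: "close_path (min \<rho> (e / 8)) f g"
      show "climb g s p \<le> e" by (rule climb_transfer[OF g _ elim(1) p(1) elim(2)]) simp
      have "close_path \<rho> f g" by (rule close_path_mono[OF g]) simp
      then show "\<forall>r\<in>J. circ (loop_pos \<Phi> g r s) (loop_pos \<Phi> f r p) \<le> e" using elim(1,3) by blast
    qed
  qed
  then show ?thesis unfolding good_def using \<rho>(1) e by (intro exI[of _ "min \<rho> (e / 8)"]) auto
qed

lemma good_continuousI:
  assumes J: "finite J" "J \<subseteq> {-1<..1}" "\<And>r. r \<in> J \<Longrightarrow> 0 < jump f r" and e: "0 < e"
    and p: "p \<in> {-1..1}" "p \<notin> J"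
    and climb: "eventually (\<lambda>s. climb f s p \<le> e / 2) (around p)"
    and cont: "\<And>r. r \<in> J \<Longrightarrow> circ_continuous (\<Phi> (jump f r)) (xval f r p / jump f r)"
  shows "good J e p"
proof (rule goodI[OF J e p climb])
  fix r assume "r \<in> J"
  from circ_continuousD[OF cont[OF this], of "e / 2"] e
  show "\<exists>\<theta>>0. \<forall>y\<in>{0..1}. \<bar>y - xval f r p / jump f r\<bar> < \<theta> \<longrightarrow> circ (\<Phi> (jump f r) y) (loop_pos \<Phi> f r p) \<le> e / 2"
    unfolding loop_pos_def by (metis half_gt_zero less_imp_le)
qed

lemma climb_around_endpoint:
  assumes "s = -1 \<or> s = 1" "0 < e"
  shows "eventually (\<lambda>u. climb f u s \<le> e) (around s)"
proof -
  have s: "s \<in> {-1..1}" using assms(1) by auto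
  have "jump f s = 0 \<or> s = -1"
  proof (cases "s = 1")
    case True
    have "left_lim f 1 \<le> f 1" "0 \<le> left_lim f 1"
      using sp_left_lim_le[OF sp, of 1] sp_left_lim_nonneg[OF sp, of 1] by auto
    then show ?thesis using True f_1 by (simp add: jump_def)
  qed (use assms in auto)
  from climb_two_sided_small[OF sp_cadlag[OF sp] s this assms(2)]
  obtain d where d: "0 < d" "\<And>u v. u \<in> {s - d<..<s + d} \<inter> {-1..1} \<Longrightarrow> v \<in> {s - d<..<s + d} \<inter> {-1..1} \<Longrightarrow> climb f u v \<le> e"
    by metis
  have "climb f u s \<le> e" if "u \<in> {-1..1}" "\<bar>u - s\<bar> < d" for u
    using that d(1) s by (intro d(2)) auto
  then show ?thesis unfolding eventually_around using d(1) by blast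
qed

lemma good_endpoint:
  assumes J: "finite J" "J \<subseteq> {-1<..1}" "\<And>r. r \<in> J \<Longrightarrow> 0 < jump f r" and e: "0 < e"
    and s: "s = -1 \<or> s = 1"
  shows "good J e s"
proof (rule good_continuousI[OF J e])
  show s1: "s \<in> {-1..1}" using s by auto
  have x: "xval f r s = 0" if "r \<in> {-1<..1}" for r
    using that s s1 by (intro excursion_xval_eq_0[OF exc]) auto
  show "s \<notin> J"
  proof
    assume "s \<in> J"
    then have "s \<in> {-1<..1}" "0 < jump f s" using J by auto
    then show False using x[of s] xval_same[OF sp, of s] by simp
  qed
  show "eventually (\<lambda>u. climb f u s \<le> e / 2) (around s)" using e by (intro climb_around_endpoint s) auto
  fix r assume "r \<in> J"
  then show "circ_continuous (\<Phi> (jump f r)) (xval f r s / jump f r)"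
    using J x[of r] circ_continuous_0[OF \<Phi>] by auto
qed auto

text \<open>Close to the limit position a shuffle is nearly constant on each side. A coordinate
  different from the limit stays on its side under small perturbations, so its position is stable
  even if the limit is a discontinuity. Only times that attain the limit coordinate require
  continuity.\<close>

lemma good_eventually:
  assumes J: "finite J" "J \<subseteq> {-1<..1}" "\<And>r. r \<in> J \<Longrightarrow> 0 < jump f r" and e: "0 < e"
    and ev: "eventually (\<lambda>p. p \<in> {-1..1}) F" "eventually (\<lambda>p. p \<notin> J) F"
    and climb: "eventually (\<lambda>p. eventually (\<lambda>s. climb f s p \<le> e / 2) (around p)) F"
    and x: "\<And>r. r \<in> J \<Longrightarrow> (xval f r \<longlongrightarrow> x r) F" "\<And>r. r \<in> J \<Longrightarrow> x r / jump f r \<in> {0..1}"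
      "\<And>r. r \<in> J \<Longrightarrow> eventually (\<lambda>p. xval f r p = x r \<longrightarrow> circ_continuous (\<Phi> (jump f r)) (xval f r p / jump f r)) F"
  shows "eventually (good J e) F"
proof -
  have "eventually (\<lambda>p. \<exists>\<theta>>0. \<forall>y\<in>{0..1}. \<bar>y - xval f r p / jump f r\<bar> < \<theta> \<longrightarrow>
      circ (\<Phi> (jump f r) y) (loop_pos \<Phi> f r p) \<le> e / 2) F" if r: "r \<in> J" for r
  proof -
    let ?\<phi> = "\<Phi> (jump f r)" and ?y = "x r / jump f r"
    have r1: "r \<in> {-1<..1}" "0 < jump f r" using J r by auto
    have "0 < e / 4" using e by simp
    obtain c \<theta> where c: "c \<in> {0..1}" and \<theta>: "0 < \<theta>" "\<And>y. y \<in> {0..1} \<Longrightarrow> \<bar>y - ?y\<bar> < \<theta> \<Longrightarrow>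
        (y \<le> ?y \<longrightarrow> circ (?\<phi> y) (?\<phi> ?y) < e / 4) \<and> (?y < y \<longrightarrow> circ (?\<phi> y) c < e / 4)"
      using caglad_circ_sides[OF shuffle_caglad[OF \<Phi> r1(2)] x(2)[OF r]] \<open>0 < e / 4\<close> by metis
    have "((\<lambda>p. xval f r p / jump f r) \<longlongrightarrow> ?y) F"
      using r1 by (intro tendsto_divide x(1)[OF r] tendsto_const) auto
    then have "eventually (\<lambda>p. dist (xval f r p / jump f r) ?y < \<theta>) F" using \<theta>(1) by (rule tendstoD)
    with ev(1) x(3)[OF r] show ?thesis
    proof eventually_elim
      case (elim p)
      let ?yp = "xval f r p / jump f r"
      have yp: "?yp \<in> {0..1}" by (intro xval_ratio sp r1 elim(1))
      show ?case
      proof (cases "xval f r p = x r")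
        case True
        then have "circ_continuous ?\<phi> ?yp" using elim(2) by simp
        from circ_continuousD[OF this, of "e / 2"] e show ?thesis
          unfolding loop_pos_def by (metis half_gt_zero less_imp_le)
      next
        case False
        then have ne: "?yp \<noteq> ?y" using r1(2) by simp
        \<comment> \<open>Keeps \<open>y\<close> within \<open>\<theta>\<close> of the limit
          position and on the same side of it as the position of \<open>p\<close>.\<close>
        define \<theta>' where "\<theta>' = min (\<theta> - \<bar>?yp - ?y\<bar>) \<bar>?yp - ?y\<bar>"
        have \<theta>': "0 < \<theta>'" using ne elim(3) by (auto simp: \<theta>'_def dist_real_def)
        have "circ (?\<phi> y) (?\<phi> ?yp) \<le> e / 2" if y: "y \<in> {0..1}" "\<bar>y - ?yp\<bar> < \<theta>'" for y
        proof -
          have rng: "?\<phi> y \<in> {0..1}" "?\<phi> ?yp \<in> {0..1}" "?\<phi> ?y \<in> {0..1}"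
            using shuffle_range[OF \<Phi> r1(2)] y(1) yp x(2)[OF r] by blast+
          have n: "\<bar>y - ?y\<bar> < \<theta>" "\<bar>?yp - ?y\<bar> < \<theta>" "\<bar>y - ?yp\<bar> < \<bar>?yp - ?y\<bar>"
            using y(2) elim(3) unfolding \<theta>'_def dist_real_def by linarith+
          show ?thesis
          proof (cases "?yp < ?y")
            case True
            then have "y \<le> ?y" using n(3) by linarith
            then have "circ (?\<phi> y) (?\<phi> ?y) < e / 4" "circ (?\<phi> ?yp) (?\<phi> ?y) < e / 4"
              using \<theta>(2)[OF y(1) n(1)] \<theta>(2)[OF yp n(2)] True by auto
            then show ?thesis using circ_triangle[OF rng(1) rng(3) rng(2)] circ_commute[of "?\<phi> ?yp" "?\<phi> ?y"] by linarith
          next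
            case False
            then have gt: "?y < ?yp" using ne by linarith
            then have "?y < y" using n(3) by linarith
            then have "circ (?\<phi> y) c < e / 4" "circ (?\<phi> ?yp) c < e / 4"
              using \<theta>(2)[OF y(1) n(1)] \<theta>(2)[OF yp n(2)] gt by auto
            then show ?thesis using circ_triangle[OF rng(1) c rng(2)] circ_commute[of "?\<phi> ?yp" c] by linarith
          qed
        qed
        then show ?thesis using \<theta>' unfolding loop_pos_def by blast
      qed
    qed
  qed
  then have "eventually (\<lambda>p. \<forall>r\<in>J. \<exists>\<theta>>0. \<forall>y\<in>{0..1}. \<bar>y - xval f r p / jump f r\<bar> < \<theta> \<longrightarrow>
      circ (\<Phi> (jump f r) y) (loop_pos \<Phi> f r p) \<le> e / 2) F"
    using J(1) by (simp add: eventually_ball_finite)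
  with ev climb show ?thesis
  proof eventually_elim
    case (elim p)
    show ?case by (rule goodI[OF J e elim(1,2,3)]) (use elim(4) in auto)
  qed
qed

text \<open>A time after \<open>s\<close> with the coordinate of \<open>s\<close> repeats this
  coordinate, so the shuffle is continuous at it. Every other case is covered by the one-sided
  limits.\<close>

lemma good_right:
  assumes J: "finite J" "J \<subseteq> {-1<..1}" "\<And>r. r \<in> J \<Longrightarrow> 0 < jump f r" and e: "0 < e" and s: "s \<in> {-1..<1}"
  shows "eventually (good J e) (at_right s)"
proof (rule good_eventually[OF J e])
  have s1: "s \<in> {-1..1}" using s by auto
  have ev: "eventually (\<lambda>p. p \<in> {s<..1}) (at_right s)"
    using s by (auto simp: eventually_at_right_field intro!: exI[of _ 1])
  then show "eventually (\<lambda>p. p \<in> {-1..1}) (at_right s)"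
    by eventually_elim (use s in auto)
  have "finite (J - {s})" using J by simp
  then have "open (- (J - {s}))" by (intro open_Compl finite_imp_closed)
  then have "eventually (\<lambda>p. p \<in> - (J - {s})) (nhds s)" by (intro eventually_nhds_in_open) auto
  then have "eventually (\<lambda>p. p \<in> - (J - {s})) (at_right s)" unfolding at_within_def by (rule filter_leD[OF inf_le1]) 
  with ev show "eventually (\<lambda>p. p \<notin> J) (at_right s)" by eventually_elim auto
  have "0 < e / 2" using e by simp
  then obtain d where d: "0 < d" "\<And>u v. u \<in> {s..<s + d} \<inter> {-1..1} \<Longrightarrow> v \<in> {s..<s + d} \<inter> {-1..1} \<Longrightarrow> climb f u v \<le> e / 2"
    using climb_right_small[OF sp_cadlag[OF sp] s1] by metis
  have "eventually (\<lambda>p. p \<in> {s<..<s+d}) (at_right s)"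
    using d(1) by (intro eventually_at_rightI[of _ "s + d"]) auto
  with ev show "eventually (\<lambda>p. eventually (\<lambda>u. climb f u p \<le> e / 2) (around p)) (at_right s)"
  proof eventually_elim
    case (elim p)
    show ?case
      unfolding eventually_around
    proof (intro exI[of _ "min (p - s) (s + d - p)"] conjI ballI impI)
      fix u assume "u \<in> {-1..1}" "\<bar>u - p\<bar> < min (p - s) (s + d - p)"
      then show "climb f u p \<le> e / 2" using elim s by (intro d(2)) auto
    qed (use elim in auto)
  qed
  fix r assume "r \<in> J"
  then have r: "r \<in> {-1<..1}" "0 < jump f r" using J by auto
  show "(xval f r \<longlongrightarrow> xval f r s) (at_right s)"
    using xval_tendsto_from_right[OF sp r(1) s1] at_right_le_from_right[of s] s by (auto intro: tendsto_mono)
  show "xval f r s / jump f r \<in> {0..1}" by (intro xval_ratio sp r s1)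
  show "eventually (\<lambda>p. xval f r p = xval f r s \<longrightarrow> circ_continuous (\<Phi> (jump f r)) (xval f r p / jump f r)) (at_right s)"
    using ev
  proof eventually_elim
    case (elim p)
    then show ?case using circ_continuous_repeated_or_0[OF r, of s p] s1 by auto
  qed
qed

text \<open>Attaining the left limit repeats the coordinate of \<open>s\<close>, except on the loop
  opened at \<open>s\<close> itself, where the limit is 0 and shuffles are continuous.\<close>

lemma good_left:
  assumes J: "finite J" "J \<subseteq> {-1<..1}" "\<And>r. r \<in> J \<Longrightarrow> 0 < jump f r" and e: "0 < e" and s: "s \<in> {-1<..1}"
  shows "eventually (good J e) (at_left s)"
proof (rule good_eventually[OF J e])
  have s1: "s \<in> {-1..1}" using s by auto
  have ev: "eventually (\<lambda>p. p \<in> {-1..<s}) (at_left s)"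
    using s by (auto simp: eventually_at_left_field intro!: exI[of _ "-1"])
  then show "eventually (\<lambda>p. p \<in> {-1..1}) (at_left s)"
    by eventually_elim (use s in auto)
  have "finite (J - {s})" using J by simp
  then have "open (- (J - {s}))" by (intro open_Compl finite_imp_closed)
  then have "eventually (\<lambda>p. p \<in> - (J - {s})) (nhds s)" by (intro eventually_nhds_in_open) auto
  then have "eventually (\<lambda>p. p \<in> - (J - {s})) (at_left s)" unfolding at_within_def by (rule filter_leD[OF inf_le1])
  with ev show "eventually (\<lambda>p. p \<notin> J) (at_left s)" by eventually_elim auto
  have "0 < e / 2" using e by simp
  then obtain d where d: "0 < d" "\<And>u v. u \<in> {s - d<..<s} \<inter> {-1..1} \<Longrightarrow> v \<in> {s - d<..<s} \<inter> {-1..1} \<Longrightarrow> climb f u v \<le> e / 2"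
    using climb_left_small[OF sp_cadlag[OF sp] s1] by metis
  have "eventually (\<lambda>p. p \<in> {s - d<..<s}) (at_left s)"
    using d(1) by (intro eventually_at_leftI[of "s - d"]) auto
  with ev show "eventually (\<lambda>p. eventually (\<lambda>u. climb f u p \<le> e / 2) (around p)) (at_left s)"
  proof eventually_elim
    case (elim p)
    show ?case
      unfolding eventually_around
    proof (intro exI[of _ "min (s - p) (p - (s - d))"] conjI ballI impI)
      fix u assume "u \<in> {-1..1}" "\<bar>u - p\<bar> < min (s - p) (p - (s - d))"
      then show "climb f u p \<le> e / 2" using elim s by (intro d(2)) auto
    qed (use elim in auto)
  qed
  fix r assume "r \<in> J"
  then have r: "r \<in> {-1<..1}" "0 < jump f r" using J by auto
  show "(xval f r \<longlongrightarrow> loop_limit_left r s) (at_left s)"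
    unfolding loop_limit_left_def by (rule xval_tendsto_left[OF sp r(1) s])
  show "loop_limit_left r s / jump f r \<in> {0..1}" by (intro loop_limit_left_ratio r s1)
  show "eventually (\<lambda>p. xval f r p = loop_limit_left r s \<longrightarrow> circ_continuous (\<Phi> (jump f r)) (xval f r p / jump f r)) (at_left s)"
    using ev
  proof eventually_elim
    case (elim p)
    show ?case
    proof (cases "r = s")
      case True
      then show ?thesis using circ_continuous_0[OF \<Phi> r(2)] by (simp add: loop_limit_left_def)
    next
      case False
      then show ?thesis
        using circ_continuous_repeated_or_0[OF r, of s p] s1 elim by (auto simp: loop_limit_left_def)
    qed
  qed
qed

end

text \<open>The limit from the right, or the value itself at continuity points (in particular at \<open>1\<close>).\<close>

definition right_value :: "(real \<Rightarrow> real) \<Rightarrow> real \<Rightarrow> real" where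
  "right_value \<phi> y = (SOME c. c \<in> {0..1} \<and> (circ_continuous \<phi> y \<longrightarrow> c = \<phi> y) \<and>
    (\<forall>e>0. \<exists>\<theta>>0. \<forall>y'\<in>{0..1}. \<bar>y' - y\<bar> < \<theta> \<longrightarrow>
      (y' \<le> y \<longrightarrow> circ (\<phi> y') (\<phi> y) < e) \<and> (y < y' \<longrightarrow> circ (\<phi> y') c < e)))"

lemma right_value:
  assumes "\<phi> \<in> caglad_circ" "y \<in> {0..1}"
  shows "right_value \<phi> y \<in> {0..1}" "circ_continuous \<phi> y \<Longrightarrow> right_value \<phi> y = \<phi> y"
    "\<And>e. 0 < e \<Longrightarrow> \<exists>\<theta>>0. \<forall>y'\<in>{0..1}. \<bar>y' - y\<bar> < \<theta> \<longrightarrow>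
      (y' \<le> y \<longrightarrow> circ (\<phi> y') (\<phi> y) < e) \<and> (y < y' \<longrightarrow> circ (\<phi> y') (right_value \<phi> y) < e)"
proof -
  let ?P = "\<lambda>c. c \<in> {0..1} \<and> (circ_continuous \<phi> y \<longrightarrow> c = \<phi> y) \<and>
    (\<forall>e>0. \<exists>\<theta>>0. \<forall>y'\<in>{0..1}. \<bar>y' - y\<bar> < \<theta> \<longrightarrow>
      (y' \<le> y \<longrightarrow> circ (\<phi> y') (\<phi> y) < e) \<and> (y < y' \<longrightarrow> circ (\<phi> y') c < e))"
  have "\<exists>c. ?P c" by (rule caglad_circ_sides[OF assms]) blast
  then have "?P (right_value \<phi> y)" unfolding right_value_def by (rule someI_ex)
  then show "right_value \<phi> y \<in> {0..1}" "circ_continuous \<phi> y \<Longrightarrow> right_value \<phi> y = \<phi> y"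
    "\<And>e. 0 < e \<Longrightarrow> \<exists>\<theta>>0. \<forall>y'\<in>{0..1}. \<bar>y' - y\<bar> < \<theta> \<longrightarrow>
      (y' \<le> y \<longrightarrow> circ (\<phi> y') (\<phi> y) < e) \<and> (y < y' \<longrightarrow> circ (\<phi> y') (right_value \<phi> y) < e)"
    by blast+
qed

context shuffled_excursion
begin

section \<open>Local nets\<close>

text \<open>Near the limit position a shuffle takes almost only two values. Which of them a nearby
  path sees may depend on the path, the time and the loop, so nothing better than a disjunction
  holds.\<close>

lemma loop_pos_alternatives:
  assumes J: "finite J" "J \<subseteq> {-1<..1}" "\<And>r. r \<in> J \<Longrightarrow> 0 < jump f r" and e: "0 < e"
    and ev: "eventually (\<lambda>s. s \<in> {-1..1}) F"
    and x: "\<And>r. r \<in> J \<Longrightarrow> (xval f r \<longlongrightarrow> x r) F" "\<And>r. r \<in> J \<Longrightarrow> x r / jump f r \<in> {0..1}"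
    and c: "\<And>r. r \<in> J \<Longrightarrow> c r \<in> {0..1}"
      "\<And>r e. r \<in> J \<Longrightarrow> 0 < e \<Longrightarrow> \<exists>\<theta>>0. \<forall>y\<in>{0..1}. \<bar>y - x r / jump f r\<bar> < \<theta> \<longrightarrow>
        (y \<le> x r / jump f r \<longrightarrow> circ (\<Phi> (jump f r) y) (\<Phi> (jump f r) (x r / jump f r)) < e) \<and>
        (x r / jump f r < y \<longrightarrow> circ (\<Phi> (jump f r) y) (c r) < e)"
  shows "\<exists>\<rho>>0. eventually (\<lambda>s. \<forall>g. close_path \<rho> f g \<longrightarrow> (\<forall>r\<in>J.
    circ (loop_pos \<Phi> g r s) (\<Phi> (jump f r) (x r / jump f r)) \<le> 2 * e \<or>
    circ (loop_pos \<Phi> g r s) (c r) \<le> 2 * e)) F"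
proof (rule uniform_ball_finite[OF J(1)])
  fix r assume r: "r \<in> J"
  then have r1: "r \<in> {-1<..1}" "0 < jump f r" using J by auto
  let ?\<phi> = "\<Phi> (jump f r)" and ?y = "x r / jump f r"
  obtain \<theta> where \<theta>: "0 < \<theta>" "\<And>y. y \<in> {0..1} \<Longrightarrow> \<bar>y - ?y\<bar> < \<theta> \<Longrightarrow>
      (y \<le> ?y \<longrightarrow> circ (?\<phi> y) (?\<phi> ?y) < e) \<and> (?y < y \<longrightarrow> circ (?\<phi> y) (c r) < e)"
    using c(2)[OF r e] by blast
  obtain \<rho> where \<rho>: "0 < \<rho>" "eventually (\<lambda>s. \<forall>g. close_path \<rho> f g \<longrightarrow>
      (\<exists>y\<in>{0..1}. \<bar>y - ?y\<bar> < \<theta> \<and> circ (loop_pos \<Phi> g r s) (?\<phi> y) < e)) F"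
    using loop_pos_transfer[OF \<Phi> sp r1 skorokhod_tendsto[OF r1] ev x(1)[OF r] e \<theta>(1)] by blast
  define \<rho>' where "\<rho>' = min \<rho> (jump f r / 3)"
  have \<rho>': "0 < \<rho>'" "\<rho>' \<le> \<rho>" "2 * \<rho>' < jump f r" using \<rho>(1) r1(2) by (auto simp: \<rho>'_def min_def)
  have "eventually (\<lambda>s. \<forall>g. close_path \<rho>' f g \<longrightarrow>
    circ (loop_pos \<Phi> g r s) (?\<phi> ?y) \<le> 2 * e \<or> circ (loop_pos \<Phi> g r s) (c r) \<le> 2 * e) F"
    using ev \<rho>(2)
  proof eventually_elim
    case (elim s)
    show ?case
    proof (intro allI impI)
      fix g assume g: "close_path \<rho>' f g"
      note gD = close_pathD[OF g]
      obtain y where y: "y \<in> {0..1}" "\<bar>y - ?y\<bar> < \<theta>" "circ (loop_pos \<Phi> g r s) (?\<phi> y) < e"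
        using elim close_path_mono[OF g \<rho>'(2)] by blast
      have "\<bar>jump g r - jump f r\<bar> \<le> 2 * \<rho>'" by (intro jump_close sp_cadlag gD sp r1)
      then have jg: "0 < jump g r" using \<rho>' by linarith
      have rng: "loop_pos \<Phi> g r s \<in> {0..1}" by (intro loop_pos_range[OF \<Phi>] gD r1 elim jg)
      have rng': "?\<phi> y \<in> {0..1}" "?\<phi> ?y \<in> {0..1}"
        using shuffle_range[OF \<Phi> r1(2)] y(1) x(2)[OF r] by blast+
      show "circ (loop_pos \<Phi> g r s) (?\<phi> ?y) \<le> 2 * e \<or> circ (loop_pos \<Phi> g r s) (c r) \<le> 2 * e"
        using circ_triangle[OF rng rng'(1) rng'(2)] circ_triangle[OF rng rng'(1) c(1)[OF r]] y(3) \<theta>(2)[OF y(1,2)]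
        by linarith
    qed
  qed
  with \<rho>'(1) show "\<exists>\<rho>>0. eventually (\<lambda>s. \<forall>g. close_path \<rho> f g \<longrightarrow>
    circ (loop_pos \<Phi> g r s) (?\<phi> ?y) \<le> 2 * e \<or> circ (loop_pos \<Phi> g r s) (c r) \<le> 2 * e) F" by blast
qed

text \<open>Unlike in \<open>good\<close>, both positions lie on the loop of \<open>g\<close>. The
  bound \<open>4 * e\<close> is the length of the chain in \<open>near_pointI\<close>:
  \<open>2 * e\<close> to a reference point, \<open>e\<close> to the position of \<open>p\<close>
  under \<open>f\<close>, and \<open>e\<close> back to \<open>g\<close>.\<close>

definition near_point :: "real set \<Rightarrow> real \<Rightarrow> (real \<Rightarrow> real) \<Rightarrow> real \<Rightarrow> real \<Rightarrow> bool" where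
  "near_point J e g s p \<longleftrightarrow> climb g s p \<le> e \<and>
    (\<forall>r\<in>J. circ (loop_pos \<Phi> g r s) (loop_pos \<Phi> g r p) \<le> 4 * e)"

lemma near_pointI:
  assumes J: "finite J" "J \<subseteq> {-1<..1}" "\<And>r. r \<in> J \<Longrightarrow> 0 < jump g r" "\<And>r. r \<in> J \<Longrightarrow> 0 < jump f r"
    and g: "spectrally_positive g" and st: "s \<in> {-1..1}" "p \<in> {-1..1}"
    and a: "\<And>r. r \<in> J \<Longrightarrow> a r \<in> {0..1}" "\<And>r. r \<in> J \<Longrightarrow> circ (loop_pos \<Phi> g r s) (a r) \<le> 2 * e"
    and p: "\<And>r. r \<in> J \<Longrightarrow> circ (loop_pos \<Phi> f r p) (a r) \<le> e" "\<And>r. r \<in> J \<Longrightarrow> circ (loop_pos \<Phi> g r p) (loop_pos \<Phi> f r p) \<le> e"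
    and climb: "climb g s p \<le> e"
  shows "near_point J e g s p"
  unfolding near_point_def
proof (intro conjI ballI climb)
  fix r assume r: "r \<in> J"
  then have r1: "r \<in> {-1<..1}" using J by auto
  have rng: "loop_pos \<Phi> g r s \<in> {0..1}" "loop_pos \<Phi> g r p \<in> {0..1}" "loop_pos \<Phi> f r p \<in> {0..1}"
    by (intro loop_pos_range[OF \<Phi>] g sp r1 st J r)+
  show "circ (loop_pos \<Phi> g r s) (loop_pos \<Phi> g r p) \<le> 4 * e"
    using circ_triangle[OF rng(1) a(1)[OF r] rng(2)] circ_triangle[OF a(1)[OF r] rng(3) rng(2)]
      a(2)[OF r] p(1)[OF r] p(2)[OF r] circ_commute[of "a r" "loop_pos \<Phi> f r p"]
      circ_commute[of "loop_pos \<Phi> g r p" "loop_pos \<Phi> f r p"] by linarith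
qed

lemma good_self:
  assumes "good J e p" "p \<in> {-1..1}"
  obtains \<rho> where "0 < \<rho>"
    "\<And>g r. close_path \<rho> f g \<Longrightarrow> r \<in> J \<Longrightarrow> circ (loop_pos \<Phi> g r p) (loop_pos \<Phi> f r p) \<le> e"
proof -
  obtain \<rho> where \<rho>: "0 < \<rho>" "eventually (\<lambda>s. \<forall>g. close_path \<rho> f g \<longrightarrow>
     climb g s p \<le> e \<and> (\<forall>r\<in>J. circ (loop_pos \<Phi> g r s) (loop_pos \<Phi> f r p) \<le> e)) (around p)"
    using assms(1) unfolding good_def by blast
  have "\<forall>g. close_path \<rho> f g \<longrightarrow> climb g p p \<le> e \<and> (\<forall>r\<in>J. circ (loop_pos \<Phi> g r p) (loop_pos \<Phi> f r p) \<le> e)"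
    using \<rho>(2) assms(2) unfolding eventually_around by auto
  then show ?thesis using that \<rho>(1) by blast
qed

lemma jumps_positive:
  assumes J: "finite J" "J \<subseteq> {-1<..1}" "\<And>r. r \<in> J \<Longrightarrow> 0 < jump f r"
  obtains \<rho> where "0 < \<rho>" "\<And>g r. close_path \<rho> f g \<Longrightarrow> r \<in> J \<Longrightarrow> 0 < jump g r"
proof -
  \<comment> \<open>The jumps change by at most \<open>2 * \<rho>\<close>, less than any jump of
    \<open>f\<close> in \<open>J\<close>; the inserted 1 covers an empty \<open>J\<close>.\<close>
  define \<rho> where "\<rho> = Min (insert 1 (jump f ` J)) / 3"
  have "0 < Min (insert 1 (jump f ` J))" using J by (subst Min_gr_iff) auto
  then have pos: "0 < \<rho>" by (simp add: \<rho>_def)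
  have "0 < jump g r" if g: "close_path \<rho> f g" and r: "r \<in> J" for g r
  proof -
    have "Min (insert 1 (jump f ` J)) \<le> jump f r" using J r by (intro Min_le) auto
    then have "3 * \<rho> \<le> jump f r" by (simp add: \<rho>_def)
    moreover have "\<bar>jump g r - jump f r\<bar> \<le> 2 * \<rho>"
      using J r by (intro jump_close sp_cadlag close_pathD[OF g] sp) auto
    ultimately show ?thesis using pos by linarith
  qed
  then show ?thesis using that pos by blast
qed

lemma net_local_good:
  assumes J: "finite J" "J \<subseteq> {-1<..1}" "\<And>r. r \<in> J \<Longrightarrow> 0 < jump f r" and e: "0 < e"
    and s: "s \<in> {-1..1}" "good J e s"
  shows "\<exists>\<rho>>0. eventually (\<lambda>t. \<forall>g. close_path \<rho> f g \<longrightarrow> near_point J e g t s) (around s)"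
proof -
  obtain \<rho>1 where \<rho>1: "0 < \<rho>1" "eventually (\<lambda>t. \<forall>g. close_path \<rho>1 f g \<longrightarrow>
     climb g t s \<le> e \<and> (\<forall>r\<in>J. circ (loop_pos \<Phi> g r t) (loop_pos \<Phi> f r s) \<le> e)) (around s)"
    using s(2) unfolding good_def by blast
  obtain \<rho>2 where \<rho>2: "0 < \<rho>2" "\<And>g r. close_path \<rho>2 f g \<Longrightarrow> r \<in> J \<Longrightarrow> 0 < jump g r"
    using jumps_positive[OF J] by metis
  obtain \<rho>3 where \<rho>3: "0 < \<rho>3" "\<And>g r. close_path \<rho>3 f g \<Longrightarrow> r \<in> J \<Longrightarrow> circ (loop_pos \<Phi> g r s) (loop_pos \<Phi> f r s) \<le> e"
    using good_self[OF s(2,1)] by metis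
  define \<rho> where "\<rho> = min \<rho>1 (min \<rho>2 \<rho>3)"
  have ev: "eventually (\<lambda>t. t \<in> {-1..1}) (around s)"
    unfolding eventually_around by (intro exI[of _ 1]) auto
  have "eventually (\<lambda>t. \<forall>g. close_path \<rho> f g \<longrightarrow> near_point J e g t s) (around s)"
    using ev \<rho>1(2)
  proof eventually_elim
    case (elim t)
    show ?case
    proof (intro allI impI)
      fix g assume g: "close_path \<rho> f g"
      have g1: "close_path \<rho>1 f g" "close_path \<rho>2 f g" "close_path \<rho>3 f g"
        by (rule close_path_mono[OF g], simp add: \<rho>_def)+
      have a: "climb g t s \<le> e" "\<And>r. r \<in> J \<Longrightarrow> circ (loop_pos \<Phi> g r t) (loop_pos \<Phi> f r s) \<le> e"
        using elim(2) g1(1) by blast+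
      show "near_point J e g t s"
      proof (rule near_pointI[OF J(1,2) \<rho>2(2)[OF g1(2)] J(3) close_pathD(1)[OF g] elim(1) s(1), of "\<lambda>r. loop_pos \<Phi> f r s"])
        fix r assume r: "r \<in> J"
        show "loop_pos \<Phi> f r s \<in> {0..1}" using J r by (intro loop_pos_range[OF \<Phi> sp] s) auto
        show "circ (loop_pos \<Phi> g r t) (loop_pos \<Phi> f r s) \<le> 2 * e" using a(2)[OF r] e by linarith
        show "circ (loop_pos \<Phi> f r s) (loop_pos \<Phi> f r s) \<le> e" using e by simp
        show "circ (loop_pos \<Phi> g r s) (loop_pos \<Phi> f r s) \<le> e" by (rule \<rho>3(2)[OF g1(3) r])
      qed (use a in auto)
    qed
  qed
  moreover have "0 < \<rho>" using \<rho>1(1) \<rho>2(1) \<rho>3(1) by (simp add: \<rho>_def)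
  ultimately show ?thesis by blast
qed

text \<open>Either all loops of \<open>J\<close> are continuous at the position of \<open>s\<close>, and each side of \<open>s\<close> has its own
  point, or exactly one is not; then \<open>f\<close> is continuous at \<open>s\<close> and the side on which \<open>g\<close> lies with
  respect to the discontinuity, rather than to \<open>s\<close>, decides between the two points.\<close>

lemma net_local_interior:
  assumes J: "finite J" "J \<subseteq> {-1<..1}" "\<And>r. r \<in> J \<Longrightarrow> 0 < jump f r" and e: "0 < e"
    and s: "s \<in> {-1<..<1}"
  shows "\<exists>P \<rho>. finite P \<and> P \<subseteq> {-1..1} \<and> (\<forall>p\<in>P. good J e p) \<and> 0 < \<rho> \<and>
    eventually (\<lambda>t. \<forall>g. close_path \<rho> f g \<longrightarrow> (\<exists>p\<in>P. near_point J e g t p)) (around s)"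
proof -
  have s1: "s \<in> {-1..1}" "s \<in> {-1<..1}" "s \<in> {-1..<1}" using s by auto
  define C where "C r y = right_value (\<Phi> (jump f r)) y" for r y
  note C = right_value[OF shuffle_caglad[OF \<Phi> J(3)], folded C_def]
  define yR where "yR r = xval f r s / jump f r" for r
  define yL where "yL r = loop_limit_left r s / jump f r" for r
  \<comment> \<open>After \<open>s\<close> the coordinates of \<open>f\<close> lie at or below their
    limit and see the value of the shuffle; before \<open>s\<close> they lie at or above it and see
    the right value.\<close>
  define aR where "aR r = \<Phi> (jump f r) (yR r)" for r
  define aL where "aL r = C r (yL r)" for r
  have yR: "yR r \<in> {0..1}" if "r \<in> J" for r
    unfolding yR_def using that J by (intro xval_ratio sp s1) auto
  have yL: "yL r \<in> {0..1}" if "r \<in> J" for r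
    unfolding yL_def using that J by (intro loop_limit_left_ratio s1) auto
  have aR: "aR r \<in> {0..1}" if "r \<in> J" for r
    unfolding aR_def using shuffle_range[OF \<Phi> J(3)[OF that] yR[OF that]] .
  have aL: "aL r \<in> {0..1}" if "r \<in> J" for r
    unfolding aL_def by (rule C(1)[OF that yL[OF that]])
  have evR: "eventually (\<lambda>t. t \<in> {-1..1}) (from_right s)"
    using s unfolding eventually_from_right by (intro exI[of _ 1]) auto
  have evL: "eventually (\<lambda>t. t \<in> {-1..<s}) (at_left s)"
    using s by (auto simp: eventually_at_left_field intro!: exI[of _ "-1"])
  then have evL': "eventually (\<lambda>t. t \<in> {-1..1}) (at_left s)" by eventually_elim (use s in auto)
  have "0 < e / 2" using e by simp
  obtain dR where dR: "0 < dR" "\<And>u v. u \<in> {s..<s + dR} \<inter> {-1..1} \<Longrightarrow> v \<in> {s..<s + dR} \<inter> {-1..1} \<Longrightarrow> climb f u v \<le> e / 2"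
    using climb_right_small[OF sp_cadlag[OF sp] s1(1) \<open>0 < e / 2\<close>] by metis
  obtain dL where dL: "0 < dL" "\<And>u v. u \<in> {s - dL<..<s} \<inter> {-1..1} \<Longrightarrow> v \<in> {s - dL<..<s} \<inter> {-1..1} \<Longrightarrow> climb f u v \<le> e / 2"
    using climb_left_small[OF sp_cadlag[OF sp] s1(1) \<open>0 < e / 2\<close>] by metis
  obtain d0 where d0: "0 < d0" "\<And>u v. jump f s = 0 \<Longrightarrow> u \<in> {s - d0<..<s + d0} \<inter> {-1..1} \<Longrightarrow>
      v \<in> {s - d0<..<s + d0} \<inter> {-1..1} \<Longrightarrow> climb f u v \<le> e / 2"
  proof (cases "jump f s = 0")
    case True
    then show ?thesis
      using climb_two_sided_small[OF sp_cadlag[OF sp] s1(1) _ \<open>0 < e / 2\<close>] that by metis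
  qed (use that[of 1] in auto)
  define d where "d = min dR (min dL d0)"
  have d: "0 < d" "d \<le> dR" "d \<le> dL" "d \<le> d0" using dR(1) dL(1) d0(1) by (auto simp: d_def)
  have loopR: "eventually (\<lambda>p. \<forall>r\<in>J. circ (loop_pos \<Phi> f r p) (aR r) \<le> e) (at_right s)"
  proof (rule eventually_ball_finite[OF J(1)], rule ballI)
    fix r assume r: "r \<in> J"
    then have r1: "r \<in> {-1<..1}" "0 < jump f r" using J by auto
    have ev: "eventually (\<lambda>u. u \<in> {s<..1}) (at_right s)"
      using s by (auto simp: eventually_at_right_field intro!: exI[of _ 1])
    then have ev1: "eventually (\<lambda>u. u \<in> {-1..1}) (at_right s)" by eventually_elim (use s in auto)
    have x: "(xval f r \<longlongrightarrow> xval f r s) (at_right s)"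
      using xval_tendsto_from_right[OF sp r1(1) s1(1)] at_right_le_from_right[of s] s by (auto intro: tendsto_mono)
    have "eventually (\<lambda>u. xval f r u \<le> xval f r s) (at_right s)"
    proof (cases "r \<le> s")
      case True
      show ?thesis using ev by eventually_elim (use True r1 in \<open>auto intro!: xval_antimono sp\<close>)
    next
      case False
      then have "eventually (\<lambda>u. u < r) (at_right s)"
        by (auto simp: eventually_at_right_field intro!: exI[of _ r])
      then show ?thesis by eventually_elim (simp add: xval_less)
    qed
    then have "((\<lambda>u. circ (loop_pos \<Phi> f r u) (loop_pos \<Phi> f r s)) \<longlongrightarrow> 0) (at_right s)"
      by (intro circ_loop_pos_tendsto[OF \<Phi> sp r1 s1(1) ev1 x]) simp
    then have "eventually (\<lambda>u. circ (loop_pos \<Phi> f r u) (loop_pos \<Phi> f r s) < e) (at_right s)"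
      using e by (rule order_tendstoD(2))
    then show "eventually (\<lambda>u. circ (loop_pos \<Phi> f r u) (aR r) \<le> e) (at_right s)"
      unfolding aR_def yR_def loop_pos_def by eventually_elim simp
  qed
  have loopL: "eventually (\<lambda>p. \<forall>r\<in>J. circ (loop_pos \<Phi> f r p) (aL r) \<le> e) (at_left s)"
  proof (rule eventually_ball_finite[OF J(1)], rule ballI)
    fix r assume r: "r \<in> J"
    then have r1: "r \<in> {-1<..1}" "0 < jump f r" using J by auto
    obtain \<theta> where \<theta>: "0 < \<theta>" "\<And>y'. y' \<in> {0..1} \<Longrightarrow> \<bar>y' - yL r\<bar> < \<theta> \<Longrightarrow> yL r < y' \<Longrightarrow>
        circ (\<Phi> (jump f r) y') (aL r) < e"
      using C(3)[OF r yL[OF r] e] unfolding aL_def by blast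
    have x: "(xval f r \<longlongrightarrow> loop_limit_left r s) (at_left s)"
      unfolding loop_limit_left_def by (rule xval_tendsto_left[OF sp r1(1) s1(2)])
    have "((\<lambda>u. xval f r u / jump f r) \<longlongrightarrow> yL r) (at_left s)"
      unfolding yL_def using r1 by (intro tendsto_divide x tendsto_const) auto
    then have "eventually (\<lambda>u. dist (xval f r u / jump f r) (yL r) < \<theta>) (at_left s)" using \<theta>(1) by (rule tendstoD)
    moreover have "eventually (\<lambda>u. r \<le> u \<or> s \<le> r) (at_left s)"
    proof (cases "r < s")
      case True
      then have "eventually (\<lambda>u. u \<in> {r<..<s}) (at_left s)" by (intro eventually_at_leftI[of r]) auto
      then show ?thesis by eventually_elim auto
    qed simp
    ultimately show "eventually (\<lambda>u. circ (loop_pos \<Phi> f r u) (aL r) \<le> e) (at_left s)"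
      using evL
    proof eventually_elim
      case (elim u)
      have u: "u \<in> {-1..1}" using elim(3) s by auto
      let ?y = "xval f r u / jump f r"
      have y: "?y \<in> {0..1}" by (intro xval_ratio sp r1 u)
      have "loop_limit_left r s \<le> xval f r u"
        using elim s r1 by (intro loop_limit_left_le) auto
      then have "yL r \<le> ?y" unfolding yL_def using r1 by (intro divide_right_mono) auto
      then consider "yL r < ?y" | "?y = yL r" by linarith
      then show ?case
      proof cases
        case 1
        then show ?thesis using \<theta>(2)[OF y _ 1] elim(1) unfolding loop_pos_def dist_real_def by simp
      next
        case 2
        \<comment> \<open>A coordinate equal to its left limit is repeated or 0, so the right value
          agrees with the value of the shuffle.\<close>
        have "circ_continuous (\<Phi> (jump f r)) (yL r)"
        proof (cases "r = s")
          case True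
          then show ?thesis using circ_continuous_0[OF \<Phi> r1(2)] by (simp add: yL_def loop_limit_left_def)
        next
          case False
          then have "xval f r s = xval f r u"
            using 2 r1(2) by (simp add: yL_def loop_limit_left_def)
          then show ?thesis
            using circ_continuous_repeated_or_0[OF r1 s1(1) u] elim(3) 2 by auto
        qed
        then have "aL r = \<Phi> (jump f r) ?y" using C(2)[OF r yL[OF r]] 2 by (simp add: aL_def)
        then show ?thesis using e by (simp add: loop_pos_def)
      qed
    qed
  qed
  have "eventually (\<lambda>p. good J e p \<and> (\<forall>r\<in>J. circ (loop_pos \<Phi> f r p) (aR r) \<le> e) \<and> p \<in> {s<..<min 1 (s + d)}) (at_right s)"
    using s d(1) by (intro eventually_conj[OF good_right[OF J e s1(3)]] eventually_conj[OF loopR] eventually_at_rightI[of s "min 1 (s + d)"]) auto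
  then obtain pR where pR: "good J e pR" "\<And>r. r \<in> J \<Longrightarrow> circ (loop_pos \<Phi> f r pR) (aR r) \<le> e" "s < pR" "pR < 1" "pR < s + d"
    using eventually_happens'[OF trivial_limit_at_right_real] by fastforce
  have "eventually (\<lambda>p. good J e p \<and> (\<forall>r\<in>J. circ (loop_pos \<Phi> f r p) (aL r) \<le> e) \<and> p \<in> {max (-1) (s - d)<..<s}) (at_left s)"
    using s d(1) by (intro eventually_conj[OF good_left[OF J e s1(2)]] eventually_conj[OF loopL] eventually_at_leftI[of "max (-1) (s - d)" s]) auto
  then obtain pL where pL: "good J e pL" "\<And>r. r \<in> J \<Longrightarrow> circ (loop_pos \<Phi> f r pL) (aL r) \<le> e" "pL < s" "-1 < pL" "s - d < pL"
    using eventually_happens'[OF trivial_limit_at_left_real] by fastforce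
  have p1: "pR \<in> {-1..1}" "pL \<in> {-1..1}" using pR pL s by auto
  obtain \<rho>1 where \<rho>1: "0 < \<rho>1" "\<And>g r. close_path \<rho>1 f g \<Longrightarrow> r \<in> J \<Longrightarrow> circ (loop_pos \<Phi> g r pR) (loop_pos \<Phi> f r pR) \<le> e"
    using good_self[OF pR(1) p1(1)] by metis
  obtain \<rho>2 where \<rho>2: "0 < \<rho>2" "\<And>g r. close_path \<rho>2 f g \<Longrightarrow> r \<in> J \<Longrightarrow> circ (loop_pos \<Phi> g r pL) (loop_pos \<Phi> f r pL) \<le> e"
    using good_self[OF pL(1) p1(2)] by metis
  obtain \<rho>3 where \<rho>3: "0 < \<rho>3" "\<And>g r. close_path \<rho>3 f g \<Longrightarrow> r \<in> J \<Longrightarrow> 0 < jump g r"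
    using jumps_positive[OF J] by metis
  have "\<exists>\<rho>>0. eventually (\<lambda>t. \<forall>g. close_path \<rho> f g \<longrightarrow> (\<forall>r\<in>J.
    circ (loop_pos \<Phi> g r t) (aR r) \<le> 2 * e \<or> circ (loop_pos \<Phi> g r t) (C r (yR r)) \<le> 2 * e)) (from_right s)"
    unfolding aR_def yR_def
    by (rule loop_pos_alternatives[OF J e evR xval_tendsto_from_right[OF sp _ s1(1)] yR[unfolded yR_def]
        C(1)[OF _ yR[unfolded yR_def]] C(3)[OF _ yR[unfolded yR_def]]]) (use J in auto)
  then obtain \<rho>4 where \<rho>4: "0 < \<rho>4" "eventually (\<lambda>t. \<forall>g. close_path \<rho>4 f g \<longrightarrow> (\<forall>r\<in>J.
    circ (loop_pos \<Phi> g r t) (aR r) \<le> 2 * e \<or> circ (loop_pos \<Phi> g r t) (C r (yR r)) \<le> 2 * e)) (from_right s)"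
    by blast
  have "\<exists>\<rho>>0. eventually (\<lambda>t. \<forall>g. close_path \<rho> f g \<longrightarrow> (\<forall>r\<in>J.
    circ (loop_pos \<Phi> g r t) (\<Phi> (jump f r) (yL r)) \<le> 2 * e \<or> circ (loop_pos \<Phi> g r t) (aL r) \<le> 2 * e)) (at_left s)"
    unfolding aL_def yL_def
    by (rule loop_pos_alternatives[OF J e evL' xval_tendsto_left[OF sp _ s1(2), folded loop_limit_left_def] yL[unfolded yL_def]
        C(1)[OF _ yL[unfolded yL_def]] C(3)[OF _ yL[unfolded yL_def]]]) (use J in auto)
  then obtain \<rho>5 where \<rho>5: "0 < \<rho>5" "eventually (\<lambda>t. \<forall>g. close_path \<rho>5 f g \<longrightarrow> (\<forall>r\<in>J.
    circ (loop_pos \<Phi> g r t) (\<Phi> (jump f r) (yL r)) \<le> 2 * e \<or> circ (loop_pos \<Phi> g r t) (aL r) \<le> 2 * e)) (at_left s)"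
    by blast
  define \<rho> where "\<rho> = min (e / 8) (min \<rho>1 (min \<rho>2 (min \<rho>3 (min \<rho>4 \<rho>5))))"
  have \<rho>: "0 < \<rho>" "\<rho> \<le> e / 8" "\<rho> \<le> \<rho>1" "\<rho> \<le> \<rho>2" "\<rho> \<le> \<rho>3" "\<rho> \<le> \<rho>4" "\<rho> \<le> \<rho>5"
    using e \<rho>1(1) \<rho>2(1) \<rho>3(1) \<rho>4(1) \<rho>5(1) by (auto simp: \<rho>_def)
  have nearR: "near_point J e g t pR"
    if "close_path \<rho> f g" "t \<in> {-1..1}" "climb f t pR \<le> e / 2" "\<And>r. r \<in> J \<Longrightarrow> circ (loop_pos \<Phi> g r t) (aR r) \<le> 2 * e" for g t
    by (rule near_pointI[OF J(1,2) \<rho>3(2)[OF close_path_mono[OF that(1) \<rho>(5)]] J(3) close_pathD(1)[OF that(1)] that(2) p1(1) aR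
        that(4) pR(2) \<rho>1(2)[OF close_path_mono[OF that(1) \<rho>(3)]] climb_transfer[OF that(1) \<rho>(2) that(2) p1(1) that(3)]])
  have nearL: "near_point J e g t pL"
    if "close_path \<rho> f g" "t \<in> {-1..1}" "climb f t pL \<le> e / 2" "\<And>r. r \<in> J \<Longrightarrow> circ (loop_pos \<Phi> g r t) (aL r) \<le> 2 * e" for g t
    by (rule near_pointI[OF J(1,2) \<rho>3(2)[OF close_path_mono[OF that(1) \<rho>(5)]] J(3) close_pathD(1)[OF that(1)] that(2) p1(2) aL
        that(4) pL(2) \<rho>2(2)[OF close_path_mono[OF that(1) \<rho>(4)]] climb_transfer[OF that(1) \<rho>(2) that(2) p1(2) that(3)]])
  have dR': "eventually (\<lambda>t. t \<in> {s..<s + d}) (from_right s)"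
    unfolding eventually_from_right using d(1) by (intro exI[of _ d]) auto
  have dL': "eventually (\<lambda>t. t \<in> {s - d<..<s}) (at_left s)"
    using d(1) by (intro eventually_at_leftI[of "s - d"]) auto
  have "eventually (\<lambda>t. \<forall>g. close_path \<rho> f g \<longrightarrow> (\<exists>p\<in>{pR, pL}. near_point J e g t p)) (around s)"
  proof (cases "\<forall>r\<in>J. circ_continuous (\<Phi> (jump f r)) (yR r)")
    case True
    have CR: "C r (yR r) = aR r" if "r \<in> J" for r
      using C(2)[OF that yR[OF that]] True that by (simp add: aR_def)
    have CL: "\<Phi> (jump f r) (yL r) = aL r" if r: "r \<in> J" for r
    proof -
      have "circ_continuous (\<Phi> (jump f r)) (yL r)"
      proof (cases "r = s")
        case True
        then show ?thesis using circ_continuous_0[OF \<Phi> J(3)[OF r]] by (simp add: yL_def loop_limit_left_def)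
      next
        case False
        then show ?thesis using True r by (simp add: yL_def yR_def loop_limit_left_def)
      qed
      then show ?thesis using C(2)[OF r yL[OF r]] by (simp add: aL_def)
    qed
    show ?thesis
    proof (rule eventually_around_sides)
      show "eventually (\<lambda>t. \<forall>g. close_path \<rho> f g \<longrightarrow> (\<exists>p\<in>{pR, pL}. near_point J e g t p)) (from_right s)"
        using evR dR' \<rho>4(2)
      proof eventually_elim
        case (elim t)
        show ?case
        proof (intro allI impI)
          fix g assume g: "close_path \<rho> f g"
          have "near_point J e g t pR"
          proof (rule nearR[OF g elim(1)])
            show "climb f t pR \<le> e / 2" using elim(1,2) pR p1 d by (intro dR(2)) auto
            show "circ (loop_pos \<Phi> g r t) (aR r) \<le> 2 * e" if "r \<in> J" for r
              using elim(3)[rule_format, OF close_path_mono[OF g \<rho>(6)] that] CR[OF that] by simp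
          qed
          then show "\<exists>p\<in>{pR, pL}. near_point J e g t p" by blast
        qed
      qed
      show "eventually (\<lambda>t. \<forall>g. close_path \<rho> f g \<longrightarrow> (\<exists>p\<in>{pR, pL}. near_point J e g t p)) (at_left s)"
        using evL' dL' \<rho>5(2)
      proof eventually_elim
        case (elim t)
        show ?case
        proof (intro allI impI)
          fix g assume g: "close_path \<rho> f g"
          have "near_point J e g t pL"
          proof (rule nearL[OF g elim(1)])
            show "climb f t pL \<le> e / 2" using elim(1,2) pL p1 d by (intro dL(2)) auto
            show "circ (loop_pos \<Phi> g r t) (aL r) \<le> 2 * e" if "r \<in> J" for r
              using elim(3)[rule_format, OF close_path_mono[OF g \<rho>(7)] that] CL[OF that] by simp
          qed
          then show "\<exists>p\<in>{pR, pL}. near_point J e g t p" by blast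
        qed
      qed
    qed
  next
    case False
    then obtain r0 where r0: "r0 \<in> J" "\<not> circ_continuous (\<Phi> (jump f r0)) (xval f r0 s / jump f r0)"
      by (auto simp: yR_def)
    then have r01: "r0 \<in> {-1<..1}" "0 < jump f r0" using J by auto
    have j0: "jump f s = 0" by (rule discontinuity_no_jump(3)[OF r01 s r0(2)])
    have yy: "yL r = yR r" if "r \<in> J" for r
    proof -
      have "r \<noteq> s" using J(3)[OF that] j0 by auto
      then show ?thesis by (simp add: yL_def yR_def loop_limit_left_def)
    qed
    have same: "aR r = aL r" if r: "r \<in> J" "r \<noteq> r0" for r
    proof -
      have r1: "r \<in> {-1<..1}" "0 < jump f r" using J r by auto
      have "circ_continuous (\<Phi> (jump f r)) (yR r)"
        using discontinuity_unique[OF r1 r01 s _ r0(2)] r(2) by (auto simp: yR_def)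
      then show ?thesis using C(2)[OF r(1) yR[OF r(1)]] yy[OF r(1)] by (simp add: aR_def aL_def)
    qed
    \<comment> \<open>On all loops but \<open>r0\<close> the two reference points coincide, so the
      alternative on \<open>r0\<close> alone selects the net point. It may lie on the other side of
      \<open>s\<close>, which costs little climb because \<open>f\<close> does not jump at
      \<open>s\<close>.\<close>
    have two: "\<exists>p\<in>{pR, pL}. near_point J e g t p"
      if g: "close_path \<rho> f g" and t: "t \<in> {-1..1}" "t \<in> {s - d<..<s + d}"
        and alt: "\<And>r. r \<in> J \<Longrightarrow> circ (loop_pos \<Phi> g r t) (aR r) \<le> 2 * e \<or> circ (loop_pos \<Phi> g r t) (aL r) \<le> 2 * e" for g t
    proof (cases "circ (loop_pos \<Phi> g r0 t) (aR r0) \<le> 2 * e")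
      case True
      have "near_point J e g t pR"
      proof (rule nearR[OF g t(1)])
        show "climb f t pR \<le> e / 2" using t pR p1 d j0 by (intro d0(2)) auto
        show "circ (loop_pos \<Phi> g r t) (aR r) \<le> 2 * e" if "r \<in> J" for r
          using alt[OF that] same[OF that] True by (cases "r = r0") auto
      qed
      then show ?thesis by blast
    next
      case False
      have "near_point J e g t pL"
      proof (rule nearL[OF g t(1)])
        show "climb f t pL \<le> e / 2" using t pL p1 d j0 by (intro d0(2)) auto
        show "circ (loop_pos \<Phi> g r t) (aL r) \<le> 2 * e" if "r \<in> J" for r
          using alt[OF that] same[OF that] False by (cases "r = r0") auto
      qed
      then show ?thesis by blast
    qed
    show ?thesis
    proof (rule eventually_around_sides)
      show "eventually (\<lambda>t. \<forall>g. close_path \<rho> f g \<longrightarrow> (\<exists>p\<in>{pR, pL}. near_point J e g t p)) (from_right s)"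
        using evR dR' \<rho>4(2)
      proof eventually_elim
        case (elim t)
        show ?case
        proof (intro allI impI)
          fix g assume g: "close_path \<rho> f g"
          show "\<exists>p\<in>{pR, pL}. near_point J e g t p"
          proof (rule two[OF g elim(1)])
            show "t \<in> {s - d<..<s + d}" using elim(2) d(1) by auto
            fix r assume r: "r \<in> J"
            have "C r (yR r) = aL r" using yy[OF r] by (simp add: aL_def)
            then show "circ (loop_pos \<Phi> g r t) (aR r) \<le> 2 * e \<or> circ (loop_pos \<Phi> g r t) (aL r) \<le> 2 * e"
              using elim(3)[rule_format, OF close_path_mono[OF g \<rho>(6)] r] by simp
          qed
        qed
      qed
      show "eventually (\<lambda>t. \<forall>g. close_path \<rho> f g \<longrightarrow> (\<exists>p\<in>{pR, pL}. near_point J e g t p)) (at_left s)"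
        using evL' dL' \<rho>5(2)
      proof eventually_elim
        case (elim t)
        show ?case
        proof (intro allI impI)
          fix g assume g: "close_path \<rho> f g"
          show "\<exists>p\<in>{pR, pL}. near_point J e g t p"
          proof (rule two[OF g elim(1)])
            show "t \<in> {s - d<..<s + d}" using elim(2) d(1) by auto
            fix r assume r: "r \<in> J"
            have "\<Phi> (jump f r) (yL r) = aR r" using yy[OF r] by (simp add: aR_def)
            then show "circ (loop_pos \<Phi> g r t) (aR r) \<le> 2 * e \<or> circ (loop_pos \<Phi> g r t) (aL r) \<le> 2 * e"
              using elim(3)[rule_format, OF close_path_mono[OF g \<rho>(7)] r] by simp
          qed
        qed
      qed
    qed
  qed
  then show ?thesis
    using p1 pR(1) pL(1) \<rho>(1) by (intro exI[of _ "{pR, pL}"] exI[of _ \<rho>]) auto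
qed

text \<open>Near \<open>s\<close> only \<open>s\<close> itself can fail to be good. By compactness
  only finitely many times are bad, and they form a null set.\<close>

lemma good_punctured:
  assumes J: "finite J" "J \<subseteq> {-1<..1}" "\<And>r. r \<in> J \<Longrightarrow> 0 < jump f r" and e: "0 < e"
    and s: "s \<in> {-1..1}"
  shows "eventually (\<lambda>t. t \<noteq> s \<longrightarrow> good J e t) (around s)"
proof -
  have "\<exists>d>0. \<forall>u\<in>{s<..1}. \<bar>u - s\<bar> < d \<longrightarrow> good J e u"
  proof (cases "s = 1")
    case False
    then have "s \<in> {-1..<1}" using s by auto
    from good_right[OF J e this] obtain b where b: "s < b" "\<And>u. s < u \<Longrightarrow> u < b \<Longrightarrow> good J e u"
      by (auto simp: eventually_at_right_field)
    then show ?thesis by (intro exI[of _ "b - s"]) auto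
  qed (auto intro: exI[of _ 1])
  then obtain d1 where d1: "0 < d1" "\<And>u. u \<in> {s<..1} \<Longrightarrow> \<bar>u - s\<bar> < d1 \<Longrightarrow> good J e u" by blast
  have "\<exists>d>0. \<forall>u\<in>{-1..<s}. \<bar>u - s\<bar> < d \<longrightarrow> good J e u"
  proof (cases "s = -1")
    case False
    then have "s \<in> {-1<..1}" using s by auto
    from good_left[OF J e this] obtain b where b: "b < s" "\<And>u. b < u \<Longrightarrow> u < s \<Longrightarrow> good J e u"
      by (auto simp: eventually_at_left_field)
    then show ?thesis by (intro exI[of _ "s - b"]) auto
  qed (auto intro: exI[of _ 1])
  then obtain d2 where d2: "0 < d2" "\<And>u. u \<in> {-1..<s} \<Longrightarrow> \<bar>u - s\<bar> < d2 \<Longrightarrow> good J e u" by blast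
  show ?thesis
    unfolding eventually_around
  proof (intro exI[of _ "min d1 d2"] conjI ballI impI)
    fix t assume t: "t \<in> {-1..1}" "\<bar>t - s\<bar> < min d1 d2" "t \<noteq> s"
    then show "good J e t" using d1(2)[of t] d2(2)[of t] by (cases "s < t") auto
  qed (use d1 d2 in auto)
qed

lemma net_local:
  assumes J: "finite J" "J \<subseteq> {-1<..1}" "\<And>r. r \<in> J \<Longrightarrow> 0 < jump f r" and e: "0 < e"
    and s: "s \<in> {-1..1}"
  shows "\<exists>P \<rho>. finite P \<and> P \<subseteq> {-1..1} \<and> (\<forall>p\<in>P. good J e p) \<and> 0 < \<rho> \<and>
    eventually (\<lambda>t. \<forall>g. close_path \<rho> f g \<longrightarrow> (\<exists>p\<in>P. near_point J e g t p)) (around s)"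
proof (cases "s \<in> {-1<..<1}")
  case True
  from net_local_interior[OF J e this] show ?thesis by blast
next
  case False
  then have "s = -1 \<or> s = 1" using s by auto
  from good_endpoint[OF J e this] have g: "good J e s" by blast
  from net_local_good[OF J e s this] obtain \<rho> where "0 < \<rho>"
    "eventually (\<lambda>t. \<forall>g. close_path \<rho> f g \<longrightarrow> near_point J e g t s) (around s)" by blast
  then show ?thesis using s g by (intro exI[of _ "{s}"] exI[of _ \<rho>]) auto
qed

lemma net:
  assumes J: "finite J" "J \<subseteq> {-1<..1}" "\<And>r. r \<in> J \<Longrightarrow> 0 < jump f r" and e: "0 < e"
  obtains P E \<rho> where "finite P" "P \<subseteq> {-1..1}" "1 \<in> P" "\<And>p. p \<in> P \<Longrightarrow> good J e p"
    "finite E" "\<And>s. s \<in> {-1..1} - E \<Longrightarrow> good J e s" "0 < \<rho>"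
    "\<And>g s. close_path \<rho> f g \<Longrightarrow> s \<in> {-1..1} \<Longrightarrow> \<exists>p\<in>P. near_point J e g s p"
proof -
  have "\<exists>P \<rho> d. finite P \<and> P \<subseteq> {-1..1} \<and> (\<forall>p\<in>P. good J e p) \<and> 0 < \<rho> \<and> 0 < d \<and>
    (\<forall>t\<in>{-1..1}. \<bar>t - s\<bar> < d \<longrightarrow> (\<forall>g. close_path \<rho> f g \<longrightarrow> (\<exists>p\<in>P. near_point J e g t p)) \<and> (t \<noteq> s \<longrightarrow> good J e t))"
    if s: "s \<in> {-1..1}" for s
  proof -
    obtain P \<rho> where P: "finite P" "P \<subseteq> {-1..1}" "\<forall>p\<in>P. good J e p" "0 < \<rho>"
      "eventually (\<lambda>t. \<forall>g. close_path \<rho> f g \<longrightarrow> (\<exists>p\<in>P. near_point J e g t p)) (around s)"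
      using net_local[OF J e s] by blast
    have "eventually (\<lambda>t. (\<forall>g. close_path \<rho> f g \<longrightarrow> (\<exists>p\<in>P. near_point J e g t p)) \<and> (t \<noteq> s \<longrightarrow> good J e t)) (around s)"
      using P(5) good_punctured[OF J e s] by (rule eventually_conj)
    then show ?thesis using P(1-4) unfolding eventually_around by blast
  qed
  then obtain P \<rho> d where A: "\<And>s. s \<in> {-1..1} \<Longrightarrow> finite (P s) \<and> P s \<subseteq> {-1..1} \<and> (\<forall>p\<in>P s. good J e p) \<and> 0 < \<rho> s \<and> 0 < d s \<and>
    (\<forall>t\<in>{-1..1}. \<bar>t - s\<bar> < d s \<longrightarrow> (\<forall>g. close_path (\<rho> s) f g \<longrightarrow> (\<exists>p\<in>P s. near_point J e g t p)) \<and> (t \<noteq> s \<longrightarrow> good J e t))"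
    by metis
  obtain E where E: "finite E" "E \<subseteq> {-1..1}" "\<And>t. t \<in> {-1..1} \<Longrightarrow> \<exists>s\<in>E. \<bar>t - s\<bar> < d s"
    using finite_ball_cover[of "-1" 1 d] A by metis
  \<comment> \<open>The time 1 is added because it codes the base point, which the correspondence
    must match.\<close>
  define Q where "Q = insert 1 (\<Union>s\<in>E. P s)"
  define \<rho>' where "\<rho>' = Min (insert 1 (\<rho> ` E))"
  have A': "finite (P s)" "P s \<subseteq> {-1..1}" "\<forall>p\<in>P s. good J e p" "0 < \<rho> s" if "s \<in> E" for s
    using A[of s] E(2) that by blast+
  show ?thesis
  proof (rule that[of Q E \<rho>'])
    show "finite Q" using E(1) A'(1) by (simp add: Q_def)
    show "Q \<subseteq> {-1..1}" using A'(2) by (auto simp: Q_def)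
    show "1 \<in> Q" by (simp add: Q_def)
    show "good J e p" if "p \<in> Q" for p
      using that A'(3) good_endpoint[OF J e, of 1] by (auto simp: Q_def)
    show "finite E" by fact
    show "0 < \<rho>'" unfolding \<rho>'_def using E(1) A'(4) by (subst Min_gr_iff) auto
    fix s :: real
    show "good J e s" if s: "s \<in> {-1..1} - E"
    proof -
      have s1: "s \<in> {-1..1}" using s by blast
      obtain c where c: "c \<in> E" "\<bar>s - c\<bar> < d c" using E(3)[OF s1] by blast
      moreover have "s \<noteq> c" using s c by blast
      ultimately show ?thesis using A[of c] E(2) s1 by blast
    qed
    fix g assume g: "close_path \<rho>' f g" and s: "s \<in> {-1..1}"
    obtain c where c: "c \<in> E" "\<bar>s - c\<bar> < d c" using E(3)[OF s] by blast
    have "\<rho>' \<le> \<rho> c" unfolding \<rho>'_def using E(1) c by (intro Min_le) auto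
    then have "close_path (\<rho> c) f g" by (rule close_path_mono[OF g])
    then have "\<exists>p\<in>P c. near_point J e g s p" using A[of c] E(2) c s by blast
    then show "\<exists>p\<in>Q. near_point J e g s p" using c(1) by (auto simp: Q_def)
  qed
qed

end

section \<open>Tree distances on the net\<close>

context shuffled_excursion
begin

text \<open>A loop of \<open>J\<close> costs at most \<open>2 * jump g r * (4 * e)\<close>. As
  \<open>g\<close> is within 1 of \<open>f\<close>, its jump is at most \<open>jump f r + 2\<close>,
  so the bound involves \<open>f\<close> and \<open>J\<close> only.\<close>

lemma tree_dist_le_of_near:
  assumes J: "dominant_loops \<Phi> f \<epsilon> J \<rho>" and g: "close_path \<rho> f g" "close_path 1 f g"
    and near: "near_point J e g s p" and sp': "s \<in> {-1..1}" "p \<in> {-1..1}" and e: "0 \<le> e"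
  shows "tree_dist \<Phi> g s p \<le> e * (1 + 8 * ((\<Sum>r\<in>J. jump f r) + 2 * real (card J))) + \<epsilon>"
proof -
  note JD = dominant_loopsD[OF J]
  have "\<bar>tree_dist \<Phi> g s p - climb g s p - (\<Sum>r\<in>J. loop_excess \<Phi> g r s p)\<bar> \<le> \<epsilon>"
    by (rule JD(5)[OF g(1) sp' JD(1) order.refl JD(2)])
  moreover have "(\<Sum>r\<in>J. loop_excess \<Phi> g r s p) \<le> (\<Sum>r\<in>J. 8 * e * (jump f r + 2))"
  proof (rule sum_mono)
    fix r assume r: "r \<in> J"
    have j: "0 < jump g r" by (rule JD(4)[OF g(1) r])
    have "\<bar>jump g r - jump f r\<bar> \<le> 2 * 1"
      using JD(2) r by (intro jump_close sp_cadlag close_pathD[OF g(2)] sp) auto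
    then have "jump g r \<le> jump f r + 2" by linarith
    have "loop_excess \<Phi> g r s p \<le> 2 * jump g r * circ (loop_pos \<Phi> g r s) (loop_pos \<Phi> g r p)"
      by (simp add: loop_excess_eq[OF j])
    also have "\<dots> \<le> 2 * jump g r * (4 * e)"
      using near r j unfolding near_point_def by (intro mult_left_mono) auto
    also have "\<dots> \<le> 2 * (jump f r + 2) * (4 * e)"
      using \<open>jump g r \<le> jump f r + 2\<close> e by (intro mult_right_mono) auto
    finally show "loop_excess \<Phi> g r s p \<le> 8 * e * (jump f r + 2)" by (simp add: algebra_simps)
  qed
  moreover have "(\<Sum>r\<in>J. 8 * e * (jump f r + 2)) = 8 * e * ((\<Sum>r\<in>J. jump f r) + 2 * real (card J))"
    unfolding sum_distrib_left[symmetric] sum.distrib by simp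
  moreover have "climb g s p \<le> e" using near by (simp add: near_point_def)
  ultimately show ?thesis by (simp add: distrib_left)
qed

text \<open>The finite approximation costs \<open>\<epsilon>\<close> for each path, the climb
  \<open>4 * \<rho>'\<close>. Per loop, the difference of coordinates costs
  \<open>4 * \<rho>'\<close>, the change of perimeter \<open>2 * \<rho>'\<close> since
  \<open>circ\<close> is at most 1/2, and the positions \<open>4 * e * jump f r\<close>.\<close>

lemma tree_dist_close_of_good:
  assumes J: "dominant_loops \<Phi> f \<epsilon> J \<rho>" and g: "close_path \<rho> f g" "close_path \<rho>' f g"
    and pq: "p \<in> {-1..1}" "q \<in> {-1..1}" and e: "0 \<le> e"
    and p: "\<And>r. r \<in> J \<Longrightarrow> circ (loop_pos \<Phi> g r p) (loop_pos \<Phi> f r p) \<le> e"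
    and q: "\<And>r. r \<in> J \<Longrightarrow> circ (loop_pos \<Phi> g r q) (loop_pos \<Phi> f r q) \<le> e"
  shows "\<bar>tree_dist \<Phi> g p q - tree_dist \<Phi> f p q\<bar>
    \<le> 2 * \<epsilon> + (4 + 6 * real (card J)) * \<rho>' + 4 * e * (\<Sum>r\<in>J. jump f r)"
proof -
  note JD = dominant_loopsD[OF J]
  have ff: "close_path \<rho> f f" using sp JD(3) by (intro close_path_refl) auto
  note gD = close_pathD[OF g(2)]
  have A: "\<bar>tree_dist \<Phi> g p q - climb g p q - (\<Sum>r\<in>J. loop_excess \<Phi> g r p q)\<bar> \<le> \<epsilon>"
    by (rule JD(5)[OF g(1) pq JD(1) order.refl JD(2)])
  have B: "\<bar>tree_dist \<Phi> f p q - climb f p q - (\<Sum>r\<in>J. loop_excess \<Phi> f r p q)\<bar> \<le> \<epsilon>"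
    by (rule JD(5)[OF ff pq JD(1) order.refl JD(2)])
  have C: "\<bar>climb g p q - climb f p q\<bar> \<le> 4 * \<rho>'" by (rule climb_close[OF gD(1) sp pq gD(2)])
  have D: "\<bar>loop_excess \<Phi> g r p q - loop_excess \<Phi> f r p q\<bar> \<le> 6 * \<rho>' + 4 * e * jump f r" if r: "r \<in> J" for r
  proof -
    have r1: "r \<in> {-1<..1}" using JD(2) r by auto
    have j: "0 < jump g r" "0 < jump f r" using JD(4)[OF g(1) r] JD(4)[OF ff r] by auto
    let ?cg = "circ (loop_pos \<Phi> g r p) (loop_pos \<Phi> g r q)" and ?cf = "circ (loop_pos \<Phi> f r p) (loop_pos \<Phi> f r q)"
    have rng: "loop_pos \<Phi> g r p \<in> {0..1}" "loop_pos \<Phi> g r q \<in> {0..1}" "loop_pos \<Phi> f r p \<in> {0..1}" "loop_pos \<Phi> f r q \<in> {0..1}"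
      by (intro loop_pos_range[OF \<Phi>] gD(1) sp r1 pq j)+
    have "\<bar>?cg - ?cf\<bar> \<le> circ (loop_pos \<Phi> g r p) (loop_pos \<Phi> f r p) + circ (loop_pos \<Phi> g r q) (loop_pos \<Phi> f r q)"
      by (rule circ_diff_le[OF rng])
    then have c: "\<bar>?cg - ?cf\<bar> \<le> 2 * e" using p[OF r] q[OF r] by linarith
    have dj: "\<bar>jump g r - jump f r\<bar> \<le> 2 * \<rho>'" by (intro jump_close sp_cadlag gD sp r1)
    have cg: "0 \<le> ?cg" "?cg \<le> 1 / 2" by (rule circ_nonneg[OF rng(1,2)], rule circ_le_half)
    have "\<bar>jump g r * ?cg - jump f r * ?cf\<bar> = \<bar>(jump g r - jump f r) * ?cg + jump f r * (?cg - ?cf)\<bar>"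
      by (simp add: algebra_simps)
    also have "\<dots> \<le> \<bar>jump g r - jump f r\<bar> * ?cg + jump f r * \<bar>?cg - ?cf\<bar>"
      using cg j by (intro order.trans[OF abs_triangle_ineq]) (simp add: abs_mult)
    also have "\<dots> \<le> (2 * \<rho>') * (1 / 2) + jump f r * (2 * e)"
      using dj cg c j by (intro add_mono mult_mono mult_left_mono) auto
    finally have m: "\<bar>jump g r * ?cg - jump f r * ?cf\<bar> \<le> \<rho>' + 2 * e * jump f r" by (simp add: algebra_simps)
    have "\<bar>xval g r p - xval f r p\<bar> \<le> 2 * \<rho>'" "\<bar>xval g r q - xval f r q\<bar> \<le> 2 * \<rho>'"
      using xval_close[OF gD(1) sp r1 pq(1) gD(2)] xval_close[OF gD(1) sp r1 pq(2) gD(2)] by blast+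
    then have "\<bar>\<bar>xval g r p - xval g r q\<bar> - \<bar>xval f r p - xval f r q\<bar>\<bar> \<le> 4 * \<rho>'" by linarith
    moreover have "\<bar>2 * (jump g r * ?cg) - 2 * (jump f r * ?cf)\<bar> \<le> 2 * \<rho>' + 4 * e * jump f r"
      using m by linarith
    ultimately show ?thesis
      unfolding loop_excess_def loop_dist_eq[OF j(1)] loop_dist_eq[OF j(2)] by linarith
  qed
  have "\<bar>(\<Sum>r\<in>J. loop_excess \<Phi> g r p q) - (\<Sum>r\<in>J. loop_excess \<Phi> f r p q)\<bar>
      \<le> (\<Sum>r\<in>J. \<bar>loop_excess \<Phi> g r p q - loop_excess \<Phi> f r p q\<bar>)"
    unfolding sum_subtractf[symmetric] by (rule sum_abs)
  also have "\<dots> \<le> (\<Sum>r\<in>J. 6 * \<rho>' + 4 * e * jump f r)" by (rule sum_mono[OF D])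
  also have "\<dots> = 6 * real (card J) * \<rho>' + 4 * e * (\<Sum>r\<in>J. jump f r)"
    by (simp add: sum.distrib sum_distrib_left)
  finally have E: "\<bar>(\<Sum>r\<in>J. loop_excess \<Phi> g r p q) - (\<Sum>r\<in>J. loop_excess \<Phi> f r p q)\<bar>
    \<le> 6 * real (card J) * \<rho>' + 4 * e * (\<Sum>r\<in>J. jump f r)" .
  have "(4 + 6 * real (card J)) * \<rho>' = 4 * \<rho>' + 6 * real (card J) * \<rho>'" by (simp add: algebra_simps)
  with A B C E show ?thesis by linarith
qed

text \<open>\<open>J\<close> is fixed before \<open>e\<close> and \<open>\<rho>\<close>, because
  their size depends on the number and the perimeters of its loops. The last clause allows the
  radius to depend on \<open>s\<close>: it is used only for a limit at each fixed
  \<open>s\<close>.\<close>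

lemma tree_dist_net:
  assumes \<epsilon>: "0 < \<epsilon>"
  obtains P E \<rho> where "finite P" "P \<subseteq> {-1..1}" "1 \<in> P" "finite E" "0 < \<rho>"
    "\<And>g s. close_path \<rho> f g \<Longrightarrow> s \<in> {-1..1} \<Longrightarrow> \<exists>p\<in>P. tree_dist \<Phi> g s p \<le> \<epsilon>"
    "\<And>g p q. close_path \<rho> f g \<Longrightarrow> p \<in> P \<Longrightarrow> q \<in> P \<Longrightarrow> \<bar>tree_dist \<Phi> g p q - tree_dist \<Phi> f p q\<bar> \<le> \<epsilon>"
    "\<And>s. s \<in> {-1..1} - E \<Longrightarrow> \<exists>\<rho>'>0. eventually (\<lambda>t. \<forall>g. close_path \<rho>' f g \<longrightarrow>
      tree_dist \<Phi> g t s \<le> \<epsilon> \<and> (\<forall>p\<in>P. \<bar>tree_dist \<Phi> g s p - tree_dist \<Phi> f s p\<bar> \<le> \<epsilon>)) (around s)"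
proof -
  have "0 < \<epsilon> / 4" using \<epsilon> by simp
  then obtain J \<rho>0 where J: "dominant_loops \<Phi> f (\<epsilon> / 4) J \<rho>0"
    using dominant_loops_exist[OF \<Phi> sp] by blast
  note JD = dominant_loopsD[OF J]
  have ff: "close_path \<rho>0 f f" using sp JD(3) by (intro close_path_refl) auto
  have Jf: "0 < jump f r" if "r \<in> J" for r by (rule JD(4)[OF ff that])
  define S where "S = (\<Sum>r\<in>J. jump f r)"
  define N where "N = real (card J)"
  define D where "D = 1 + 8 * (S + 2 * N)"
  \<comment> \<open>Makes the loop error in \<open>tree_dist_le_of_near\<close> exactly
    \<open>\<epsilon> / 4\<close>, and the term with \<open>4 * e\<close> in
    \<open>tree_dist_close_of_good\<close> at most \<open>\<epsilon> / 4\<close>.\<close>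
  define e where "e = \<epsilon> / (4 * D)"
  have S: "0 \<le> S" unfolding S_def using Jf by (intro sum_nonneg) (auto intro: less_imp_le)
  have N: "0 \<le> N" by (simp add: N_def)
  have pos: "0 < D" unfolding D_def using S N by simp
  have e: "0 < e" unfolding e_def using \<epsilon> pos by simp
  have e_eq: "e * (1 + 8 * (S + 2 * N)) = \<epsilon> / 4" unfolding e_def D_def[symmetric] using pos by simp
  have eS: "4 * e * S \<le> \<epsilon> / 4"
  proof -
    have "4 * S \<le> 1 + 8 * (S + 2 * N)" using S N by simp
    then have "e * (4 * S) \<le> e * (1 + 8 * (S + 2 * N))" using e by (intro mult_left_mono) auto
    also have "\<dots> = \<epsilon> / 4" by (rule e_eq)
    finally show ?thesis by (simp add: mult.left_commute mult.commute)
  qed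
  define \<rho>1 where "\<rho>1 = min \<rho>0 (min 1 (\<epsilon> / (4 * (4 + 6 * N))))"
  have \<rho>1: "0 < \<rho>1" "\<rho>1 \<le> \<rho>0" "\<rho>1 \<le> 1" "\<rho>1 \<le> \<epsilon> / (4 * (4 + 6 * N))"
    using JD(3) \<epsilon> N by (auto simp: \<rho>1_def)
  have \<rho>1N: "(4 + 6 * N) * \<rho>1 \<le> \<epsilon> / 4" using \<rho>1(4) N by (simp add: field_simps)
  have upper: "tree_dist \<Phi> g s p \<le> \<epsilon>"
    if g: "close_path \<rho>1 f g" and "near_point J e g s p" "s \<in> {-1..1}" "p \<in> {-1..1}" for g s p
    using tree_dist_le_of_near[OF J close_path_mono[OF g \<rho>1(2)] close_path_mono[OF g \<rho>1(3)] that(2-4)] e e_eq \<epsilon>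
    unfolding S_def N_def by linarith
  have diff: "\<bar>tree_dist \<Phi> g p q - tree_dist \<Phi> f p q\<bar> \<le> \<epsilon>"
    if g: "close_path \<rho>1 f g" and "p \<in> {-1..1}" "q \<in> {-1..1}"
      "\<And>r. r \<in> J \<Longrightarrow> circ (loop_pos \<Phi> g r p) (loop_pos \<Phi> f r p) \<le> e"
      "\<And>r. r \<in> J \<Longrightarrow> circ (loop_pos \<Phi> g r q) (loop_pos \<Phi> f r q) \<le> e" for g p q
    using tree_dist_close_of_good[OF J close_path_mono[OF g \<rho>1(2)] g that(2,3) less_imp_le[OF e] that(4,5)] \<rho>1N eS
    unfolding S_def N_def by linarith
  obtain P E \<rho>2 where P: "finite P" "P \<subseteq> {-1..1}" "1 \<in> P" "\<And>p. p \<in> P \<Longrightarrow> good J e p"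
    and E: "finite E" "\<And>s. s \<in> {-1..1} - E \<Longrightarrow> good J e s"
    and \<rho>2: "0 < \<rho>2" "\<And>g s. close_path \<rho>2 f g \<Longrightarrow> s \<in> {-1..1} \<Longrightarrow> \<exists>p\<in>P. near_point J e g s p"
    using net[OF JD(1,2) Jf e] by blast
  have "\<exists>\<rho>>0. \<forall>g r. close_path \<rho> f g \<longrightarrow> r \<in> J \<longrightarrow> circ (loop_pos \<Phi> g r p) (loop_pos \<Phi> f r p) \<le> e"
    if "p \<in> {-1..1}" "good J e p" for p
    using good_self[OF that(2,1)] by metis
  then obtain R where R: "\<And>p. p \<in> {-1..1} \<Longrightarrow> good J e p \<Longrightarrow> 0 < R p"
    "\<And>p g r. p \<in> {-1..1} \<Longrightarrow> good J e p \<Longrightarrow> close_path (R p) f g \<Longrightarrow> r \<in> J \<Longrightarrow>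
      circ (loop_pos \<Phi> g r p) (loop_pos \<Phi> f r p) \<le> e"
    by metis
  define \<rho> where "\<rho> = min (min \<rho>1 \<rho>2) (Min (R ` P))"
  have "0 < Min (R ` P)" using P R(1) by (subst Min_gr_iff) auto
  then have \<rho>: "0 < \<rho>" "\<rho> \<le> \<rho>1" "\<rho> \<le> \<rho>2" using \<rho>1(1) \<rho>2(1) by (auto simp: \<rho>_def)
  have \<rho>R: "\<rho> \<le> R p" if "p \<in> P" for p
  proof -
    have "Min (R ` P) \<le> R p" using P(1) that by (intro Min_le) auto
    then show ?thesis by (simp add: \<rho>_def)
  qed
  have closeP: "circ (loop_pos \<Phi> g r p) (loop_pos \<Phi> f r p) \<le> e" if "close_path \<rho> f g" "p \<in> P" "r \<in> J" for g p r
    using R(2)[OF _ P(4)[OF that(2)] close_path_mono[OF that(1) \<rho>R[OF that(2)]] that(3)] P(2) that(2) by blast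
  show ?thesis
  proof (rule that[OF P(1-3) E(1) \<rho>(1)])
    fix g assume g: "close_path \<rho> f g"
    show "\<exists>p\<in>P. tree_dist \<Phi> g s p \<le> \<epsilon>" if s: "s \<in> {-1..1}" for s
    proof -
      obtain p where p: "p \<in> P" "near_point J e g s p"
        using \<rho>2(2)[OF close_path_mono[OF g \<rho>(3)] s] by blast
      then have "p \<in> {-1..1}" using P(2) by blast
      from upper[OF close_path_mono[OF g \<rho>(2)] p(2) s this] show ?thesis using p(1) by blast
    qed
    show "\<bar>tree_dist \<Phi> g p q - tree_dist \<Phi> f p q\<bar> \<le> \<epsilon>" if pq: "p \<in> P" "q \<in> P" for p q
    proof -
      have "p \<in> {-1..1}" "q \<in> {-1..1}" using P(2) pq by blast+
      from diff[OF close_path_mono[OF g \<rho>(2)] this closeP[OF g pq(1)] closeP[OF g pq(2)]]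
      show ?thesis by blast
    qed
  next
    fix s :: real assume s: "s \<in> {-1..1} - E"
    then have s1: "s \<in> {-1..1}" and gs: "good J e s" using E(2) by blast+
    obtain \<rho>3 where \<rho>3: "0 < \<rho>3" "eventually (\<lambda>t. \<forall>g. close_path \<rho>3 f g \<longrightarrow> near_point J e g t s) (around s)"
      using net_local_good[OF JD(1,2) Jf e s1 gs] by blast
    define \<rho>' where "\<rho>' = min \<rho> (min \<rho>3 (R s))"
    have \<rho>': "0 < \<rho>'" "\<rho>' \<le> \<rho>" "\<rho>' \<le> \<rho>3" "\<rho>' \<le> R s"
      using \<rho>(1) \<rho>3(1) R(1)[OF s1 gs] by (auto simp: \<rho>'_def)
    have "eventually (\<lambda>t. t \<in> {-1..1}) (around s)"
      unfolding eventually_around by (intro exI[of _ 1]) auto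
    then have "eventually (\<lambda>t. \<forall>g. close_path \<rho>' f g \<longrightarrow>
      tree_dist \<Phi> g t s \<le> \<epsilon> \<and> (\<forall>p\<in>P. \<bar>tree_dist \<Phi> g s p - tree_dist \<Phi> f s p\<bar> \<le> \<epsilon>)) (around s)"
      using \<rho>3(2)
    proof eventually_elim
      case (elim t)
      show ?case
      proof (intro allI impI conjI ballI)
        fix g assume g: "close_path \<rho>' f g"
        have g1: "close_path \<rho> f g" "close_path \<rho>1 f g"
          using close_path_mono[OF g] \<rho>' \<rho> by auto
        have "near_point J e g t s" using elim(2) close_path_mono[OF g \<rho>'(3)] by blast
        then show "tree_dist \<Phi> g t s \<le> \<epsilon>" by (rule upper[OF g1(2) _ elim(1) s1])
        show "\<bar>tree_dist \<Phi> g s p - tree_dist \<Phi> f s p\<bar> \<le> \<epsilon>" if p: "p \<in> P" for p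
        proof -
          have "p \<in> {-1..1}" using P(2) p by blast
          from diff[OF g1(2) s1 this R(2)[OF s1 gs close_path_mono[OF g \<rho>'(4)]] closeP[OF g1(1) p]]
          show ?thesis by blast
        qed
      qed
    qed
    then show "\<exists>\<rho>'>0. eventually (\<lambda>t. \<forall>g. close_path \<rho>' f g \<longrightarrow>
      tree_dist \<Phi> g t s \<le> \<epsilon> \<and> (\<forall>p\<in>P. \<bar>tree_dist \<Phi> g s p - tree_dist \<Phi> f s p\<bar> \<le> \<epsilon>)) (around s)"
      using \<rho>'(1) by blast
  qed
qed

end

section \<open>Quotients of the unit interval\<close>

text \<open>A set that contains an interval to the right of each of its points is open up to the countably many
  left end points of its components.\<close>

lemma right_open_borel:
  fixes V :: "real set"
  assumes "\<And>t. t \<in> V \<Longrightarrow> t < b \<Longrightarrow> \<exists>\<delta>>0. {t..<t + \<delta>} \<subseteq> V" "V \<subseteq> {..b}"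
  shows "V \<in> sets borel"
proof -
  \<comment> \<open>The end \<open>b\<close> is set aside: nothing is assumed about the right of
    it.\<close>
  define B where "B = V - interior V - {b}"
  have "\<exists>\<delta>>0. {t..<t + \<delta>} \<subseteq> V" if "t \<in> B" for t
    using assms that by (force simp: B_def)
  then obtain \<delta> where \<delta>: "\<And>t. t \<in> B \<Longrightarrow> 0 < \<delta> t" "\<And>t. t \<in> B \<Longrightarrow> {t..<t + \<delta> t} \<subseteq> V" by metis
  have "\<exists>q\<in>\<rat>. t < q \<and> q < t + \<delta> t" if "t \<in> B" for t
    using Rats_dense_in_real[of t "t + \<delta> t"] \<delta>(1)[OF that] by auto
  then obtain q where q: "\<And>t. t \<in> B \<Longrightarrow> q t \<in> \<rat> \<and> t < q t \<and> q t < t + \<delta> t" by metis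
  \<comment> \<open>The open part of the interval attached to a point of \<open>B\<close> lies in
    the interior of \<open>V\<close>, so it contains no other point of \<open>B\<close>; distinct
    points thus receive distinct rationals.\<close>
  have sep: "t + \<delta> t \<le> t'" if "t \<in> B" "t' \<in> B" "t < t'" for t t'
  proof (rule ccontr)
    assume "\<not> t + \<delta> t \<le> t'"
    then have "t' \<in> {t<..<t + \<delta> t}" using that by auto
    moreover have "{t<..<t + \<delta> t} \<subseteq> interior V" using \<delta>(2)[OF that(1)] by (intro interior_maximal) auto
    ultimately show False using that(2) by (auto simp: B_def)
  qed
  have "inj_on q B"
  proof (rule inj_onI, rule ccontr)
    fix t t' assume t: "t \<in> B" "t' \<in> B" "q t = q t'" "t \<noteq> t'"
    have *: False if "t \<in> B" "t' \<in> B" "q t = q t'" "t < t'" for t t'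
      using sep[OF that(1,2,4)] q[OF that(1)] q[OF that(2)] that(3) by linarith
    show False using *[of t t'] *[of t' t] t by (cases "t < t'") auto
  qed
  moreover have "q ` B \<subseteq> \<rat>" using q by auto
  ultimately have "countable B"
    using countable_rat countable_subset countable_image_inj_on by blast
  then have "B \<in> sets borel" by (rule sets.countable[rotated]) simp
  moreover have "interior V \<in> sets borel" by simp
  moreover have "V \<inter> {b} \<in> sets borel" by (cases "b \<in> V") auto
  moreover have "V = interior V \<union> B \<union> (V \<inter> {b})" using interior_subset[of V] by (auto simp: B_def)
  ultimately show ?thesis by (metis sets.Un)
qed

text \<open>Right-continuity is what makes the projection measurable; sequential compactness is
  compactness of the quotient, stated with representatives.\<close>

locale interval_pseudometric =
  fixes d :: "real \<Rightarrow> real \<Rightarrow> real"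
  assumes d_refl: "s \<in> {0..1} \<Longrightarrow> d s s = 0"
    and d_nonneg: "s \<in> {0..1} \<Longrightarrow> t \<in> {0..1} \<Longrightarrow> 0 \<le> d s t"
    and d_commute: "s \<in> {0..1} \<Longrightarrow> t \<in> {0..1} \<Longrightarrow> d s t = d t s"
    and d_triangle: "s \<in> {0..1} \<Longrightarrow> t \<in> {0..1} \<Longrightarrow> u \<in> {0..1} \<Longrightarrow> d s u \<le> d s t + d t u"
    and right_continuous: "s \<in> {0..<1} \<Longrightarrow> ((\<lambda>u. d u s) \<longlongrightarrow> 0) (at_right s)"
    and sequentially_compact: "(\<And>k. \<sigma> k \<in> {0..1}) \<Longrightarrow>
      \<exists>u\<in>{0..1}. \<exists>h. strict_mono (h :: nat \<Rightarrow> nat) \<and> (\<lambda>k. d (\<sigma> (h k)) u) \<longlonglongrightarrow> 0"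
begin

abbreviation points :: "real set set" where "points \<equiv> {0..1} // zero_rel {0..1} d"
abbreviation qdist :: "real set \<Rightarrow> real set \<Rightarrow> real" where "qdist \<equiv> quotient_dist {0..1} d"

definition proj :: "real \<Rightarrow> real set" where "proj t = zero_rel {0..1} d `` {t}"

lemma in_proj: "s \<in> {0..1} \<Longrightarrow> x \<in> proj s \<longleftrightarrow> x \<in> {0..1} \<and> d s x = 0"
  by (auto simp: proj_def zero_rel_def)

lemma proj_in: "s \<in> {0..1} \<Longrightarrow> proj s \<in> points"
  unfolding proj_def by (rule quotientI)

lemma points_cases:
  assumes "A \<in> points"
  obtains s where "s \<in> {0..1}" "A = proj s"
  using assms unfolding proj_def by (rule quotientE) blast

lemma dist_cong:
  assumes "s \<in> {0..1}" "t \<in> {0..1}" "x \<in> {0..1}" "y \<in> {0..1}" "d s x = 0" "d t y = 0"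
  shows "d x y = d s t"
  using d_triangle[OF assms(3,1,4)] d_triangle[OF assms(1,2,4)] d_triangle[OF assms(1,3,2)] d_triangle[OF assms(3,4,2)]
    d_commute[OF assms(1,3)] d_commute[OF assms(2,4)] assms(5,6) by linarith

lemma qdist_proj:
  assumes "s \<in> {0..1}" "t \<in> {0..1}"
  shows "qdist (proj s) (proj t) = d s t"
proof -
  have *: "(SOME x. x \<in> proj s) \<in> {0..1} \<and> d s (SOME x. x \<in> proj s) = 0" if "s \<in> {0..1}" for s
  proof -
    have "s \<in> proj s" using in_proj[OF that] that d_refl[OF that] by blast
    then have "(SOME x. x \<in> proj s) \<in> proj s" by (rule someI)
    then show ?thesis using in_proj[OF that] by blast
  qed
  have "d (SOME x. x \<in> proj s) (SOME y. y \<in> proj t) = d s t"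
    by (rule dist_cong) (use * assms in blast)+
  then show ?thesis unfolding quotient_dist_def using proj_in assms by simp
qed

lemma proj_eq:
  assumes "s \<in> {0..1}" "t \<in> {0..1}" "d s t = 0"
  shows "proj s = proj t"
proof -
  have "d s x = 0 \<longleftrightarrow> d t x = 0" if "x \<in> {0..1}" for x
    using dist_cong[OF assms(1) that assms(2) that assms(3) d_refl[OF that]] by simp
  then show ?thesis using in_proj[OF assms(1)] in_proj[OF assms(2)] by blast
qed

sublocale Metric_space points qdist
proof
  show "0 \<le> qdist A B" for A B
  proof (cases "A \<in> points \<and> B \<in> points")
    case True
    then obtain s t where "s \<in> {0..1}" "t \<in> {0..1}" "A = proj s" "B = proj t"
      by (meson points_cases)
    then show ?thesis using d_nonneg by (simp add: qdist_proj)
  qed (auto simp: quotient_dist_def)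
  show "qdist A B = qdist B A" for A B
  proof (cases "A \<in> points \<and> B \<in> points")
    case True
    then obtain s t where "s \<in> {0..1}" "t \<in> {0..1}" "A = proj s" "B = proj t"
      by (meson points_cases)
    then show ?thesis using d_commute by (simp add: qdist_proj)
  qed (auto simp: quotient_dist_def)
  show "qdist A B = 0 \<longleftrightarrow> A = B" if AB: "A \<in> points" "B \<in> points" for A B
  proof -
    obtain s t where st: "s \<in> {0..1}" "t \<in> {0..1}" "A = proj s" "B = proj t"
      using AB by (meson points_cases)
    then show ?thesis using proj_eq[OF st(1,2)] qdist_proj[OF st(1,2)] qdist_proj[OF st(1,1)] d_refl by auto
  qed
  show "qdist A C \<le> qdist A B + qdist B C" if AB: "A \<in> points" "B \<in> points" "C \<in> points" for A B C
  proof -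
    obtain s t u where st: "s \<in> {0..1}" "t \<in> {0..1}" "u \<in> {0..1}" "A = proj s" "B = proj t" "C = proj u"
      using AB by (meson points_cases)
    then show ?thesis using d_triangle[OF st(1-3)] by (simp add: qdist_proj)
  qed
qed

lemma compactin_points: "compactin mtopology points"
  unfolding compactin_sequentially
proof (intro conjI allI impI subset_refl)
  fix \<sigma> :: "nat \<Rightarrow> real set" assume "range \<sigma> \<subseteq> points"
  then have "\<exists>s\<in>{0..1}. \<sigma> k = proj s" for k by (meson points_cases rangeI subsetD)
  then obtain \<tau> where \<tau>: "\<And>k. \<tau> k \<in> {0..1}" "\<And>k. \<sigma> k = proj (\<tau> k)" by metis
  obtain u h where u: "u \<in> {0..1}" "strict_mono (h :: nat \<Rightarrow> nat)" "(\<lambda>k. d (\<tau> (h k)) u) \<longlonglongrightarrow> 0"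
    using sequentially_compact[of \<tau>] \<tau>(1) by blast
  have "limitin mtopology (\<sigma> \<circ> h) (proj u) sequentially"
    unfolding limitin_metric
  proof (intro conjI allI impI)
    show "proj u \<in> points" by (rule proj_in[OF u(1)])
    fix e :: real assume "0 < e"
    then have "eventually (\<lambda>k. d (\<tau> (h k)) u < e) sequentially" by (rule order_tendstoD(2)[OF u(3)])
    then show "eventually (\<lambda>k. (\<sigma> \<circ> h) k \<in> points \<and> qdist ((\<sigma> \<circ> h) k) (proj u) < e) sequentially"
      by eventually_elim (use \<tau> u in \<open>simp add: qdist_proj proj_in del: atLeastAtMost_iff\<close>)
  qed
  then show "\<exists>l r. l \<in> points \<and> strict_mono r \<and> limitin mtopology (\<sigma> \<circ> r) l sequentially"
    using proj_in[OF u(1)] u(2) by blast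
qed

lemma compactin_mcball: "compactin mtopology (mcball A r)"
  by (rule closed_compactin[OF compactin_points mcball_subset_mspace closedin_mcball])

abbreviation borel_points :: "real set measure" where
  "borel_points \<equiv> borel_of_topology mtopology"

lemma space_borel_points: "space borel_points = points"
  by (simp add: borel_of_topology_def space_measure_of_conv)

lemma open_in_sets: "openin mtopology U \<Longrightarrow> U \<in> sets borel_points"
  unfolding borel_of_topology_def
  by (subst sets_measure_of) (use openin_subset[of mtopology] in force)+

lemma closed_in_sets:
  assumes "closedin mtopology C"
  shows "C \<in> sets borel_points"
proof -
  have "points - C \<in> sets borel_points"
    using assms by (intro open_in_sets) (simp add: closedin_def)
  then have "space borel_points - (points - C) \<in> sets borel_points" by (rule sets.compl_sets)
  moreover have "space borel_points - (points - C) = C"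
    using assms closedin_subset[OF assms] by (auto simp: space_borel_points)
  ultimately show ?thesis by simp
qed

abbreviation unit_lebesgue :: "real measure" where
  "unit_lebesgue \<equiv> restrict_space lborel {0..1}"

text \<open>The projection need not be continuous. Right-continuity makes the preimage of an open
  set contain an interval to the right of each of its points below 1, which is enough by
  \<open>right_open_borel\<close>.\<close>

lemma proj_measurable: "proj \<in> unit_lebesgue \<rightarrow>\<^sub>M borel_points"
  unfolding borel_of_topology_def
proof (rule measurable_measure_of)
  show "{U. openin mtopology U} \<subseteq> Pow (topspace mtopology)" using openin_subset[of mtopology] by blast
  show "proj \<in> space unit_lebesgue \<rightarrow> topspace mtopology"
    using proj_in by (auto simp: space_restrict_space)
  fix U assume "U \<in> {U. openin mtopology U}"
  then have U: "openin mtopology U" by simp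
  define V where "V = proj -` U \<inter> {0..1}"
  have "V \<in> sets borel"
  proof (rule right_open_borel[of V 1])
    show "V \<subseteq> {..1}" by (auto simp: V_def)
    fix t assume t: "t \<in> V" "t < 1"
    then have t1: "t \<in> {0..<1}" "t \<in> {0..1}" "proj t \<in> U" by (auto simp: V_def)
    obtain e where e: "0 < e" "mball (proj t) e \<subseteq> U" using U t1(3) unfolding openin_mtopology by blast
    have "eventually (\<lambda>u. d u t < e) (at_right t)" by (rule order_tendstoD(2)[OF right_continuous[OF t1(1)] e(1)])
    then obtain b where b: "t < b" "\<And>u. t < u \<Longrightarrow> u < b \<Longrightarrow> d u t < e" by (auto simp: eventually_at_right_field)
    have "{t..<t + min (b - t) (1 - t)} \<subseteq> V"
    proof
      fix u assume u: "u \<in> {t..<t + min (b - t) (1 - t)}"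
      then have u1: "u \<in> {0..1}" using t1 by auto
      have "d u t < e" using u b(2)[of u] d_refl[OF t1(2)] e(1) by (cases "u = t") auto
      then have "proj u \<in> mball (proj t) e"
        using proj_in[OF u1] proj_in[OF t1(2)] d_commute[OF u1 t1(2)] qdist_proj[OF t1(2) u1] by simp
      then show "u \<in> V" using e(2) u1 by (auto simp: V_def)
    qed
    then show "\<exists>\<delta>>0. {t..<t + \<delta>} \<subseteq> V" using b(1) t(2) by (intro exI[of _ "min (b - t) (1 - t)"]) auto
  qed
  then show "proj -` U \<inter> space unit_lebesgue \<in> sets unit_lebesgue"
    by (auto simp: V_def space_restrict_space sets_restrict_space)
qed

definition quotient_space :: "real set pointed_weighted_space" where
  "quotient_space = \<lparr> pts = points, mdist = qdist, base = proj 1, mass = distr unit_lebesgue borel_points proj \<rparr>"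

lemma in_mcball_proj:
  "s \<in> {0..1} \<Longrightarrow> t \<in> {0..1} \<Longrightarrow> proj s \<in> mcball (proj t) r \<longleftrightarrow> d s t \<le> r"
  using qdist_proj[of t s] d_commute[of s t] proj_in by simp

lemma dist_le_measurable:
  assumes "t \<in> {0..1}"
  shows "{s \<in> {0..1}. d s t \<le> r} \<in> sets unit_lebesgue"
proof -
  have "proj -` mcball (proj t) r \<inter> space unit_lebesgue \<in> sets unit_lebesgue"
    by (rule measurable_sets[OF proj_measurable closed_in_sets]) simp
  moreover have "proj -` mcball (proj t) r \<inter> space unit_lebesgue = {s \<in> {0..1}. d s t \<le> r}"
    using in_mcball_proj[OF _ assms] by (auto simp: space_restrict_space simp del: in_mcball)
  ultimately show ?thesis by simp
qed

end

section \<open>The correspondence and the coupling\<close>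

lemma prob_space_unit_lebesgue: "prob_space (restrict_space lborel {0..1::real})"
  by (rule prob_spaceI) (simp add: space_restrict_space emeasure_restrict_space)

text \<open>Moving both points of a pair to the centres of their balls changes a distance by at most
  \<open>8 * \<epsilon>\<close> in each space, and distances between centres differ by
  \<open>\<epsilon>\<close>; this gives \<open>17 * \<epsilon>\<close>, used for the mass as
  well.\<close>

lemma GHP_dist_quotient_le:
  fixes a b :: "'i \<Rightarrow> real"
  assumes X: "interval_pseudometric d" and Y: "interval_pseudometric d'"
    and I: "finite I" "\<And>p. p \<in> I \<Longrightarrow> a p \<in> {0..1}" "\<And>p. p \<in> I \<Longrightarrow> b p \<in> {0..1}"
    and \<epsilon>: "0 \<le> \<epsilon>"
    and dis: "\<And>p q. p \<in> I \<Longrightarrow> q \<in> I \<Longrightarrow> \<bar>d (a p) (a q) - d' (b p) (b q)\<bar> \<le> \<epsilon>"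
    and netX: "\<And>s. s \<in> {0..1} \<Longrightarrow> \<exists>p\<in>I. d s (a p) \<le> 4 * \<epsilon>"
    and netY: "\<And>s. s \<in> {0..1} \<Longrightarrow> \<exists>p\<in>I. d' s (b p) \<le> 4 * \<epsilon>"
    and base: "j \<in> I" "d 1 (a j) \<le> 4 * \<epsilon>" "d' 1 (b j) \<le> 4 * \<epsilon>"
    and A: "A = {s \<in> {0..1}. \<exists>p\<in>I. d s (a p) \<le> 4 * \<epsilon> \<and> d' s (b p) \<le> 4 * \<epsilon>}"
    and mass: "1 - 17 * \<epsilon> \<le> measure (restrict_space lborel {0..1}) A"
  shows "GHP_dist (interval_pseudometric.quotient_space d) (interval_pseudometric.quotient_space d') \<le> ennreal (17 * \<epsilon>)"
proof -
  interpret X: interval_pseudometric d by (rule X)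
  interpret Y: interval_pseudometric d' by (rule Y)
  let ?X = "X.quotient_space" and ?Y = "Y.quotient_space" and ?L = "restrict_space lborel {0..1::real}"
  interpret L: prob_space ?L by (rule prob_space_unit_lebesgue)
  define R where "R = (\<Union>p\<in>I. X.mcball (X.proj (a p)) (4 * \<epsilon>) \<times> Y.mcball (Y.proj (b p)) (4 * \<epsilon>))"
  \<comment> \<open>Both coordinates are driven by the same uniform time, so the mass of
    \<open>R\<close> is the Lebesgue measure of \<open>A\<close>.\<close>
  define \<nu> where "\<nu> = distr ?L (X.borel_points \<Otimes>\<^sub>M Y.borel_points) (\<lambda>s. (X.proj s, Y.proj s))"
  have pair: "(\<lambda>s. (X.proj s, Y.proj s)) \<in> ?L \<rightarrow>\<^sub>M X.borel_points \<Otimes>\<^sub>M Y.borel_points"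
    by (rule measurable_Pair[OF X.proj_measurable Y.proj_measurable])
  have sel: "pts ?X = X.points" "mdist ?X = X.qdist" "base ?X = X.proj 1" "mass ?X = distr ?L X.borel_points X.proj"
    "pts ?Y = Y.points" "mdist ?Y = Y.qdist" "base ?Y = Y.proj 1" "mass ?Y = distr ?L Y.borel_points Y.proj"
    by (simp_all add: X.quotient_space_def Y.quotient_space_def)
  have one: "(1::real) \<in> {0..1}" by simp
  have Rsets: "R \<in> sets (X.borel_points \<Otimes>\<^sub>M Y.borel_points)"
    unfolding R_def by (intro sets.finite_UN I(1) pair_measureI X.closed_in_sets Y.closed_in_sets X.closedin_mcball Y.closedin_mcball)
  have RA: "(X.proj s, Y.proj s) \<in> R \<longleftrightarrow> (\<exists>p\<in>I. d s (a p) \<le> 4 * \<epsilon> \<and> d' s (b p) \<le> 4 * \<epsilon>)"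
    if "s \<in> {0..1}" for s
    unfolding R_def using X.in_mcball_proj[OF that I(2)] Y.in_mcball_proj[OF that I(3)]
    by (auto simp del: X.in_mcball Y.in_mcball)
  have "R \<in> compact_correspondences ?X ?Y"
    unfolding compact_correspondences_def mem_Collect_eq sel
  proof (intro conjI)
    show "compactin (prod_topology X.mtopology Y.mtopology) R"
      unfolding R_def using I(1)
      by (intro compactin_Union) (auto simp: compactin_Times X.compactin_mcball Y.compactin_mcball)
    show "fst ` R = X.points"
    proof (intro equalityI subsetI)
      fix x assume "x \<in> fst ` R"
      then show "x \<in> X.points" unfolding R_def by auto
    next
      fix x assume "x \<in> X.points"
      then obtain s where s: "s \<in> {0..1}" "x = X.proj s" by (rule X.points_cases)
      obtain p where p: "p \<in> I" "d s (a p) \<le> 4 * \<epsilon>" using netX[OF s(1)] by blast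
      have "x \<in> X.mcball (X.proj (a p)) (4 * \<epsilon>)"
        using X.in_mcball_proj[OF s(1) I(2)[OF p(1)]] p(2) s(2) by blast
      moreover have "Y.proj (b p) \<in> Y.mcball (Y.proj (b p)) (4 * \<epsilon>)"
        using Y.proj_in[OF I(3)[OF p(1)]] \<epsilon> by (simp add: Y.centre_in_mcball_iff del: Y.in_mcball)
      ultimately have "(x, Y.proj (b p)) \<in> R" unfolding R_def using p(1) by blast
      then show "x \<in> fst ` R" by force
    qed
    show "snd ` R = Y.points"
    proof (intro equalityI subsetI)
      fix x assume "x \<in> snd ` R"
      then show "x \<in> Y.points" unfolding R_def by auto
    next
      fix x assume "x \<in> Y.points"
      then obtain s where s: "s \<in> {0..1}" "x = Y.proj s" by (rule Y.points_cases)
      obtain p where p: "p \<in> I" "d' s (b p) \<le> 4 * \<epsilon>" using netY[OF s(1)] by blast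
      have "x \<in> Y.mcball (Y.proj (b p)) (4 * \<epsilon>)"
        using Y.in_mcball_proj[OF s(1) I(3)[OF p(1)]] p(2) s(2) by blast
      moreover have "X.proj (a p) \<in> X.mcball (X.proj (a p)) (4 * \<epsilon>)"
        using X.proj_in[OF I(2)[OF p(1)]] \<epsilon> by (simp add: X.centre_in_mcball_iff del: X.in_mcball)
      ultimately have "(X.proj (a p), x) \<in> R" unfolding R_def using p(1) by blast
      then show "x \<in> snd ` R" by force
    qed
    show "(X.proj 1, Y.proj 1) \<in> R" using RA[OF one] base by blast
  qed
  moreover have "\<nu> \<in> couplings (mass ?X) (mass ?Y)"
    unfolding couplings_def mem_Collect_eq sel
  proof (intro conjI)
    show "prob_space \<nu>" unfolding \<nu>_def by (rule L.prob_space_distr[OF pair])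
    show "sets \<nu> = sets (distr ?L X.borel_points X.proj \<Otimes>\<^sub>M distr ?L Y.borel_points Y.proj)"
      unfolding \<nu>_def sets_distr by (intro sets_pair_measure_cong) simp_all
    have "distr \<nu> (distr ?L X.borel_points X.proj) fst = distr \<nu> X.borel_points fst"
      by (intro distr_cong) simp_all
    also have "\<dots> = distr ?L X.borel_points X.proj"
      unfolding \<nu>_def by (subst distr_distr[OF measurable_fst pair]) (simp add: comp_def)
    finally show "distr \<nu> (distr ?L X.borel_points X.proj) fst = distr ?L X.borel_points X.proj" .
    have "distr \<nu> (distr ?L Y.borel_points Y.proj) snd = distr \<nu> Y.borel_points snd"
      by (intro distr_cong) simp_all
    also have "\<dots> = distr ?L Y.borel_points Y.proj"
      unfolding \<nu>_def by (subst distr_distr[OF measurable_snd pair]) (simp add: comp_def)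
    finally show "distr \<nu> (distr ?L Y.borel_points Y.proj) snd = distr ?L Y.borel_points Y.proj" .
  qed
  ultimately have "GHP_dist ?X ?Y \<le> max (distortion ?X ?Y R / 2) (ennreal (1 - measure \<nu> R))"
    unfolding GHP_dist_def by (intro INF_lower2[of "(R, \<nu>)"]) auto
  also have "\<dots> \<le> ennreal (17 * \<epsilon>)"
  proof (rule max.boundedI)
    have "distortion ?X ?Y R \<le> ennreal (17 * \<epsilon>)"
      unfolding distortion_def sel
    proof (rule SUP_least)
      fix z assume "z \<in> R \<times> R"
      then obtain x1 x2 y1 y2 where z: "z = ((x1, x2), (y1, y2))" "(x1, x2) \<in> R" "(y1, y2) \<in> R"
        by (metis SigmaE prod.collapse)
      obtain p where p: "p \<in> I" "x1 \<in> X.mcball (X.proj (a p)) (4 * \<epsilon>)" "x2 \<in> Y.mcball (Y.proj (b p)) (4 * \<epsilon>)"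
        using z(2) unfolding R_def by blast
      obtain q where q: "q \<in> I" "y1 \<in> X.mcball (X.proj (a q)) (4 * \<epsilon>)" "y2 \<in> Y.mcball (Y.proj (b q)) (4 * \<epsilon>)"
        using z(3) unfolding R_def by blast
      obtain s1 where s1: "s1 \<in> {0..1}" "x1 = X.proj s1" using p(2) by (meson X.in_mcball X.points_cases)
      obtain s2 where s2: "s2 \<in> {0..1}" "x2 = Y.proj s2" using p(3) by (meson Y.in_mcball Y.points_cases)
      obtain t1 where t1: "t1 \<in> {0..1}" "y1 = X.proj t1" using q(2) by (meson X.in_mcball X.points_cases)
      obtain t2 where t2: "t2 \<in> {0..1}" "y2 = Y.proj t2" using q(3) by (meson Y.in_mcball Y.points_cases)
      note ap = I(2)[OF p(1)] and aq = I(2)[OF q(1)] and bp = I(3)[OF p(1)] and bq = I(3)[OF q(1)]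
      have D: "d s1 (a p) \<le> 4 * \<epsilon>" "d t1 (a q) \<le> 4 * \<epsilon>" "d' s2 (b p) \<le> 4 * \<epsilon>" "d' t2 (b q) \<le> 4 * \<epsilon>"
        using p(2,3) q(2,3) X.in_mcball_proj[OF s1(1) ap] X.in_mcball_proj[OF t1(1) aq]
          Y.in_mcball_proj[OF s2(1) bp] Y.in_mcball_proj[OF t2(1) bq] s1(2) s2(2) t1(2) t2(2) by blast+
      have dX: "\<bar>d s1 t1 - d (a p) (a q)\<bar> \<le> 8 * \<epsilon>"
        using X.d_triangle[OF s1(1) ap t1(1)] X.d_triangle[OF ap aq t1(1)] X.d_triangle[OF ap s1(1) aq] X.d_triangle[OF s1(1) t1(1) aq]
          X.d_commute[OF s1(1) ap] X.d_commute[OF t1(1) aq] D(1,2) by linarith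
      have dY: "\<bar>d' s2 t2 - d' (b p) (b q)\<bar> \<le> 8 * \<epsilon>"
        using Y.d_triangle[OF s2(1) bp t2(1)] Y.d_triangle[OF bp bq t2(1)] Y.d_triangle[OF bp s2(1) bq] Y.d_triangle[OF s2(1) t2(1) bq]
          Y.d_commute[OF s2(1) bp] Y.d_commute[OF t2(1) bq] D(3,4) by linarith
      have "\<bar>d s1 t1 - d' s2 t2\<bar> \<le> 17 * \<epsilon>" using dX dY dis[OF p(1) q(1)] by linarith
      then have "\<bar>X.qdist x1 y1 - Y.qdist x2 y2\<bar> \<le> 17 * \<epsilon>"
        using X.qdist_proj[OF s1(1) t1(1)] Y.qdist_proj[OF s2(1) t2(1)] s1(2) s2(2) t1(2) t2(2) by simp
      then show "(case z of (xa, xb) \<Rightarrow> (case xa of (x1, x2) \<Rightarrow> \<lambda>(y1, y2). ennreal \<bar>X.qdist x1 y1 - Y.qdist x2 y2\<bar>) xb)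
          \<le> ennreal (17 * \<epsilon>)"
        by (simp add: z(1) ennreal_leI)
    qed
    then have "distortion ?X ?Y R / 2 \<le> ennreal (17 * \<epsilon>) / 2" by (rule divide_right_mono_ennreal)
    also have "\<dots> = ennreal (17 * \<epsilon> / 2)"
      using \<epsilon> divide_ennreal[of "17 * \<epsilon>" 2] by simp
    also have "\<dots> \<le> ennreal (17 * \<epsilon>)" using \<epsilon> by (intro ennreal_leI) simp
    finally show "distortion ?X ?Y R / 2 \<le> ennreal (17 * \<epsilon>)" .
    have "measure \<nu> R = measure ?L ((\<lambda>s. (X.proj s, Y.proj s)) -` R \<inter> space ?L)"
      unfolding \<nu>_def by (rule measure_distr[OF pair Rsets])
    also have "(\<lambda>s. (X.proj s, Y.proj s)) -` R \<inter> space ?L = A"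
      unfolding A using RA by (auto simp: space_restrict_space)
    finally show "ennreal (1 - measure \<nu> R) \<le> ennreal (17 * \<epsilon>)"
      using mass by (intro ennreal_leI) simp
  qed
  finally show ?thesis .
qed

lemma excursion_interval_pseudometric:
  assumes \<Phi>: "shuffle \<Phi>" and f: "excursion f"
  shows "interval_pseudometric (dV \<Phi> f)"
proof
  note sp = excursion_spectrally_positive[OF f] and eq = dV_eq_tree_dist[OF \<Phi> f]
  have sub: "s \<in> {-1..1}" if "s \<in> {0..1}" for s :: real using that by auto
  show "dV \<Phi> f s s = 0" if "s \<in> {0..1}" for s using eq[OF that that] by simp
  show "0 \<le> dV \<Phi> f s t" if "s \<in> {0..1}" "t \<in> {0..1}" for s t
    unfolding eq[OF that] by (intro tree_dist_nonneg \<Phi> sp sub that)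
  show "dV \<Phi> f s t = dV \<Phi> f t s" if "s \<in> {0..1}" "t \<in> {0..1}" for s t
    unfolding eq[OF that] eq[OF that(2,1)] by (rule tree_dist_commute)
  show "dV \<Phi> f s u \<le> dV \<Phi> f s t + dV \<Phi> f t u" if "s \<in> {0..1}" "t \<in> {0..1}" "u \<in> {0..1}" for s t u
    unfolding eq[OF that(1,3)] eq[OF that(1,2)] eq[OF that(2,3)] by (intro tree_dist_triangle \<Phi> sp sub that)
  show "((\<lambda>u. dV \<Phi> f u s) \<longlongrightarrow> 0) (at_right s)" if s: "s \<in> {0..<1}" for s
  proof (rule Lim_transform_eventually)
    show "((\<lambda>u. tree_dist \<Phi> f u s) \<longlongrightarrow> 0) (at_right s)"
      using s by (intro tree_dist_right_continuous \<Phi> sp) auto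
    have "eventually (\<lambda>u. u \<in> {s<..<1}) (at_right s)" using s by (intro eventually_at_rightI[of _ 1]) auto
    then show "eventually (\<lambda>u. tree_dist \<Phi> f u s = dV \<Phi> f u s) (at_right s)"
    proof eventually_elim
      case (elim u)
      then show ?case using s by (intro eq[symmetric]) auto
    qed
  qed
  show "\<exists>u\<in>{0..1}. \<exists>h. strict_mono (h :: nat \<Rightarrow> nat) \<and> (\<lambda>k. dV \<Phi> f (\<sigma> (h k)) u) \<longlonglongrightarrow> 0"
    if \<sigma>: "\<And>k. \<sigma> k \<in> {0..1}" for \<sigma>
  proof -
    obtain u h where u: "u \<in> {0..1}" "strict_mono (h :: nat \<Rightarrow> nat)" "(\<lambda>k. tree_dist \<Phi> f (\<sigma> (h k)) u) \<longlonglongrightarrow> 0"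
      using tree_dist_sequentially_compact[OF \<Phi> f, of \<sigma>] \<sigma> by blast
    have "(\<lambda>k. dV \<Phi> f (\<sigma> (h k)) u) = (\<lambda>k. tree_dist \<Phi> f (\<sigma> (h k)) u)"
      using eq[OF \<sigma> u(1)] by blast
    with u show ?thesis by (intro bexI[of _ u] exI[of _ h] conjI) simp_all
  qed
qed

lemma shuffled_vernation_tree_eq:
  assumes "interval_pseudometric (dV \<Phi> f)"
  shows "shuffled_vernation_tree \<Phi> f = interval_pseudometric.quotient_space (dV \<Phi> f)"
proof -
  interpret interval_pseudometric "dV \<Phi> f" by (rule assms)
  show ?thesis
    unfolding shuffled_vernation_tree_def quotient_space_def Let_def proj_def[abs_def] ..
qed

section \<open>Convergence of the trees\<close>

text \<open>Negative times code the base point, which is represented by \<open>1\<close> in \<open>[0, 1]\<close>; time changes of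
  \<open>[-1, 1]\<close> need not preserve \<open>[0, 1]\<close>.\<close>

definition to_unit :: "real \<Rightarrow> real" where
  "to_unit t = (if t < 0 then 1 else t)"

lemma to_unit_range: "t \<in> {-1..1} \<Longrightarrow> to_unit t \<in> {0..1}"
  by (auto simp: to_unit_def)

lemma to_unit_id: "t \<in> {0..1} \<Longrightarrow> to_unit t = t"
  by (auto simp: to_unit_def)

text \<open>Every time is at distance 0 from its representative, so the triangle inequality in both
  directions gives equality.\<close>

lemma tree_dist_to_unit:
  assumes \<Phi>: "shuffle \<Phi>" and f: "excursion f" and st: "s \<in> {-1..1}" "t \<in> {-1..1}"
  shows "dV \<Phi> f (to_unit s) (to_unit t) = tree_dist \<Phi> f s t"
proof -
  note sp = excursion_spectrally_positive[OF f]
  have zero: "tree_dist \<Phi> f t (to_unit t) = 0" if "t \<in> {-1..1}" for t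
    using excursion_tree_dist_base[OF f, of t] that by (auto simp: to_unit_def)
  have rng: "to_unit s \<in> {-1..1}" "to_unit t \<in> {-1..1}"
    using to_unit_range[OF st(1)] to_unit_range[OF st(2)] by auto
  note tri = tree_dist_triangle[OF \<Phi> sp]
  have "tree_dist \<Phi> f (to_unit s) (to_unit t) = tree_dist \<Phi> f s t"
    using tri[OF rng(1) st(1) rng(2)] tri[OF st(1,2) rng(2)] tri[OF st(1) rng(1) st(2)] tri[OF rng st(2)]
      zero[OF st(1)] zero[OF st(2)] tree_dist_commute[of \<Phi> f s "to_unit s"] tree_dist_commute[of \<Phi> f t "to_unit t"]
    by linarith
  then show ?thesis
    using dV_eq_tree_dist[OF \<Phi> f to_unit_range[OF st(1)] to_unit_range[OF st(2)]] by simp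
qed

lemma skorokhod_time_changes:
  assumes "excursion f" "\<And>n. excursion (F n)" "(\<lambda>n. skorokhod_dist (-1) 1 dist (F n) f) \<longlonglongrightarrow> 0"
  obtains l k where "\<And>n. l n \<in> increasing_bijections (-1) 1" "\<And>n. k n \<in> increasing_bijections (-1) 1"
    "\<And>n x. x \<in> {-1..1} \<Longrightarrow> k n (l n x) = x" "\<And>n x. x \<in> {-1..1} \<Longrightarrow> l n (k n x) = x"
    "\<And>e. 0 < e \<Longrightarrow> eventually (\<lambda>n. \<forall>x\<in>{-1..1}. \<bar>l n x - x\<bar> < e) sequentially"
    "\<And>\<rho>. 0 < \<rho> \<Longrightarrow> eventually (\<lambda>n. close_path \<rho> f (\<lambda>u. F n (k n u))) sequentially"
proof -
  \<comment> \<open>The infimum in the Skorokhod distance need not be attained; the added term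
    leaves room for a strict inequality.\<close>
  define \<delta> where "\<delta> n = skorokhod_dist (-1) 1 dist (F n) f + inverse (real (Suc n))" for n
  have "\<exists>l\<in>increasing_bijections (-1) 1. \<forall>x\<in>{-1..1}. \<bar>l x - x\<bar> < \<delta> n \<and> dist (F n x) (f (l x)) < \<delta> n" for n
  proof -
    obtain M where M: "0 < M" "\<And>t. t \<in> {-1..1} \<Longrightarrow> \<bar>f t\<bar> \<le> M"
      using cadlag_bounded[OF sp_cadlag[OF excursion_spectrally_positive[OF assms(1)]]] by metis
    obtain M' where M': "0 < M'" "\<And>t. t \<in> {-1..1} \<Longrightarrow> \<bar>F n t\<bar> \<le> M'"
      using cadlag_bounded[OF sp_cadlag[OF excursion_spectrally_positive[OF assms(2)]]] by metis
    have bdd: "bdd_above ((\<lambda>x. dist (F n x) (f (l x))) ` {-1..1})" if l: "l \<in> increasing_bijections (-1) 1" for l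
    proof (rule bdd_aboveI2)
      fix x :: real assume x: "x \<in> {-1..1}"
      show "dist (F n x) (f (l x)) \<le> M' + M"
        using M(2)[OF increasing_bijectionsD(3)[OF l x]] M'(2)[OF x] unfolding dist_real_def by linarith
    qed
    have lt: "skorokhod_dist (-1) 1 dist (F n) f < \<delta> n" by (simp add: \<delta>_def)
    have le: "(-1::real) \<le> 1" by simp
    obtain l where "l \<in> increasing_bijections (-1) 1" "\<And>x. x \<in> {-1..1} \<Longrightarrow> \<bar>l x - x\<bar> < \<delta> n"
      "\<And>x. x \<in> {-1..1} \<Longrightarrow> dist (F n x) (f (l x)) < \<delta> n"
      using skorokhod_distD[OF lt le bdd] by blast
    then show ?thesis by blast
  qed
  then obtain l where l: "\<And>n. l n \<in> increasing_bijections (-1) 1"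
    "\<And>n x. x \<in> {-1..1} \<Longrightarrow> \<bar>l n x - x\<bar> < \<delta> n" "\<And>n x. x \<in> {-1..1} \<Longrightarrow> dist (F n x) (f (l n x)) < \<delta> n" by metis
  have "\<exists>k\<in>increasing_bijections (-1) 1. (\<forall>x\<in>{-1..1}. k (l n x) = x) \<and> (\<forall>x\<in>{-1..1}. l n (k x) = x)" for n
    by (rule increasing_bijections_inverse[OF l(1)[of n]]) blast
  then obtain k where k: "\<And>n. k n \<in> increasing_bijections (-1) 1"
    "\<And>n x. x \<in> {-1..1} \<Longrightarrow> k n (l n x) = x" "\<And>n x. x \<in> {-1..1} \<Longrightarrow> l n (k n x) = x" by metis
  have "\<delta> \<longlonglongrightarrow> 0 + 0" unfolding \<delta>_def by (intro tendsto_add assms(3) LIMSEQ_inverse_real_of_nat)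
  then have \<delta>: "eventually (\<lambda>n. \<delta> n < e) sequentially" if "0 < e" for e
    using that by (intro order_tendstoD(2)[of \<delta> 0]) auto
  show ?thesis
  proof (rule that[OF l(1) k])
    fix e :: real assume "0 < e"
    from \<delta>[OF this] show "eventually (\<lambda>n. \<forall>x\<in>{-1..1}. \<bar>l n x - x\<bar> < e) sequentially"
      by eventually_elim (meson l(2) order.strict_trans)
    from \<delta>[OF \<open>0 < e\<close>] show "eventually (\<lambda>n. close_path e f (\<lambda>u. F n (k n u))) sequentially"
    proof eventually_elim
      case (elim n)
      show ?case
        unfolding close_path_def
      proof (intro conjI ballI)
        show "spectrally_positive (\<lambda>u. F n (k n u))"
          by (rule spectrally_positive_time_change[OF k(1) excursion_spectrally_positive[OF assms(2)]])
        fix u :: real assume u: "u \<in> {-1..1}"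
        have "dist (F n (k n u)) (f (l n (k n u))) < \<delta> n"
          by (rule l(3)[OF increasing_bijectionsD(3)[OF k(1) u]])
        then show "\<bar>F n (k n u) - f u\<bar> \<le> e" using elim k(3)[OF u] by (simp add: dist_real_def)
      qed
    qed
  qed
qed

text \<open>Indicators converge pointwise off a null set and are bounded by 1, so no uniformity in
  \<open>s\<close> is required.\<close>

lemma measure_tendsto_1:
  fixes A :: "nat \<Rightarrow> real set"
  assumes A: "\<And>n. A n \<in> sets (restrict_space lborel {0..1})" and E: "finite E"
    and ev: "\<And>s. s \<in> {0..1} - E \<Longrightarrow> eventually (\<lambda>n. s \<in> A n) sequentially"
  shows "(\<lambda>n. measure (restrict_space lborel {0..1}) (A n)) \<longlonglongrightarrow> 1"
proof -
  let ?L = "restrict_space lborel {0..1::real}"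
  interpret L: prob_space ?L by (rule prob_space_unit_lebesgue)
  have "AE s in lborel. s \<notin> E"
    using E by (intro AE_not_in finite_imp_null_set_lborel)
  then have AE: "AE s in ?L. s \<notin> E \<and> s \<in> {0..1}"
    by (subst AE_restrict_space_iff) auto
  have "(\<lambda>n. integral\<^sup>L ?L (indicator (A n) :: real \<Rightarrow> real)) \<longlonglongrightarrow> integral\<^sup>L ?L (\<lambda>_. 1 :: real)"
  proof (rule integral_dominated_convergence[where w="\<lambda>_. 1"])
    show "AE s in ?L. (\<lambda>n. indicator (A n) s :: real) \<longlonglongrightarrow> 1"
      using AE
    proof eventually_elim
      case (elim s)
      then have "eventually (\<lambda>n. s \<in> A n) sequentially" using ev by blast
      then have "eventually (\<lambda>n. indicator (A n) s = (1::real)) sequentially" by eventually_elim simp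
      then show ?case by (rule tendsto_eventually)
    qed
  qed (use A in \<open>auto simp: indicator_def\<close>)
  moreover have "integral\<^sup>L ?L (indicator (A n) :: real \<Rightarrow> real) = measure ?L (A n)" for n
    using A[of n] sets.sets_into_space[OF A[of n]] by (simp add: space_restrict_space Int_absorb2)
  ultimately show ?thesis using L.prob_space by simp
qed

theorem theorem1p6:
  fixes \<Phi> :: "real \<Rightarrow> real \<Rightarrow> real"
    and f :: "real \<Rightarrow> real"
    and F :: "nat \<Rightarrow> real \<Rightarrow> real"
  assumes "shuffle \<Phi>"
    and "excursion f"
    and "\<And>n. excursion (F n)"
    and "(\<lambda>n. skorokhod_dist (-1) 1 dist (F n) f) \<longlonglongrightarrow> 0"
    and "bset f \<inter> disc \<Phi> = {}"
  shows "(\<lambda>n. GHP_dist (shuffled_vernation_tree \<Phi> (F n)) (shuffled_vernation_tree \<Phi> f)) \<longlonglongrightarrow> 0"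
proof -
  interpret shuffled_excursion \<Phi> f using assms by unfold_locales
  let ?G = "\<lambda>n. GHP_dist (shuffled_vernation_tree \<Phi> (F n)) (shuffled_vernation_tree \<Phi> f)"
  note spF = excursion_spectrally_positive[OF assms(3)]
  note pf = excursion_interval_pseudometric[OF assms(1,2)] and pF = excursion_interval_pseudometric[OF assms(1,3)]
  obtain l k where l: "\<And>n. l n \<in> increasing_bijections (-1) 1" and k: "\<And>n. k n \<in> increasing_bijections (-1) 1"
    and kl: "\<And>n x. x \<in> {-1..1} \<Longrightarrow> k n (l n x) = x" and lk: "\<And>n x. x \<in> {-1..1} \<Longrightarrow> l n (k n x) = x"
    and l_id: "\<And>e. 0 < e \<Longrightarrow> eventually (\<lambda>n. \<forall>x\<in>{-1..1}. \<bar>l n x - x\<bar> < e) sequentially"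
    and close: "\<And>\<rho>. 0 < \<rho> \<Longrightarrow> eventually (\<lambda>n. close_path \<rho> f (\<lambda>u. F n (k n u))) sequentially"
    using skorokhod_time_changes[OF assms(2-4)] by blast
  have l1: "l n t \<in> {-1..1}" and k1: "k n t \<in> {-1..1}" if "t \<in> {-1..1}" for n t
    using increasing_bijectionsD(3)[OF l that] increasing_bijectionsD(3)[OF k that] by blast+
  have sub: "s \<in> {-1..1}" if "s \<in> {0..1}" for s :: real using that by auto
  have tc: "tree_dist \<Phi> (\<lambda>u. F n (k n u)) s t = tree_dist \<Phi> (F n) (k n s) (k n t)" if "s \<in> {-1..1}" "t \<in> {-1..1}" for n s t
    by (rule tree_dist_time_change[OF k sp_cadlag[OF spF] that])
  have main: "eventually (\<lambda>n. ?G n \<le> ennreal (17 * \<epsilon>)) sequentially" if \<epsilon>: "0 < \<epsilon>" for \<epsilon>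
  proof -
    obtain P E \<rho> where P: "finite P" "P \<subseteq> {-1..1}" "1 \<in> P" and E: "finite E" and \<rho>: "0 < \<rho>"
      and net: "\<And>g s. close_path \<rho> f g \<Longrightarrow> s \<in> {-1..1} \<Longrightarrow> \<exists>p\<in>P. tree_dist \<Phi> g s p \<le> \<epsilon>"
      and dis: "\<And>g p q. close_path \<rho> f g \<Longrightarrow> p \<in> P \<Longrightarrow> q \<in> P \<Longrightarrow> \<bar>tree_dist \<Phi> g p q - tree_dist \<Phi> f p q\<bar> \<le> \<epsilon>"
      and generic: "\<And>s. s \<in> {-1..1} - E \<Longrightarrow> \<exists>\<rho>'>0. eventually (\<lambda>t. \<forall>g. close_path \<rho>' f g \<longrightarrow>
        tree_dist \<Phi> g t s \<le> \<epsilon> \<and> (\<forall>p\<in>P. \<bar>tree_dist \<Phi> g s p - tree_dist \<Phi> f s p\<bar> \<le> \<epsilon>)) (around s)"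
      using tree_dist_net[OF \<epsilon>] by blast
    have P1: "p \<in> {-1..1}" if "p \<in> P" for p using P(2) that by blast
    define a where "a n p = to_unit (k n p)" for n p
    define A where "A n = {s \<in> {0..1}. \<exists>p\<in>P. dV \<Phi> (F n) s (a n p) \<le> 4 * \<epsilon> \<and> dV \<Phi> f s (to_unit p) \<le> 4 * \<epsilon>}" for n
    have a01: "a n p \<in> {0..1}" "to_unit p \<in> {0..1}" if "p \<in> P" for n p
      unfolding a_def using to_unit_range[OF k1[OF P1[OF that]]] to_unit_range[OF P1[OF that]] .
    \<comment> \<open>Time \<open>s\<close> of \<open>F n\<close> is time \<open>l n s\<close> of
      the time-changed path, because \<open>k n\<close> inverts \<open>l n\<close>.\<close>
    have dF: "dV \<Phi> (F n) s (a n p) = tree_dist \<Phi> (\<lambda>u. F n (k n u)) (l n s) p" if s: "s \<in> {0..1}" and p: "p \<in> P" for n s p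
    proof -
      have "dV \<Phi> (F n) (to_unit s) (a n p) = tree_dist \<Phi> (F n) s (k n p)"
        unfolding a_def by (rule tree_dist_to_unit[OF assms(1,3) sub[OF s] k1[OF P1[OF p]]])
      then show ?thesis
        using tc[OF l1[OF sub[OF s]] P1[OF p]] kl[OF sub[OF s]] to_unit_id[OF s] by simp
    qed
    have df: "dV \<Phi> f s (to_unit p) = tree_dist \<Phi> f s p" if s: "s \<in> {0..1}" and p: "p \<in> P" for s p
      using tree_dist_to_unit[OF assms(1,2) sub[OF s] P1[OF p]] to_unit_id[OF s] by simp
    have netf: "\<exists>p\<in>P. tree_dist \<Phi> f s p \<le> \<epsilon>" if "s \<in> {-1..1}" for s
      using \<rho> that by (intro net close_path_refl sp) auto
    have "A n \<in> sets (restrict_space lborel {0..1})" for n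
    proof -
      have eq: "A n = (\<Union>p\<in>P. {s \<in> {0..1}. dV \<Phi> (F n) s (a n p) \<le> 4 * \<epsilon>} \<inter> {s \<in> {0..1}. dV \<Phi> f s (to_unit p) \<le> 4 * \<epsilon>})"
        unfolding A_def by blast
      show ?thesis
        unfolding eq
        by (intro sets.finite_UN P(1) sets.Int interval_pseudometric.dist_le_measurable[OF pf]
            interval_pseudometric.dist_le_measurable[OF pF] a01)
    qed
    moreover have "eventually (\<lambda>n. s \<in> A n) sequentially" if s: "s \<in> {0..1} - E" for s
    proof -
      have s01: "s \<in> {0..1}" and s1: "s \<in> {-1..1}" using s sub by blast+
      have "s \<in> {-1..1} - E" using s s1 by blast
      then obtain \<rho>' where \<rho>': "0 < \<rho>'" "eventually (\<lambda>t. \<forall>g. close_path \<rho>' f g \<longrightarrow>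
        tree_dist \<Phi> g t s \<le> \<epsilon> \<and> (\<forall>p\<in>P. \<bar>tree_dist \<Phi> g s p - tree_dist \<Phi> f s p\<bar> \<le> \<epsilon>)) (around s)"
        using generic by blast
      obtain d where d: "0 < d" "\<And>t g. t \<in> {-1..1} \<Longrightarrow> \<bar>t - s\<bar> < d \<Longrightarrow> close_path \<rho>' f g \<Longrightarrow>
        tree_dist \<Phi> g t s \<le> \<epsilon> \<and> (\<forall>p\<in>P. \<bar>tree_dist \<Phi> g s p - tree_dist \<Phi> f s p\<bar> \<le> \<epsilon>)"
        using \<rho>'(2) unfolding eventually_around by blast
      \<comment> \<open>This net point is chosen for \<open>f\<close> alone and serves all large
        \<open>n\<close>. For the other path the way from \<open>l n s\<close> through
        \<open>s\<close> to \<open>p\<close> has length at most \<open>3 * \<epsilon>\<close>, which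
        fits in the radius \<open>4 * \<epsilon>\<close>.\<close>
      obtain p where p: "p \<in> P" "tree_dist \<Phi> f s p \<le> \<epsilon>" using netf[OF s1] by blast
      show ?thesis
        using l_id[OF d(1)] close[OF \<rho>'(1)]
      proof eventually_elim
        case (elim n)
        let ?g = "\<lambda>u. F n (k n u)"
        have "\<bar>l n s - s\<bar> < d" using elim(1) s1 by blast
        from d(2)[OF l1[OF s1] this elim(2)]
        have "tree_dist \<Phi> ?g (l n s) s \<le> \<epsilon>" "\<bar>tree_dist \<Phi> ?g s p - tree_dist \<Phi> f s p\<bar> \<le> \<epsilon>" using p(1) by blast+
        moreover have "tree_dist \<Phi> ?g (l n s) p \<le> tree_dist \<Phi> ?g (l n s) s + tree_dist \<Phi> ?g s p"
          by (rule tree_dist_triangle[OF assms(1) close_pathD(1)[OF elim(2)] l1[OF s1] s1 P1[OF p(1)]])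
        ultimately have "dV \<Phi> (F n) s (a n p) \<le> 4 * \<epsilon>" unfolding dF[OF s01 p(1)] using p(2) \<epsilon> by linarith
        moreover have "dV \<Phi> f s (to_unit p) \<le> 4 * \<epsilon>" unfolding df[OF s01 p(1)] using p(2) \<epsilon> by linarith
        ultimately show "s \<in> A n" unfolding A_def using s01 p(1) by blast
      qed
    qed
    ultimately have "(\<lambda>n. measure (restrict_space lborel {0..1}) (A n)) \<longlonglongrightarrow> 1"
      by (intro measure_tendsto_1[OF _ E])
    then have "eventually (\<lambda>n. 1 - 17 * \<epsilon> < measure (restrict_space lborel {0..1}) (A n)) sequentially"
      using \<epsilon> by (intro order_tendstoD(1)[of _ 1]) auto
    then show ?thesis
      using close[OF \<rho>]
    proof eventually_elim
      case (elim n)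
      let ?g = "\<lambda>u. F n (k n u)"
      have "GHP_dist (interval_pseudometric.quotient_space (dV \<Phi> (F n))) (interval_pseudometric.quotient_space (dV \<Phi> f))
          \<le> ennreal (17 * \<epsilon>)"
      proof (rule GHP_dist_quotient_le[OF pF pf P(1), where a="a n" and b=to_unit and \<epsilon>=\<epsilon> and j=1 and A="A n"])
        show "a n p \<in> {0..1}" "to_unit p \<in> {0..1}" if "p \<in> P" for p using a01[OF that] by blast+
        show "0 \<le> \<epsilon>" using \<epsilon> by simp
        show "\<bar>dV \<Phi> (F n) (a n p) (a n q) - dV \<Phi> f (to_unit p) (to_unit q)\<bar> \<le> \<epsilon>" if pq: "p \<in> P" "q \<in> P" for p q
        proof -
          have "dV \<Phi> (F n) (a n p) (a n q) = tree_dist \<Phi> ?g p q"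
            unfolding a_def tc[OF P1[OF pq(1)] P1[OF pq(2)]]
            by (rule tree_dist_to_unit[OF assms(1,3) k1[OF P1[OF pq(1)]] k1[OF P1[OF pq(2)]]])
          moreover have "dV \<Phi> f (to_unit p) (to_unit q) = tree_dist \<Phi> f p q"
            by (rule tree_dist_to_unit[OF assms(1,2) P1[OF pq(1)] P1[OF pq(2)]])
          ultimately show ?thesis using dis[OF elim(2) pq] by simp
        qed
        fix s :: real assume s: "s \<in> {0..1}"
        obtain p where p: "p \<in> P" "tree_dist \<Phi> ?g (l n s) p \<le> \<epsilon>" using net[OF elim(2) l1[OF sub[OF s]]] by blast
        then have "dV \<Phi> (F n) s (a n p) \<le> 4 * \<epsilon>" unfolding dF[OF s p(1)] using \<epsilon> by linarith
        then show "\<exists>p\<in>P. dV \<Phi> (F n) s (a n p) \<le> 4 * \<epsilon>" using p(1) by blast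
        obtain q where q: "q \<in> P" "tree_dist \<Phi> f s q \<le> \<epsilon>" using netf[OF sub[OF s]] by blast
        then have "dV \<Phi> f s (to_unit q) \<le> 4 * \<epsilon>" unfolding df[OF s q(1)] using \<epsilon> by linarith
        then show "\<exists>p\<in>P. dV \<Phi> f s (to_unit p) \<le> 4 * \<epsilon>" using q(1) by blast
      next
        \<comment> \<open>Time changes fix 1, so the net point 1 represents the base point in both
          trees.\<close>
        have k_1: "k n 1 = 1" using increasing_bijections_endpoints(2)[OF k] by simp
        have one: "(1::real) \<in> {0..1}" by simp
        have "a n 1 = 1" "to_unit 1 = 1" by (simp_all add: a_def k_1 to_unit_def)
        then show "dV \<Phi> (F n) 1 (a n 1) \<le> 4 * \<epsilon>" "dV \<Phi> f 1 (to_unit 1) \<le> 4 * \<epsilon>"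
          using interval_pseudometric.d_refl[OF pF one] interval_pseudometric.d_refl[OF pf one] \<epsilon> by simp_all
      qed (use P(3) elim(1) A_def in auto)
      then show "?G n \<le> ennreal (17 * \<epsilon>)" by (simp add: shuffled_vernation_tree_eq[OF pF] shuffled_vernation_tree_eq[OF pf])
    qed
  qed
  show ?thesis
  proof (rule order_tendstoI)
    fix e :: ennreal assume "0 < e"
    then obtain c where c: "0 < c" "c < e" using dense by blast
    have "c < top" using c(2) top_greatest by (rule order.strict_trans2)
    then obtain x where x: "c = ennreal x" "0 < x"
      using c(1) by (cases c) auto
    have "eventually (\<lambda>n. ?G n \<le> ennreal (17 * (x / 17))) sequentially" using x by (intro main) simp
    then show "eventually (\<lambda>n. ?G n < e) sequentially"
      by eventually_elim (use c x in \<open>auto intro: order.strict_trans1\<close>)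
  qed simp
qed

end
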